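(* Suppose the smoothness assumption stated in the context holds and $\lambda=\lambda_n>0$ satisfies $\sqrt{n}\lambda=o(1)$, $n^{-1}\lambda^{-1/m}(-\log\lambda)^{2|S_{\sup}|-2}=o(1)$ and $\sqrt{n}\alpha_n=o(1)$ as $n\to\infty$, where $$\alpha_n=\beta_n\Big(n^{-1/2}\lambda^{-1/(4m)}(-\log\lambda)^{(|S_{\sup}|-1)/2}+\lambda^{1/2}J^{1/2}(f^\ast)\Big),$$ $$\beta_n=n^{-1/2}\lambda^{-1/(2m)}\lambda^{-1/(4m-2\tau-2)}\lambda^{1/(8m^2-4m\tau-4m)}(-\log\lambda)^{(|S_{\sup}|-1)(1-1/(4m-2\tau-2))}\Big(\log\big(\lambda^{1/(4m)-1/2}(-\log\lambda)^{(1-|S_{\sup}|)/2}\big)\Big)^{1/2}(\log n)^{1/2},$$ with $\tau=0$ if $|S_{\sup}|=1$ and $\tau$ a fixed value in $(0,2m-2)$ if $|S_{\sup}|>1$. Then for each $S\in\mathbb{S}\setminus\{\emptyset\}$, $$\|\hat f_S-f^\ast_S\|_{S,\lambda}=\mathcal{O}_{\mathbb{P}}\Big(n^{-1/2}\lambda^{-1/(4m)}(-\log\lambda)^{(|S|-1)/2}+\lambda^{1/2}J_S^{1/2}(f^\ast_S)\Big),$$ and for the intercept, $|\hat f_\emptyset-f^\ast_\emptyset|=\|\hat f_\emptyset-f^\ast_\emptyset\|_{\emptyset,\lambda}=\mathcal{O}_{\mathbb{P}}(n^{-1/2})$.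
   Context: Fix integers $d\ge1$ and $m\ge2$. For $j=1,\dots,d$, let $\mathcal{H}_{[j]}$ be the Sobolev space of $f\in\mathcal{L}_2[0,1]$ with $f,\dots,f^{(m-1)}$ absolutely continuous and $f^{(m)}\in\mathcal{L}_2[0,1]$. Let $\mathcal{H}_{\{j\}}=\{f\in\mathcal{H}_{[j]}:\int_0^1 f=0\}$ with inner product $\langle f,g\rangle_{\{j\}}=\sum_{l=1}^{m-1}\big(\int_0^1 f^{(l)}\big)\big(\int_0^1 g^{(l)}\big)+\int_0^1 f^{(m)}g^{(m)}$. For nonempty $S\subseteq\{1,\dots,d\}$, $\mathcal{H}_S=\otimes_{j\in S}\mathcal{H}_{\{j\}}$ (Hilbert tensor product; functions of $x_S=(x_{[j]})_{j\in S}\in[0,1]^{|S|}$) with the tensor-product inner product $\langle\cdot,\cdot\rangle_S$; $\mathcal{H}_\emptyset$ is the space of constants. Let $\mathbb{S}$ be a collection of subsets of $\{1,\dots,d\}$ with $\emptyset\in\mathbb{S}$, and $\mathcal{H}=\oplus_{S\in\mathbb{S}}\mathcal{H}_S$; each $f\in\mathcal{H}$ is uniquely $f=\sum_{S\in\mathbb{S}}f_S$ with $f_S\in\mathcal{H}_S$. Let $S_{\sup}$ be an element of $\mathbb{S}$ of maximal cardinality. Define $V_S(f_S,g_S)=\int_{[0,1]^{|S|}}f_Sg_S\,dx_S$ ($V_\emptyset(a,b)=ab$), $J_\emptyset=0$, $J_S(f_S,g_S)=\langle f_S,g_S\rangle_S$ for $S\ne\emptyset$, $J(f,g)=\sum_{S\in\mathbb{S}}J_S(f_S,g_S)$,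 $J(f)=J(f,f)$, $J_S(f_S)=J_S(f_S,f_S)$. For $\lambda>0$, $\|\cdot\|_{S,\lambda}$ is the norm of the inner product $V_S+\lambda J_S$ on $\mathcal{H}_S$. Data: $X$ has independent Uniform$[0,1]$ coordinates, $Y=f^\ast(X)+\epsilon$ with $f^\ast=\sum_{S\in\mathbb{S}}f^\ast_S\in\mathcal{H}$, $f^\ast_S\in\mathcal{H}_S$, $\epsilon$ independent of $X$, $\mathbb{E}\epsilon=0$, $\mathrm{Var}(\epsilon)=\sigma^2$, $\mathbb{E}\epsilon^4<\infty$; $(X_i,Y_i,\epsilon_i)$, $i=1,\dots,n$, are i.i.d. copies. Smoothness assumption: for each $S\in\mathbb{S}\setminus\{\emptyset\}$, $J_S(f^\ast_S)\le\mathcal{C}_{J,S}$ for a constant $\mathcal{C}_{J,S}\in(0,\infty)$. The estimator is $\hat f=\arg\min_{f\in\mathcal{H}}\frac1{2n}\sum_{i=1}^n(Y_i-f(X_i))^2+\frac\lambda2J(f)$, decomposed as $\hat f=\sum_{S\in\mathbb{S}}\hat f_S$ with $\hat f_S\in\mathcal{H}_S$. The tuning parameter $\lambda=\lambda_n$ depends on $n$. *)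

theory Defs
  imports "HOL-Probability.Probability"
begin

text \<open>g 0 = f, g l = f^(l); for l < m, g l is absolutely continuous with derivative g (l+1)
  (i.e. it is the indefinite integral of g (l+1)), and g m is square integrable on [0,1].\<close>
definition sob_chain :: "nat \<Rightarrow> (real \<Rightarrow> real) \<Rightarrow> (nat \<Rightarrow> real \<Rightarrow> real) \<Rightarrow> bool" where
  "sob_chain m f g \<longleftrightarrow>
     (\<forall>x\<in>{0..1}. g 0 x = f x) \<and>
     (\<forall>l<m. g (Suc l) absolutely_integrable_on {0..1} \<and>
            (\<forall>x\<in>{0..1}. g l x = g l 0 + integral {0..x} (g (Suc l)))) \<and>
     g m measurable_on {0..1} \<and> (\<lambda>t. (g m t)^2) integrable_on {0..1}"

definition sobolev :: "nat \<Rightarrow> (real \<Rightarrow> real) set" where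
  "sobolev m = {f. \<exists>g. sob_chain m f g}"

definition sob0 :: "nat \<Rightarrow> (real \<Rightarrow> real) set" where
  "sob0 m = {f \<in> sobolev m. integral {0..1} f = 0}"

definition sob_der :: "nat \<Rightarrow> (real \<Rightarrow> real) \<Rightarrow> nat \<Rightarrow> real \<Rightarrow> real" where
  "sob_der m f = (SOME g. sob_chain m f g)"

definition sob_ip :: "nat \<Rightarrow> (real \<Rightarrow> real) \<Rightarrow> (real \<Rightarrow> real) \<Rightarrow> real" where
  "sob_ip m f h =
     (\<Sum>l=1..m-1. integral {0..1} (sob_der m f l) * integral {0..1} (sob_der m h l))
     + integral {0..1} (\<lambda>t. sob_der m f m t * sob_der m h m t)"

definition cube :: "nat \<Rightarrow> (nat \<Rightarrow> real) set" where
  "cube d = PiE {1..d} (\<lambda>_. {0..1::real})"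

type_synonym tensor_rep = "(real \<times> (nat \<Rightarrow> real \<Rightarrow> real)) list"

definition tev :: "nat set \<Rightarrow> tensor_rep \<Rightarrow> (nat \<Rightarrow> real) \<Rightarrow> real" where
  "tev S L x = sum_list (map (\<lambda>(c, \<phi>). c * (\<Prod>j\<in>S. \<phi> j (x j))) L)"

definition tip :: "nat \<Rightarrow> nat set \<Rightarrow> tensor_rep \<Rightarrow> tensor_rep \<Rightarrow> real" where
  "tip m S L M = sum_list (map (\<lambda>(c, \<phi>). sum_list (map (\<lambda>(c', \<psi>).
       c * c' * (\<Prod>j\<in>S. sob_ip m (\<phi> j) (\<psi> j))) M)) L)"

definition rdiff :: "tensor_rep \<Rightarrow> tensor_rep \<Rightarrow> tensor_rep" where
  "rdiff L M = L @ map (\<lambda>(c, \<phi>). (- c, \<phi>)) M"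

text \<open>L is a Cauchy sequence (in the tensor norm) of algebraic tensors converging pointwise
  on the cube to f.  Since point evaluations are continuous on the RKHS H_S, the Hilbert
  tensor product (the completion) is exactly the set of such pointwise limits.\<close>
definition tapprox :: "nat \<Rightarrow> nat \<Rightarrow> nat set \<Rightarrow> ((nat \<Rightarrow> real) \<Rightarrow> real) \<Rightarrow> (nat \<Rightarrow> tensor_rep) \<Rightarrow> bool" where
  "tapprox m d S f L \<longleftrightarrow>
     (\<forall>k. \<forall>(c, \<phi>)\<in>set (L k). \<forall>j\<in>S. \<phi> j \<in> sob0 m) \<and>
     (\<forall>e>0. \<exists>N. \<forall>k\<ge>N. \<forall>l\<ge>N. tip m S (rdiff (L k) (L l)) (rdiff (L k) (L l)) < e) \<and>
     (\<forall>x\<in>cube d. (\<lambda>k. tev S (L k) x) \<longlonglongrightarrow> f x)"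

definition HS :: "nat \<Rightarrow> nat \<Rightarrow> nat set \<Rightarrow> ((nat \<Rightarrow> real) \<Rightarrow> real) set" where
  "HS m d S = {f. \<exists>L. tapprox m d S f L}"

definition JS :: "nat \<Rightarrow> nat \<Rightarrow> nat set \<Rightarrow> ((nat \<Rightarrow> real) \<Rightarrow> real) \<Rightarrow> real" where
  "JS m d S f = (if S = {} then 0
      else (let L = (SOME L. tapprox m d S f L) in lim (\<lambda>k. tip m S (L k) (L k))))"

definition unif_cube :: "nat \<Rightarrow> (nat \<Rightarrow> real) measure" where
  "unif_cube d = PiM {1..d} (\<lambda>_. uniform_measure lborel {0..1::real})"

text \<open>V_S(g,g) = integral of g^2 over x_S; for g depending only on x_S this equals the
  integral over the full uniform cube.\<close>
definition VS :: "nat \<Rightarrow> ((nat \<Rightarrow> real) \<Rightarrow> real) \<Rightarrow> real" where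
  "VS d g = (\<integral>x. (g x)^2 \<partial>unif_cube d)"

definition Snorm :: "nat \<Rightarrow> nat \<Rightarrow> real \<Rightarrow> nat set \<Rightarrow> ((nat \<Rightarrow> real) \<Rightarrow> real) \<Rightarrow> real" where
  "Snorm m d lam S g = sqrt (VS d g + lam * JS m d S g)"

text \<open>Objective written in terms of the (unique) ANOVA decomposition fam S = f_S.\<close>
definition pls_obj :: "nat \<Rightarrow> nat \<Rightarrow> nat set set \<Rightarrow> nat \<Rightarrow> (nat \<Rightarrow> nat \<Rightarrow> real) \<Rightarrow> (nat \<Rightarrow> real)
     \<Rightarrow> real \<Rightarrow> (nat set \<Rightarrow> (nat \<Rightarrow> real) \<Rightarrow> real) \<Rightarrow> real" where
  "pls_obj m d SS n X Y lam fam =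
     (\<Sum>i<n. (Y i - (\<Sum>S\<in>SS. fam S (X i)))^2) / (2 * real n)
     + lam / 2 * (\<Sum>S\<in>SS. JS m d S (fam S))"

definition is_pls_min :: "nat \<Rightarrow> nat \<Rightarrow> nat set set \<Rightarrow> nat \<Rightarrow> (nat \<Rightarrow> nat \<Rightarrow> real) \<Rightarrow> (nat \<Rightarrow> real)
     \<Rightarrow> real \<Rightarrow> (nat set \<Rightarrow> (nat \<Rightarrow> real) \<Rightarrow> real) \<Rightarrow> bool" where
  "is_pls_min m d SS n X Y lam fam \<longleftrightarrow>
     (\<forall>S\<in>SS. fam S \<in> HS m d S) \<and>
     (\<forall>fam'. (\<forall>S\<in>SS. fam' S \<in> HS m d S) \<longrightarrow>
        pls_obj m d SS n X Y lam fam \<le> pls_obj m d SS n X Y lam fam')"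

definition sample_space :: "nat \<Rightarrow> real measure \<Rightarrow> nat \<Rightarrow> (nat \<Rightarrow> (nat \<Rightarrow> real) \<times> real) measure" where
  "sample_space d \<nu> n = PiM {..<n} (\<lambda>_. unif_cube d \<Otimes>\<^sub>M \<nu>)"

text \<open>Z_n = O_P(r_n), with outer probability (no measurability requirement on Z_n).\<close>
definition bigOP :: "(nat \<Rightarrow> 'a measure) \<Rightarrow> (nat \<Rightarrow> 'a \<Rightarrow> real) \<Rightarrow> (nat \<Rightarrow> real) \<Rightarrow> bool" where
  "bigOP P Z r \<longleftrightarrow> (\<forall>\<epsilon>>0. \<exists>M N. \<forall>n\<ge>N. \<exists>A\<in>sets (P n).
      {\<omega>\<in>space (P n). \<bar>Z n \<omega>\<bar> > M * r n} \<subseteq> A \<and> measure (P n) A < \<epsilon>)"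

definition beta_n :: "nat \<Rightarrow> real \<Rightarrow> nat \<Rightarrow> nat \<Rightarrow> real \<Rightarrow> real" where
  "beta_n m \<tau> s n lam =
     real n powr (-1/2) * lam powr (-1 / (2 * real m))
     * lam powr (-1 / (4 * real m - 2 * \<tau> - 2))
     * lam powr (1 / (8 * (real m)^2 - 4 * real m * \<tau> - 4 * real m))
     * (- ln lam) powr ((real s - 1) * (1 - 1 / (4 * real m - 2 * \<tau> - 2)))
     * sqrt (ln (lam powr (1 / (4 * real m) - 1/2) * (- ln lam) powr ((1 - real s) / 2)))
     * sqrt (ln (real n))"

definition alpha_n :: "nat \<Rightarrow> real \<Rightarrow> nat \<Rightarrow> nat \<Rightarrow> real \<Rightarrow> real \<Rightarrow> real" where
  "alpha_n m \<tau> s n lam Jstar =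
     beta_n m \<tau> s n lam *
     (real n powr (-1/2) * lam powr (-1 / (4 * real m)) * (- ln lam) powr ((real s - 1) / 2)
      + sqrt lam * sqrt Jstar)"

end

theory Submission
  imports Defs "HOL-Computational_Algebra.Polynomial" "HOL-Real_Asymp.Real_Asymp"
begin

text \<open>The Legendre polynomials on \<open>[0, 1]\<close> are orthonormal, and they diagonalise the differential
  operator \<open>(-1)\<^sup>m D\<^sup>m w\<^sup>m D\<^sup>m\<close> with \<open>w = x (1 - x)\<close>, whose eigenvalues grow like \<open>k\<^sup>2\<^sup>m\<close>. Therefore the
  Legendre coefficients \<open>c\<close> of a function in \<open>H_S\<close> satisfy \<open>\<Sum> (\<Prod> k_j)\<^sup>2\<^sup>m c\<^sub>k\<^sup>2 \<le> C J_S\<close>, and this inequality replaces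
  the joint diagonalisation of \<open>V_S\<close> and \<open>J_S\<close>.

  Let \<open>\<delta>_S\<close> be the error of the component \<open>S\<close> of the estimator and \<open>e_S\<^sup>2 = V_S + \<lambda> J_S\<close> at \<open>\<delta>_S\<close>. The first order
  condition in the direction \<open>\<delta>_S\<close> expresses \<open>e_S\<^sup>2\<close> by the noise functional at \<open>\<delta>_S\<close>, the bias term
  \<open>\<lambda> J_S(f*_S, \<delta>_S)\<close>, and the differences between the empirical and the true inner products of \<open>\<delta>_S\<close> with all
  \<open>\<delta>_S'\<close>; the true ones vanish for \<open>S' \<noteq> S\<close>. By the Cauchy-Schwarz inequality in weighted
  coefficients this gives \<open>e_S \<le> K T_S + (\<lambda> J_S(f*_S))\<^sup>1\<^sup>/\<^sup>2 + K B \<Sum> e_S'\<close>, where \<open>T_S\<close> and \<open>B\<close> are Hilbert-Schmidt type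
  norms whose second moments are sums of \<open>1 / (1 + \<lambda> (\<Prod> k_j)\<^sup>2\<^sup>m)\<close>. Such a sum is of order
  \<open>\<lambda>\<close> to the power \<open>-1/(2m)\<close> times a power of \<open>-log \<lambda>\<close>. It follows that \<open>T_S\<close> has the claimed rate and that \<open>B\<close> is at most
  of order \<open>\<beta>\<^sub>n\<close>; as \<open>n\<^sup>1\<^sup>/\<^sup>2 \<alpha>\<^sub>n\<close> tends to zero, the sum on the right is absorbed with a remainder \<open>o(n\<^sup>-\<^sup>1\<^sup>/\<^sup>2)\<close>.\<close>

subsection \<open>Polynomials on the unit interval and Legendre polynomials\<close>

text \<open>The Legendre basis is explicit, but not uniformly bounded: squared values grow like the
  product of the degrees. In the second moment of \<open>B\<close> this costs one factor
  \<open>lam powr (-1 / (2 * real m))\<close>, so that \<open>B\<close> is of order n^(-1/2)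
  \<lambda>^(-3/(4m)) (-log \<lambda>)^(s-1), where s is the maximal cardinality. For \<tau> = 0 the
  powers of \<lambda> in \<open>beta_n\<close> multiply to exactly this one. For \<tau> > 0 they
  exceed it by a positive power of 1/\<lambda>, which pays for the smaller power of the logarithm.
  Nothing is known about the measurability of the estimator. The exceptional events are therefore
  built from noise and design alone, and outside them the error inequality holds for every
  minimiser. The errors of the largest components enter the equations of the intercept and of all
  small components. Their product with \<open>B\<close> has to be negligible against n^(-1/2), and
  this is the role of n^(1/2) \<alpha>_n tending to zero.\<close>

definition pint :: "real poly \<Rightarrow> real" where
  "pint p = integral {0..1} (poly p)"

lemma continuous_on_poly_real [continuous_intros]: "continuous_on X (poly (p::real poly))"
  by (intro continuous_at_imp_continuous_on ballI poly_isCont)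

lemma poly_integrable_on [simp]: "poly (p::real poly) integrable_on {a..b}"
  by (rule integrable_continuous_interval) (rule continuous_on_poly_real)

lemma pint_add: "pint (p + q) = pint p + pint q"
  using integral_add[of "poly p" "{0..1}" "poly q"] by (simp add: pint_def poly_add[abs_def])

lemma pint_diff: "pint (p - q) = pint p - pint q"
  using integral_diff[of "poly p" "{0..1}" "poly q"] by (simp add: pint_def poly_diff[abs_def])


lemma pint_smult: "pint (smult c p) = c * pint p"
  by (simp add: pint_def poly_smult[abs_def])

lemma pint_0 [simp]: "pint 0 = 0"
  by (simp add: pint_def poly_0[abs_def])

lemma pint_sum: "pint (sum f X) = (\<Sum>x\<in>X. pint (f x))"
  by (induction X rule: infinite_finite_induct) (simp_all add: pint_add)

lemma pint_1 [simp]: "pint 1 = 1"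
  by (simp add: pint_def poly_1[abs_def])

lemma pint_nonneg: "(\<And>x. x \<in> {0..1} \<Longrightarrow> 0 \<le> poly p x) \<Longrightarrow> 0 \<le> pint p"
  unfolding pint_def by (rule integral_nonneg) auto

lemma pint_mono: "(\<And>x. x \<in> {0..1} \<Longrightarrow> poly p x \<le> poly q x) \<Longrightarrow> pint p \<le> pint q"
  using pint_nonneg[of "q - p"] by (simp add: pint_diff)

lemma pint_pderiv: "pint (pderiv p) = poly p 1 - poly p 0"
proof -
  have "(poly (pderiv p) has_integral (poly p 1 - poly p 0)) {0..1}"
    by (rule fundamental_theorem_of_calculus)
      (auto intro!: DERIV_subset[OF poly_DERIV]
        simp flip: has_real_derivative_iff_has_vector_derivative)
  then show ?thesis by (simp add: pint_def integral_unique)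
qed

lemma pint_square_eq_0:
  assumes "pint (p * p) = 0" shows "p = 0"
proof -
  have "(poly (p * p) has_integral 0) {0..1}"
    using assms unfolding pint_def by (metis has_integral_integral poly_integrable_on)
  then have z: "poly (p * p) x = 0" if "x \<in> {0..1}" for x
    using has_integral_0_cbox_imp_0[of 0 1 "poly (p * p)" x] that continuous_on_poly_real[of "{0..1}" "p * p"]
    by (auto simp del: poly_mult) (auto simp: zero_le_mult_iff)
  have "{0..1} \<subseteq> {x. poly p x = 0}" using z by auto
  moreover have "infinite {0..1::real}" by (simp add: infinite_Icc)
  ultimately show ?thesis using poly_roots_finite finite_subset by blast
qed

lemma pint_square_nonneg: "0 \<le> pint (p * p)"
  by (rule pint_nonneg) simp

lemma pint_by_parts:
  assumes "poly u 0 = 0" "poly u 1 = 0"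
  shows "pint (pderiv u * v) = - pint (u * pderiv v)"
  using pint_pderiv[of "u * v"] assms
  by (simp add: pderiv_mult pint_add algebra_simps)

definition Wp :: "real poly" where "Wp = [:0, 1, -1:]"

lemma poly_Wp: "poly Wp x = x * (1 - x)"
  by (simp add: Wp_def algebra_simps)

lemma degree_Wp: "degree Wp = 2"
  by (simp add: Wp_def)

text \<open>Divisibility by \<open>Wp ^ n\<close> encodes vanishing of order n at both endpoints.
  Each differentiation uses up one order, so that all boundary terms vanish in n successive
  integrations by parts.\<close>

lemma Wp_dvd_pderiv:
  assumes "Wp ^ Suc n dvd u" shows "Wp ^ n dvd pderiv u"
proof -
  obtain q where "u = Wp ^ Suc n * q" using assms by blast
  then have "pderiv u = Wp ^ n * (smult (real (Suc n)) (pderiv Wp) * q + Wp * pderiv q)"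
    by (simp only: pderiv_mult pderiv_power_Suc) (simp add: algebra_simps)
  then show ?thesis by simp
qed

lemma pint_iterated_by_parts:
  assumes "Wp ^ n dvd u"
  shows "pint ((pderiv ^^ n) u * v) = (-1) ^ n * pint (u * (pderiv ^^ n) v)"
  using assms
proof (induction n arbitrary: u v)
  case (Suc n)
  have "Wp dvd u" using Suc.prems by (metis dvd_trans dvd_triv_left power_Suc)
  then obtain q where q: "u = Wp * q" by blast
  have "pint ((pderiv ^^ Suc n) u * v) = pint ((pderiv ^^ n) (pderiv u) * v)"
    by (simp add: funpow_swap1)
  also have "\<dots> = (-1) ^ n * pint (pderiv u * (pderiv ^^ n) v)"
    using Suc.IH Wp_dvd_pderiv[OF Suc.prems] by blast
  also have "\<dots> = (-1) ^ Suc n * pint (u * (pderiv ^^ Suc n) v)"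
    by (subst pint_by_parts) (auto simp: q poly_Wp)
  finally show ?case .
qed simp

lemma degree_funpow_pderiv: "degree ((pderiv ^^ n) (p::real poly)) = degree p - n"
  by (induction n) (auto simp: degree_pderiv)

lemma funpow_pderiv_eq_0: "degree (p::real poly) < n \<Longrightarrow> (pderiv ^^ n) p = 0"
  by (rule poly_eqI) (simp add: coeff_higher_pderiv coeff_eq_0)

text \<open>Rodrigues' formula without its scalar factor, in the variable of the unit
  interval.\<close>

definition Rod :: "nat \<Rightarrow> real poly" where "Rod k = (pderiv ^^ k) (Wp ^ k)"

definition Leg :: "nat \<Rightarrow> real poly" where
  "Leg k = smult (1 / sqrt (pint (Rod k * Rod k))) (Rod k)"

lemma degree_Rod: "degree (Rod k) = k"
  by (simp add: Rod_def degree_funpow_pderiv degree_power_eq degree_Wp Wp_def)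

lemma Rod_nz: "Rod k \<noteq> 0"
proof
  assume a: "Rod k = 0"
  have "degree (Wp ^ k) = 2 * k" by (simp add: degree_power_eq degree_Wp Wp_def)
  \<comment> \<open>The top coefficient survives k differentiations, being multiplied by a positive
    Pochhammer symbol.\<close>
  then have "coeff (Wp ^ k) (k + k) \<noteq> 0"
    by (metis Wp_def leading_coeff_0_iff mult_2 pCons_eq_0_iff power_not_zero zero_neq_one)
  moreover have "coeff (Rod k) k = pochhammer (of_nat (Suc k)) k * coeff (Wp ^ k) (k + k)"
    unfolding Rod_def by (rule coeff_higher_pderiv)
  moreover have "pochhammer (of_nat (Suc k) :: real) k > 0"
    by (rule pochhammer_pos) simp
  ultimately show False using a by simp
qed

lemma Rod_norm_pos: "0 < pint (Rod k * Rod k)"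
  using pint_square_nonneg[of "Rod k"] pint_square_eq_0[of "Rod k"] Rod_nz[of k] by force

lemma degree_Leg: "degree (Leg k) = k"
  using Rod_norm_pos[of k] by (simp add: Leg_def degree_Rod)

lemma Leg_nz: "Leg k \<noteq> 0"
  using Rod_norm_pos[of k] by (simp add: Leg_def Rod_nz)

lemma Leg_0 [simp]: "Leg 0 = 1"
  by (simp add: Leg_def Rod_def)

text \<open>Repeated integration by parts moves all k derivatives of Rodrigues' formula onto
  \<open>v\<close>, whose k-th derivative is zero.\<close>

lemma Leg_orth_lower:
  assumes "degree v < k" shows "pint (Leg k * v) = 0"
proof -
  have "pint (Rod k * v) = (-1) ^ k * pint (Wp ^ k * (pderiv ^^ k) v)"
    unfolding Rod_def by (rule pint_iterated_by_parts) simp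
  also have "\<dots> = 0" using funpow_pderiv_eq_0[OF assms] by simp
  finally show ?thesis by (simp add: Leg_def pint_smult)
qed

lemma Leg_orthonormal: "pint (Leg i * Leg j) = (if i = j then 1 else 0)"
proof (cases i j rule: linorder_cases)
  case less
  then show ?thesis using Leg_orth_lower[of "Leg i" j] by (simp add: degree_Leg mult.commute)
next
  case greater
  then show ?thesis using Leg_orth_lower[of "Leg j" i] by (simp add: degree_Leg)
next
  case equal
  have "sqrt (pint (Rod j * Rod j)) * sqrt (pint (Rod j * Rod j)) = pint (Rod j * Rod j)"
    using Rod_norm_pos[of j] by simp
  then show ?thesis using equal Rod_norm_pos[of j] by (simp add: Leg_def pint_smult field_simps)
qed

lemma Leg_span: "degree p \<le> n \<Longrightarrow> \<exists>a. p = (\<Sum>j\<le>n. smult (a j) (Leg j))"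
proof (induction n arbitrary: p)
  case 0
  then obtain c where "p = [:c:]" by (metis degree_eq_zeroE le_zero_eq)
  then show ?case by (intro exI[of _ "\<lambda>_. c"]) simp
next
  case (Suc n)
  define a where "a = coeff p (Suc n) / lead_coeff (Leg (Suc n))"
  define r where "r = p - smult a (Leg (Suc n))"
  have "coeff r i = 0" if "i > n" for i
  proof (cases "i = Suc n")
    case True
    then show ?thesis using Leg_nz[of "Suc n"] leading_coeff_0_iff[of "Leg (Suc n)"]
      by (simp add: r_def a_def degree_Leg)
  next
    case False
    then show ?thesis using that Suc.prems by (simp add: r_def coeff_eq_0 degree_Leg)
  qed
  then have "degree r \<le> n" by (simp add: degree_le)
  then obtain b where b: "r = (\<Sum>j\<le>n. smult (b j) (Leg j))" using Suc.IH by blast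
  have "p = r + smult a (Leg (Suc n))" by (simp add: r_def)
  also have "\<dots> = (\<Sum>j\<le>Suc n. smult ((b(Suc n := a)) j) (Leg j))" by (simp add: b)
  finally show ?case by blast
qed

lemma Leg_expansion:
  assumes "degree p \<le> n" shows "p = (\<Sum>j\<le>n. smult (pint (p * Leg j)) (Leg j))"
proof -
  obtain a where a: "p = (\<Sum>j\<le>n. smult (a j) (Leg j))" using Leg_span[OF assms] by blast
  have "pint (p * Leg i) = a i" if "i \<le> n" for i
  proof -
    have "pint (p * Leg i) = (\<Sum>j\<le>n. a j * pint (Leg j * Leg i))"
      by (simp add: a sum_distrib_right pint_sum pint_smult)
    also have "\<dots> = a i" using that by (simp add: Leg_orthonormal if_distrib cong: if_cong)
    finally show ?thesis .
  qed
  then show ?thesis using a by (metis (no_types, lifting) atMost_iff sum.cong)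
qed

section \<open>The differential operator of order 2m and its eigenvalues\<close>

definition leg_op :: "nat \<Rightarrow> real poly \<Rightarrow> real poly" where
  "leg_op m p = smult ((-1) ^ m) ((pderiv ^^ m) (Wp ^ m * (pderiv ^^ m) p))"

lemma pint_leg_op: "pint (leg_op m p * q) = pint (Wp ^ m * ((pderiv ^^ m) p * (pderiv ^^ m) q))"
proof -
  have "pint (leg_op m p * q) = (-1) ^ m * pint ((pderiv ^^ m) (Wp ^ m * (pderiv ^^ m) p) * q)"
    by (simp add: leg_op_def pint_smult)
  also have "\<dots> = (-1) ^ m * ((-1) ^ m * pint (Wp ^ m * (pderiv ^^ m) p * (pderiv ^^ m) q))"
    by (subst pint_iterated_by_parts) auto
  finally show ?thesis by (simp add: mult.assoc flip: power_add mult_2)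
qed

lemma pint_leg_op_sym: "pint (leg_op m p * q) = pint (leg_op m q * p)"
  unfolding pint_leg_op by (simp only: mult.commute[of "(pderiv ^^ m) p"])

text \<open>The factor \<open>Wp ^ m\<close> raises the degree by 2m, and the 2m derivatives lower
  it again.\<close>

lemma degree_leg_op: "degree (leg_op m p) \<le> degree p"
proof (cases "degree p < m")
  case True
  then show ?thesis by (simp add: leg_op_def funpow_pderiv_eq_0)
next
  case False
  have "degree (Wp ^ m * (pderiv ^^ m) p) \<le> 2 * m + (degree p - m)"
    by (rule order.trans[OF degree_mult_le])
      (simp add: degree_funpow_pderiv degree_power_eq degree_Wp Wp_def)
  then show ?thesis using False
    by (simp add: leg_op_def degree_funpow_pderiv)
qed

definition leg_mu :: "nat \<Rightarrow> nat \<Rightarrow> real" where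
  "leg_mu m k = pint (leg_op m (Leg k) * Leg k)"

text \<open>The operator does not raise degrees, hence is triangular in the Legendre basis; being
  symmetric, it is diagonal.\<close>

lemma leg_op_Leg: "leg_op m (Leg k) = smult (leg_mu m k) (Leg k)"
proof -
  have "pint (leg_op m (Leg k) * Leg j) = 0" if "j < k" for j
  proof -
    have "pint (leg_op m (Leg k) * Leg j) = pint (leg_op m (Leg j) * Leg k)"
      by (rule pint_leg_op_sym)
    also have "\<dots> = pint (Leg k * leg_op m (Leg j))" by (subst mult.commute) (rule refl)
    also have "\<dots> = 0" using that degree_leg_op[of m "Leg j"]
      by (intro Leg_orth_lower) (simp add: degree_Leg)
    finally show ?thesis .
  qed
  then have "(\<Sum>j\<le>k. smult (pint (leg_op m (Leg k) * Leg j)) (Leg j))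
      = (\<Sum>j\<le>k. if j = k then smult (leg_mu m k) (Leg k) else 0)"
    by (intro sum.cong) (auto simp: leg_mu_def)
  then show ?thesis
    using Leg_expansion[of "leg_op m (Leg k)" k] degree_leg_op[of m "Leg k"]
    by (simp add: degree_Leg)
qed

text \<open>Comparison of the coefficients of x^k in the eigenvalue equation. The leading
  coefficient (-1)^m of \<open>Wp ^ m\<close> cancels the sign in \<open>leg_op\<close>.\<close>

lemma leg_mu_eq:
  assumes "m \<le> k"
  shows "leg_mu m k = pochhammer (real (Suc (k - m))) m * pochhammer (real (Suc k)) m"
proof -
  let ?D = "(pderiv ^^ m) (Leg k)"
  have dW: "degree (Wp ^ m) = 2 * m" by (simp add: degree_power_eq degree_Wp Wp_def)
  have lW: "coeff (Wp ^ m) (2 * m) = (-1) ^ m"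
    using lead_coeff_power[of Wp m] by (simp add: dW) (simp add: Wp_def)
  have dD: "degree ?D = k - m" by (simp add: degree_funpow_pderiv degree_Leg)
  have cD: "coeff ?D (k - m) = pochhammer (real (Suc (k - m))) m * coeff (Leg k) k"
    using assms by (simp add: coeff_higher_pderiv)
  have "coeff (leg_op m (Leg k)) k
     = (-1) ^ m * (pochhammer (real (Suc k)) m * coeff (Wp ^ m * ?D) (k + m))"
    by (simp add: leg_op_def coeff_higher_pderiv)
  also have "k + m = degree (Wp ^ m) + degree ?D" using assms by (simp add: dW dD)
  also have "coeff (Wp ^ m * ?D) (degree (Wp ^ m) + degree ?D)
      = (-1) ^ m * (pochhammer (real (Suc (k - m))) m * coeff (Leg k) k)"
    by (simp only: coeff_mult_degree_sum) (simp add: dW dD lW cD)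
  finally have "leg_mu m k * coeff (Leg k) k
     = ((-1) ^ m * (-1) ^ m) * (pochhammer (real (Suc (k - m))) m * pochhammer (real (Suc k)) m) * coeff (Leg k) k"
    unfolding leg_op_Leg coeff_smult by (simp only: mult_ac)
  moreover have "(-1::real) ^ m * (-1) ^ m = 1" by (simp flip: power_add mult_2)
  moreover have "coeff (Leg k) k \<noteq> 0" using Leg_nz[of k] leading_coeff_0_iff[of "Leg k"] by (simp add: degree_Leg)
  ultimately show ?thesis by simp
qed

lemma power_le_pochhammer: "0 \<le> (a::real) \<Longrightarrow> a ^ n \<le> pochhammer a n"
proof (induction n)
  case (Suc n)
  then have "a ^ n * a \<le> pochhammer a n * (a + real n)"
    by (intro mult_mono) (auto intro: order.trans[OF zero_le_power])
  then show ?case by (simp add: pochhammer_Suc mult.commute)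
qed simp

text \<open>Of the 2m factors of \<open>leg_mu m k\<close>, m are at least k + 1 and the others at
  least k - m + 1. A factor m + 1 for each of the latter covers the ratio of k to k - m + 1.\<close>

lemma leg_mu_lower:
  assumes "m \<le> k" shows "real k ^ (2 * m) \<le> (real m + 1) ^ m * leg_mu m k"
proof -
  have a: "real k \<le> (real m + 1) * real (Suc (k - m))"
  proof -
    have "0 \<le> real m * (real k - real m)" using assms by simp
    then show ?thesis using assms by (simp add: of_nat_diff algebra_simps)
  qed
  have "real k ^ (2 * m) = real k ^ m * real k ^ m" by (simp add: mult_2 power_add)
  also have "\<dots> \<le> ((real m + 1) * real (Suc (k - m))) ^ m * real (Suc k) ^ m"
    using a by (intro mult_mono power_mono) auto
  also have "\<dots> = (real m + 1) ^ m * (real (Suc (k - m)) ^ m * real (Suc k) ^ m)"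
    by (simp add: power_mult_distrib)
  also have "\<dots> \<le> (real m + 1) ^ m * (pochhammer (real (Suc (k - m))) m * pochhammer (real (Suc k)) m)"
    by (intro mult_left_mono mult_mono power_le_pochhammer) (auto intro!: pochhammer_nonneg)
  finally show ?thesis by (simp add: leg_mu_eq[OF assms])
qed

lemma leg_mu_nonneg: "0 \<le> leg_mu m k"
  unfolding leg_mu_def pint_leg_op
  by (rule pint_nonneg) (simp add: poly_Wp)

lemma pint_mult_Leg_expansion:
  assumes "degree s \<le> n"
  shows "pint (s * q) = (\<Sum>j\<le>n. pint (s * Leg j) * pint (Leg j * q))"
proof -
  have "pint (s * q) = pint ((\<Sum>j\<le>n. smult (pint (s * Leg j)) (Leg j)) * q)"
    using Leg_expansion[OF assms] by simp
  then show ?thesis by (simp add: sum_distrib_right pint_sum pint_smult)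
qed

lemma pint_square_Leg: "degree s \<le> n \<Longrightarrow> pint (s * s) = (\<Sum>j\<le>n. (pint (s * Leg j))\<^sup>2)"
  by (subst pint_mult_Leg_expansion) (auto simp: power2_eq_square mult.commute)

text \<open>The left side equals the integral of \<open>Wp ^ m\<close> times the squared m-th
  derivative; the inequality is the bound 1 for \<open>Wp\<close> on the unit interval.\<close>

lemma sum_leg_mu_le:
  assumes "degree s \<le> n"
  shows "(\<Sum>j\<le>n. leg_mu m j * (pint (s * Leg j))\<^sup>2) \<le> pint ((pderiv ^^ m) s * (pderiv ^^ m) s)"
proof -
  have "pint (leg_op m s * s) = pint (s * leg_op m s)" by (subst mult.commute) (rule refl)
  also have "\<dots> = (\<Sum>j\<le>n. pint (s * Leg j) * pint (leg_op m (Leg j) * s))"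
  proof (subst pint_mult_Leg_expansion[OF assms], intro sum.cong refl)
    fix j
    have "pint (Leg j * leg_op m s) = pint (leg_op m s * Leg j)" by (subst mult.commute) (rule refl)
    also have "\<dots> = pint (leg_op m (Leg j) * s)" by (rule pint_leg_op_sym)
    finally show "pint (s * Leg j) * pint (Leg j * leg_op m s) = pint (s * Leg j) * pint (leg_op m (Leg j) * s)"
      by (simp only:)
  qed
  also have "\<dots> = (\<Sum>j\<le>n. leg_mu m j * (pint (s * Leg j))\<^sup>2)"
    by (simp add: leg_op_Leg pint_smult power2_eq_square mult.commute mult.left_commute)
  finally have "(\<Sum>j\<le>n. leg_mu m j * (pint (s * Leg j))\<^sup>2)
     = pint (Wp ^ m * ((pderiv ^^ m) s * (pderiv ^^ m) s))"
    by (simp add: pint_leg_op)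
  also have "\<dots> \<le> pint ((pderiv ^^ m) s * (pderiv ^^ m) s)"
  proof (rule pint_mono)
    fix x :: real assume "x \<in> {0..1}"
    then have "0 \<le> x * (1 - x)" "x * (1 - x) \<le> 1" by (auto intro: mult_le_one)
    then have "(x * (1 - x)) ^ m \<le> 1" by (rule power_le_one)
    then show "poly (Wp ^ m * ((pderiv ^^ m) s * (pderiv ^^ m) s)) x \<le> poly ((pderiv ^^ m) s * (pderiv ^^ m) s) x"
      by (simp add: poly_Wp mult_left_le_one_le mult_le_cancel_right1 del: mult_le_cancel_right1)
        (metis (no_types, opaque_lifting) mult.commute mult_left_le zero_le_square)
  qed
  finally show ?thesis .
qed

section \<open>Legendre's equation, endpoint values and the uniform bound\<close>

lemma Leg_ode: "pderiv (Wp * pderiv (Leg k)) = smult (- (real k * (real k + 1))) (Leg k)"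
\<comment> \<open>This is the eigenvalue equation with \<open>m = 1\<close>, for which
  \<open>leg_mu_eq\<close> asks for k \<ge> 1; for k = 0 both sides vanish.\<close>
proof (cases "k = 0")
  case False
  then have "leg_mu 1 k = real k * (real k + 1)" by (simp add: leg_mu_eq of_nat_diff)
  then have "smult (- 1) (pderiv (Wp * pderiv (Leg k))) = smult (real k * (real k + 1)) (Leg k)"
    using leg_op_Leg[of 1 k] by (simp add: leg_op_def)
  then show ?thesis by (metis minus_minus smult_1_left smult_minus_left)
qed simp

text \<open>For P = \<open>Leg k\<close> the polynomial x P' - k P has degree below k and is
  orthogonal to P, so that the integral of x P P' is k. Integrating the derivatives of x P^2 and (1
  - x) P^2 then gives the two values.\<close>

lemma Leg_endpoint: "(poly (Leg k) 1)\<^sup>2 = 2 * real k + 1" "(poly (Leg k) 0)\<^sup>2 = 2 * real k + 1"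
proof -
  let ?P = "Leg k" and ?X = "[:0, 1:] :: real poly"
  define r where "r = ?X * pderiv ?P - smult (real k) ?P"
  have coeffr: "coeff r i = (real i - real k) * coeff ?P i" for i
    by (cases i) (auto simp: r_def coeff_pderiv algebra_simps)
  have rz: "pint (?P * r) = 0"
  proof (cases "k = 0")
    case True then show ?thesis by (simp add: r_def)
  next
    case False
    have "degree r < k"
      using False coeffr by (intro degree_lessI) (auto simp: coeff_eq_0 degree_Leg le_less)
    then show ?thesis by (rule Leg_orth_lower)
  qed
  have XP: "pint (?P * (?X * pderiv ?P)) = real k"
  proof -
    have "?X * pderiv ?P = r + smult (real k) ?P" by (simp add: r_def)
    then show ?thesis using rz by (simp only: distrib_left pint_add) (simp add: pint_smult Leg_orthonormal)
  qed
  have PP: "pint (?P * pderiv ?P) = 0"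
  proof (cases "k = 0")
    case False
    then show ?thesis by (intro Leg_orth_lower) (simp add: degree_pderiv degree_Leg)
  qed simp
  have n: "pint (?P * ?P) = 1" by (simp add: Leg_orthonormal)
  have "pderiv (?X * (?P * ?P)) = ?P * ?P + smult 2 (?P * (?X * pderiv ?P))"
    by (rule poly_eq_poly_eq_iff[THEN iffD1, OF ext]) (simp add: pderiv_mult pderiv_pCons algebra_simps)
  from arg_cong[OF this, of pint]
  have "pint (pderiv (?X * (?P * ?P))) = 1 + 2 * real k"
    unfolding pint_add pint_smult XP n .
  then show "(poly ?P 1)\<^sup>2 = 2 * real k + 1"
    unfolding pint_pderiv by (simp add: power2_eq_square)
  have "pderiv ((1 - ?X) * (?P * ?P)) = smult 2 (?P * pderiv ?P) - (?P * ?P + smult 2 (?P * (?X * pderiv ?P)))"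
    by (rule poly_eq_poly_eq_iff[THEN iffD1, OF ext]) (simp add: pderiv_mult pderiv_diff pderiv_pCons algebra_simps)
  from arg_cong[OF this, of pint]
  have "pint (pderiv ((1 - ?X) * (?P * ?P))) = 2 * 0 - (1 + 2 * real k)"
    unfolding pint_add pint_diff pint_smult XP PP n .
  then show "(poly ?P 0)\<^sup>2 = 2 * real k + 1"
    unfolding pint_pderiv by (simp add: power2_eq_square)
qed

text \<open>With \<open>w = x (1 - x)\<close>, Legendre's equation makes \<open>P\<^sup>2 + w P'\<^sup>2 / (k (k + 1))\<close> decrease on
  \<open>[0, 1/2]\<close> and increase on \<open>[1/2, 1]\<close>, so that it is largest at the endpoints.\<close>

lemma Leg_sup:
  assumes "x \<in> {0..1}" shows "(poly (Leg k) x)\<^sup>2 \<le> 2 * real k + 1"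
proof (cases "k = 0")
  case False
  let ?P = "Leg k"
  define K where "K = real k * (real k + 1)"
  have K: "K > 0" using False by (simp add: K_def)
  define u where "u = ?P * ?P + smult (1 / K) (Wp * (pderiv ?P * pderiv ?P))"
  have ode: "poly (pderiv Wp) y * poly (pderiv ?P) y + poly Wp y * poly (pderiv (pderiv ?P)) y = - K * poly ?P y" for y
    using arg_cong[OF Leg_ode[of k], of "\<lambda>p. poly p y"] by (simp add: pderiv_mult K_def algebra_simps)
  have W': "poly (pderiv Wp) y = 1 - 2 * y" for y
    by (simp add: Wp_def pderiv_pCons)
  have du: "poly (pderiv u) y = - (1 - 2 * y) * (poly (pderiv ?P) y)\<^sup>2 / K" for y
  proof -
    let ?p = "poly ?P y" and ?d = "poly (pderiv ?P) y" and ?e = "poly (pderiv (pderiv ?P)) y"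
    have "poly (pderiv u) y = 2 * ?p * ?d + (1 / K) * (poly (pderiv Wp) y * ?d * ?d + 2 * ?d * (poly Wp y * ?e))"
      by (simp add: u_def pderiv_add pderiv_smult pderiv_mult algebra_simps)
    also have "poly Wp y * ?e = - K * ?p - (1 - 2 * y) * ?d" using ode[of y] by (simp add: W')
    finally show ?thesis using K by (simp add: W' field_simps power2_eq_square)
  qed
  have dx: "(poly u has_real_derivative poly (pderiv u) y) (at y)" for y by (rule poly_DERIV)
  have le: "(poly ?P x)\<^sup>2 \<le> poly u x"
    using assms K by (simp add: u_def poly_Wp power2_eq_square)
  show ?thesis
  proof (cases "x \<le> 1/2")
    case True
    have "poly u x \<le> poly u 0"
    proof (rule DERIV_nonpos_imp_nonincreasing[where f = "poly u"])
      fix y assume "0 \<le> y" "y \<le> x"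
      then show "\<exists>z. (poly u has_real_derivative z) (at y) \<and> z \<le> 0"
        using True K dx[of y] by (intro exI[of _ "poly (pderiv u) y"]) (auto simp: du divide_le_0_iff mult_le_0_iff)
    qed (use assms in auto)
    also have "poly u 0 = (poly ?P 0)\<^sup>2" by (simp add: u_def poly_Wp power2_eq_square)
    finally show ?thesis using le Leg_endpoint(2)[of k] by linarith
  next
    case F: False
    have "poly u x \<le> poly u 1"
    proof (rule DERIV_nonneg_imp_nondecreasing[where f = "poly u"])
      fix y assume "x \<le> y" "y \<le> 1"
      then show "\<exists>z. (poly u has_real_derivative z) (at y) \<and> z \<ge> 0"
        using F K dx[of y] by (intro exI[of _ "poly (pderiv u) y"]) (auto simp: du zero_le_divide_iff mult_nonneg_nonneg divide_nonpos_pos intro!: mult_nonneg_nonneg)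
    qed (use assms in auto)
    also have "poly u 1 = (poly ?P 1)\<^sup>2" by (simp add: u_def poly_Wp power2_eq_square)
    finally show ?thesis using le Leg_endpoint(1)[of k] by linarith
  qed
qed simp

subsection \<open>Square integrable functions on the unit interval\<close>

text \<open>Lebesgue sets rather than Borel sets: \<open>sob_chain\<close> makes the highest
  derivative only Lebesgue measurable.\<close>

abbreviation ulm :: "real measure" where "ulm \<equiv> lebesgue_on {0..1}"

definition sqi :: "(real \<Rightarrow> real) \<Rightarrow> bool" where
  "sqi g \<longleftrightarrow> g \<in> borel_measurable ulm \<and> integrable ulm (\<lambda>x. (g x)\<^sup>2)"

lemma ulm_finite: "finite_measure ulm"
  by (rule finite_measure_lebesgue_on) simp

lemma integral_ulm: "integrable ulm f \<Longrightarrow> integral {0..1} f = integral\<^sup>L ulm (f :: real \<Rightarrow> real)"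
  by (simp add: lebesgue_integral_eq_integral)

lemma sqi_measurable [measurable_dest]: "sqi g \<Longrightarrow> g \<in> borel_measurable ulm"
  by (simp add: sqi_def)

lemma sqi_mult_integrable:
  assumes "sqi g" "sqi h" shows "integrable ulm (\<lambda>x. g x * h x)"
proof (rule Bochner_Integration.integrable_bound)
  show "integrable ulm (\<lambda>x. (g x)\<^sup>2 + (h x)\<^sup>2)" using assms by (simp add: sqi_def)
  have [measurable]: "g \<in> borel_measurable ulm" "h \<in> borel_measurable ulm" using assms by (auto simp: sqi_def)
  show "(\<lambda>x. g x * h x) \<in> borel_measurable ulm" by measurable
  have "\<bar>a * b\<bar> \<le> a\<^sup>2 + b\<^sup>2" for a b :: real
    using sum_squares_bound[of a b] sum_squares_bound[of a "-b"] zero_le_power2[of a] zero_le_power2[of b] by (auto simp: abs_le_iff)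
  then show "AE x in ulm. norm (g x * h x) \<le> norm ((g x)\<^sup>2 + (h x)\<^sup>2)" by (intro AE_I2) simp
qed

lemma sqi_add: "sqi g \<Longrightarrow> sqi h \<Longrightarrow> sqi (\<lambda>x. g x + h x)"
  using sqi_mult_integrable[of g h]
  by (auto simp: sqi_def power2_sum mult.assoc intro: borel_measurable_add)

lemma sqi_cmult: "sqi g \<Longrightarrow> sqi (\<lambda>x. c * g x)"
  by (auto simp: sqi_def power_mult_distrib intro: borel_measurable_times)

lemma sqi_diff: "sqi g \<Longrightarrow> sqi h \<Longrightarrow> sqi (\<lambda>x. g x - h x)"
  using sqi_add[OF _ sqi_cmult[of h "-1"], of g] by simp

lemma sqi_bounded:
  assumes "g \<in> borel_measurable ulm" "\<And>x. x \<in> {0..1} \<Longrightarrow> \<bar>g x\<bar> \<le> B"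
  shows "sqi g"
  unfolding sqi_def
proof
  interpret finite_measure ulm by (rule ulm_finite)
  show "integrable ulm (\<lambda>x. (g x)\<^sup>2)"
  proof (rule integrable_const_bound[where B = "B\<^sup>2"])
    show "AE x in ulm. norm ((g x)\<^sup>2) \<le> B\<^sup>2"
    proof (intro AE_I2)
      fix x assume "x \<in> space ulm"
      then have "\<bar>g x\<bar> \<le> \<bar>B\<bar>" using assms(2)[of x] by simp
      then show "norm ((g x)\<^sup>2) \<le> B\<^sup>2" by (simp add: abs_le_square_iff)
    qed
  qed (use assms(1) in measurable)
qed fact

lemma continuous_measurable_ulm:
  "continuous_on {0..1} (f :: real \<Rightarrow> real) \<Longrightarrow> f \<in> borel_measurable ulm"
  by (rule continuous_imp_measurable_on_sets_lebesgue) auto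

lemma sqi_continuous:
  assumes "continuous_on {0..1} f" shows "sqi f"
proof -
  have "bounded (f ` {0..1})" using assms by (intro compact_imp_bounded compact_continuous_image) auto
  then obtain B where "\<forall>x\<in>{0..1}. \<bar>f x\<bar> \<le> B" by (auto simp: bounded_iff)
  then show ?thesis using assms by (intro sqi_bounded continuous_measurable_ulm) auto
qed

lemma sqi_poly [simp]: "sqi (poly p)"
  by (rule sqi_continuous) (rule continuous_on_poly_real)

lemma sqi_integrable: "sqi g \<Longrightarrow> integrable ulm g"
  using sqi_mult_integrable[of g "poly 1"] by simp

lemma sqi_abs: "sqi g \<Longrightarrow> sqi (\<lambda>x. \<bar>g x\<bar>)"
  by (auto simp: sqi_def intro: borel_measurable_abs)

text \<open>Common source of the Cauchy-Schwarz inequalities for functions and for families. With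
  \<open>c = 0\<close> it forces \<open>b = 0\<close>, and in this form it yields the first order
  condition of the minimisation.\<close>

lemma quadratic_nonneg_discriminant:
  fixes a b c :: real
  assumes q: "\<And>t. 0 \<le> c + 2 * t * b + t\<^sup>2 * a" and a: "0 \<le> a"
  shows "b\<^sup>2 \<le> c * a"
proof (cases "a = 0")
  case True
  have "b = 0"
  proof (rule ccontr)
    assume "b \<noteq> 0"
    then show False using q[of "- (c + 1) / (2 * b)"] True by (simp add: field_simps)
  qed
  then show ?thesis using True by simp
next
  case False
  then have "a > 0" using a by simp
  then show ?thesis using q[of "- b / a"] by (simp add: field_simps power2_eq_square)
qed

lemma sqi_CS:
  assumes "sqi g" "sqi h"
  shows "(integral\<^sup>L ulm (\<lambda>x. g x * h x))\<^sup>2 \<le> integral\<^sup>L ulm (\<lambda>x. (g x)\<^sup>2) * integral\<^sup>L ulm (\<lambda>x. (h x)\<^sup>2)"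
proof (rule quadratic_nonneg_discriminant)
  fix t :: real
  have i: "integrable ulm (\<lambda>x. (g x)\<^sup>2)" "integrable ulm (\<lambda>x. (h x)\<^sup>2)" "integrable ulm (\<lambda>x. g x * h x)"
    using assms sqi_mult_integrable by (auto simp: sqi_def)
  have "0 \<le> integral\<^sup>L ulm (\<lambda>x. (g x + t * h x)\<^sup>2)" by simp
  also have "(\<lambda>x. (g x + t * h x)\<^sup>2) = (\<lambda>x. (g x)\<^sup>2 + 2 * t * (g x * h x) + t\<^sup>2 * (h x)\<^sup>2)"
    by (auto simp: power2_eq_square algebra_simps)
  finally show "0 \<le> integral\<^sup>L ulm (\<lambda>x. (g x)\<^sup>2) + 2 * t * integral\<^sup>L ulm (\<lambda>x. g x * h x) + t\<^sup>2 * integral\<^sup>L ulm (\<lambda>x. (h x)\<^sup>2)"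
    using i by simp
qed simp

lemma sqi_abs_integral:
  assumes "sqi g" shows "integral\<^sup>L ulm (\<lambda>x. \<bar>g x\<bar>) \<le> sqrt (integral\<^sup>L ulm (\<lambda>x. (g x)\<^sup>2))"
proof -
  have "measure ulm {0..1} = 1" by (simp add: measure_restrict_space)
  then have "(integral\<^sup>L ulm (\<lambda>x. \<bar>g x\<bar>))\<^sup>2 \<le> integral\<^sup>L ulm (\<lambda>x. (g x)\<^sup>2)"
    using sqi_CS[OF sqi_abs[OF assms] sqi_poly[of 1]] by simp
  then show ?thesis by (rule real_le_rsqrt)
qed

lemma poly_dense_continuous:
  fixes h :: "real \<Rightarrow> real"
  assumes "continuous_on {0..1} h" "e > 0"
  obtains p where "\<And>x. x \<in> {0..1} \<Longrightarrow> \<bar>h x - poly p x\<bar> < e"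
proof -
  obtain f where "real_polynomial_function f" and f: "\<And>x. x \<in> {0..1} \<Longrightarrow> \<bar>h x - f x\<bar> < e"
    using Stone_Weierstrass_real_polynomial_function[of "{0..1}" h e] assms by auto
  then obtain a n where an: "f = (\<lambda>x. \<Sum>i\<le>n. a i * x ^ i)"
    by (auto simp: real_polynomial_function_iff_sum)
  have "poly (\<Sum>i\<le>n. monom (a i) i) x = f x" for x
    by (simp add: an poly_sum poly_monom)
  then show thesis using that f by metis
qed

lemma L2_triangle_sq:
  assumes "sqi g" "sqi h"
  shows "integral\<^sup>L ulm (\<lambda>x. (g x + h x)\<^sup>2) \<le> 2 * integral\<^sup>L ulm (\<lambda>x. (g x)\<^sup>2) + 2 * integral\<^sup>L ulm (\<lambda>x. (h x)\<^sup>2)"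
proof -
  have "integral\<^sup>L ulm (\<lambda>x. (g x + h x)\<^sup>2) \<le> integral\<^sup>L ulm (\<lambda>x. 2 * (g x)\<^sup>2 + 2 * (h x)\<^sup>2)"
  proof (rule integral_mono)
    show "integrable ulm (\<lambda>x. (g x + h x)\<^sup>2)" using sqi_add[OF assms] by (simp add: sqi_def)
    show "(g x + h x)\<^sup>2 \<le> 2 * (g x)\<^sup>2 + 2 * (h x)\<^sup>2" for x
      using zero_le_power2[of "g x - h x"] by (simp add: power2_eq_square algebra_simps)
  qed (use assms in \<open>auto simp: sqi_def\<close>)
  also have "\<dots> = 2 * integral\<^sup>L ulm (\<lambda>x. (g x)\<^sup>2) + 2 * integral\<^sup>L ulm (\<lambda>x. (h x)\<^sup>2)"
    using assms by (simp add: sqi_def)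
  finally show ?thesis .
qed

definition clamp_abs :: "real \<Rightarrow> real \<Rightarrow> real" where
  "clamp_abs B y = max (- B) (min B y)"

lemma clamp_abs_le: "0 \<le> B \<Longrightarrow> \<bar>clamp_abs B y\<bar> \<le> B"
  by (auto simp: clamp_abs_def)

lemma continuous_clamp_abs [continuous_intros]:
  "continuous_on X f \<Longrightarrow> continuous_on X (\<lambda>x. clamp_abs B (f x))"
  unfolding clamp_abs_def by (intro continuous_intros)

lemma L2_clamp_tendsto:
  assumes "sqi g"
  shows "(\<lambda>n. integral\<^sup>L ulm (\<lambda>x. (g x - clamp_abs (real n) (g x))\<^sup>2)) \<longlonglongrightarrow> 0"
proof -
  have "(\<lambda>n. integral\<^sup>L ulm (\<lambda>x. (g x - clamp_abs (real n) (g x))\<^sup>2)) \<longlonglongrightarrow> integral\<^sup>L ulm (\<lambda>x. 0)"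
  proof (rule integral_dominated_convergence[where w = "\<lambda>x. (g x)\<^sup>2"])
    show "integrable ulm (\<lambda>x. (g x)\<^sup>2)" using assms by (simp add: sqi_def)
    show "(\<lambda>x. (g x - clamp_abs (real n) (g x))\<^sup>2) \<in> borel_measurable ulm" for n
      using assms unfolding clamp_abs_def by measurable
    show "AE x in ulm. (\<lambda>n. (g x - clamp_abs (real n) (g x))\<^sup>2) \<longlonglongrightarrow> 0"
    proof (intro AE_I2 tendsto_eventually)
      fix x
      obtain N where "\<bar>g x\<bar> \<le> real N" using real_arch_simple by blast
      then have "(g x - clamp_abs (real n) (g x))\<^sup>2 = 0" if "n \<ge> N" for n
        using that by (auto simp: clamp_abs_def)
      then show "\<forall>\<^sub>F n in sequentially. (g x - clamp_abs (real n) (g x))\<^sup>2 = 0"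
        by (auto simp: eventually_sequentially)
    qed
    show "AE x in ulm. norm ((g x - clamp_abs (real n) (g x))\<^sup>2) \<le> (g x)\<^sup>2" for n
    proof (intro AE_I2)
      fix x
      have "\<bar>g x - clamp_abs (real n) (g x)\<bar> \<le> \<bar>g x\<bar>" by (auto simp: clamp_abs_def)
      then show "norm ((g x - clamp_abs (real n) (g x))\<^sup>2) \<le> (g x)\<^sup>2" by (simp add: abs_le_square_iff)
    qed
  qed simp
  then show ?thesis by simp
qed

text \<open>A Lebesgue measurable function is an almost everywhere limit of continuous functions;
  clamping these at \<open>B\<close> makes the convergence dominated.\<close>

lemma L2_clamp_continuous:
  assumes "sqi g" "0 \<le> B" "e > 0"
  obtains h where "continuous_on {0..1} h" "integral\<^sup>L ulm (\<lambda>x. (clamp_abs B (g x) - h x)\<^sup>2) < e"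
proof -
  have "g measurable_on {0..1}"
    using assms(1) by (simp add: sqi_def measurable_on_iff_borel_measurable)
  then obtain N h where N: "negligible N" and hc: "\<And>n. continuous_on UNIV (h n)"
    and lim: "\<And>x. x \<notin> N \<Longrightarrow> (\<lambda>n. h n x) \<longlonglongrightarrow> (if x \<in> {0..1} then g x else 0)"
    unfolding measurable_on_def by metis
  have hc': "continuous_on {0..1} (\<lambda>x. clamp_abs B (h n x))" for n
    using continuous_on_subset[OF hc[of n]] by (intro continuous_clamp_abs) auto
  have AEN: "AE x in ulm. x \<notin> N"
  proof -
    have "AE x in lebesgue. x \<notin> N"
      using N by (intro AE_not_in) (simp add: negligible_iff_null_sets)
    then show ?thesis by (auto simp: AE_restrict_space_iff)
  qed
  have "(\<lambda>n. integral\<^sup>L ulm (\<lambda>x. (clamp_abs B (g x) - clamp_abs B (h n x))\<^sup>2)) \<longlonglongrightarrow> integral\<^sup>L ulm (\<lambda>x. 0)"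
  proof (rule integral_dominated_convergence[where w = "\<lambda>x. (2 * B)\<^sup>2"])
    show "integrable ulm (\<lambda>x. (2 * B)\<^sup>2)" using sqi_integrable[OF sqi_poly[of "[:(2*B)^2:]"]] by simp
    show "(\<lambda>x. (clamp_abs B (g x) - clamp_abs B (h n x))\<^sup>2) \<in> borel_measurable ulm" for n
    proof -
      have "(\<lambda>x. clamp_abs B (h n x)) \<in> borel_measurable ulm" using hc' by (rule continuous_measurable_ulm)
      moreover have "(\<lambda>x. clamp_abs B (g x)) \<in> borel_measurable ulm"
        using assms(1) unfolding clamp_abs_def by measurable
      ultimately show ?thesis by measurable
    qed
    show "AE x in ulm. (\<lambda>n. (clamp_abs B (g x) - clamp_abs B (h n x))\<^sup>2) \<longlonglongrightarrow> 0"
      using AEN AE_space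
    proof eventually_elim
      case (elim x)
      then have "(\<lambda>n. h n x) \<longlonglongrightarrow> g x" using lim[of x] by auto
      then have "(\<lambda>n. (clamp_abs B (g x) - clamp_abs B (h n x))\<^sup>2) \<longlonglongrightarrow> (clamp_abs B (g x) - clamp_abs B (g x))\<^sup>2"
        unfolding clamp_abs_def by (intro tendsto_intros)
      then show ?case by simp
    qed
    show "AE x in ulm. norm ((clamp_abs B (g x) - clamp_abs B (h n x))\<^sup>2) \<le> (2 * B)\<^sup>2" for n
    proof (intro AE_I2)
      fix x
      have "\<bar>clamp_abs B (g x) - clamp_abs B (h n x)\<bar> \<le> \<bar>2 * B\<bar>"
        using clamp_abs_le[OF assms(2), of "g x"] clamp_abs_le[OF assms(2), of "h n x"] by linarith
      then have "(clamp_abs B (g x) - clamp_abs B (h n x))\<^sup>2 \<le> (2 * B)\<^sup>2" by (simp only: abs_le_square_iff)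
      then show "norm ((clamp_abs B (g x) - clamp_abs B (h n x))\<^sup>2) \<le> (2 * B)\<^sup>2" by simp
    qed
  qed simp
  then obtain n where "integral\<^sup>L ulm (\<lambda>x. (clamp_abs B (g x) - clamp_abs B (h n x))\<^sup>2) < e"
    using assms(3) by (auto simp: lim_sequentially dist_real_def dest!: spec[of _ e])
  then show thesis using that hc' by blast
qed

lemma L2_poly_dense:
  assumes "sqi g" "e > 0"
  obtains p where "integral\<^sup>L ulm (\<lambda>x. (g x - poly p x)\<^sup>2) < e"
proof -
  \<comment> \<open>The three errors are combined by (a + b)^2 \<le> 2 a^2 + 2 b^2, applied twice:
    e/16 and e/16 give e/4, then e/4 and e/4 give e.\<close>
  obtain n where n: "integral\<^sup>L ulm (\<lambda>x. (g x - clamp_abs (real n) (g x))\<^sup>2) < e / 4"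
    using L2_clamp_tendsto[OF assms(1)] assms(2)
    by (auto simp: lim_sequentially dist_real_def dest!: spec[of _ "e/4"])
  obtain h where h: "continuous_on {0..1} h"
    and h2: "integral\<^sup>L ulm (\<lambda>x. (clamp_abs (real n) (g x) - h x)\<^sup>2) < e / 16"
    using L2_clamp_continuous[OF assms(1), of "real n" "e/16"] assms(2) by auto
  obtain p where p: "\<And>x. x \<in> {0..1} \<Longrightarrow> \<bar>h x - poly p x\<bar> < sqrt (e / 16)"
    using poly_dense_continuous[OF h, of "sqrt (e/16)"] assms(2) by auto
  have s1: "sqi (\<lambda>x. clamp_abs (real n) (g x))"
    using assms(1) by (intro sqi_bounded[where B = "real n"]) (auto simp: clamp_abs_le clamp_abs_def[abs_def])
  have s2: "sqi h" using h by (rule sqi_continuous)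
  have "integral\<^sup>L ulm (\<lambda>x. (h x - poly p x)\<^sup>2) \<le> integral\<^sup>L ulm (\<lambda>x. e / 16)"
  proof (rule integral_mono)
    show "integrable ulm (\<lambda>x. (h x - poly p x)\<^sup>2)"
      using sqi_diff[OF s2 sqi_poly[of p]] by (simp add: sqi_def)
    show "integrable ulm (\<lambda>x. e / 16)" using sqi_integrable[OF sqi_poly[of "[:e/16:]"]] by simp
    fix x assume "x \<in> space ulm"
    then have "\<bar>h x - poly p x\<bar> \<le> sqrt (e / 16)" using p by (simp add: less_imp_le)
    then show "(h x - poly p x)\<^sup>2 \<le> e / 16"
      using assms(2) abs_le_square_iff[of "h x - poly p x" "sqrt (e/16)"] by simp
  qed
  also have "\<dots> = e / 16" by (simp add: measure_restrict_space)
  finally have h3: "integral\<^sup>L ulm (\<lambda>x. (h x - poly p x)\<^sup>2) \<le> e / 16" .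
  have "integral\<^sup>L ulm (\<lambda>x. (clamp_abs (real n) (g x) - poly p x)\<^sup>2) \<le> e / 4"
    using L2_triangle_sq[OF sqi_diff[OF s1 s2] sqi_diff[OF s2 sqi_poly[of p]]] h2 h3 by simp
  then have "integral\<^sup>L ulm (\<lambda>x. (g x - poly p x)\<^sup>2) < e"
    using L2_triangle_sq[OF sqi_diff[OF assms(1) s1] sqi_diff[OF s1 sqi_poly[of p]]] n by simp
  then show thesis by (rule that)
qed

section \<open>Legendre coefficients and Parseval's identity\<close>

definition lc :: "(real \<Rightarrow> real) \<Rightarrow> nat \<Rightarrow> real" where
  "lc g k = integral\<^sup>L ulm (\<lambda>x. g x * poly (Leg k) x)"

lemma pint_ulm: "pint p = integral\<^sup>L ulm (poly p)"
  unfolding pint_def by (rule integral_ulm) (rule sqi_integrable[OF sqi_poly])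

lemma L2_dist_poly:
  assumes g: "sqi g"
  shows "integral\<^sup>L ulm (\<lambda>x. (g x - poly p x)\<^sup>2)
    = integral\<^sup>L ulm (\<lambda>x. (g x)\<^sup>2) - 2 * integral\<^sup>L ulm (\<lambda>x. g x * poly p x) + pint (p * p)"
proof -
  have i: "integrable ulm (\<lambda>x. (g x)\<^sup>2)" using g by (simp add: sqi_def)
  have i2: "integrable ulm (\<lambda>x. g x * poly p x)" by (rule sqi_mult_integrable[OF g sqi_poly])
  have i3: "integrable ulm (\<lambda>x. poly p x * poly p x)" by (rule sqi_mult_integrable[OF sqi_poly sqi_poly])
  have "(\<lambda>x. (g x - poly p x)\<^sup>2) = (\<lambda>x. (g x)\<^sup>2 - 2 * (g x * poly p x) + poly p x * poly p x)"
    by (auto simp: power2_eq_square algebra_simps)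
  then show ?thesis using i i2 i3 by (simp add: pint_ulm poly_mult[abs_def])
qed

lemma L2_dist_Leg_sum:
  assumes g: "sqi g"
  shows "integral\<^sup>L ulm (\<lambda>x. (g x - poly (\<Sum>k<K. smult (a k) (Leg k)) x)\<^sup>2)
    = integral\<^sup>L ulm (\<lambda>x. (g x)\<^sup>2) - 2 * (\<Sum>k<K. a k * lc g k) + (\<Sum>k<K. (a k)\<^sup>2)"
proof -
  let ?p = "\<Sum>k<K. smult (a k) (Leg k)"
  have "integral\<^sup>L ulm (\<lambda>x. g x * poly ?p x) = integral\<^sup>L ulm (\<lambda>x. \<Sum>k<K. a k * (g x * poly (Leg k) x))"
    by (intro Bochner_Integration.integral_cong refl) (simp add: poly_sum sum_distrib_left mult.left_commute)
  also have "\<dots> = (\<Sum>k<K. integral\<^sup>L ulm (\<lambda>x. a k * (g x * poly (Leg k) x)))"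
    by (rule Bochner_Integration.integral_sum) (intro integrable_mult_right sqi_mult_integrable g sqi_poly)
  finally have 1: "integral\<^sup>L ulm (\<lambda>x. g x * poly ?p x) = (\<Sum>k<K. a k * lc g k)"
    by (simp add: lc_def)
  have "pint (?p * ?p) = (\<Sum>i<K. \<Sum>j<K. pint (smult (a i) (Leg i) * smult (a j) (Leg j)))"
    by (simp only: sum_product pint_sum)
  also have "\<dots> = (\<Sum>i<K. \<Sum>j<K. if i = j then a i * a j else 0)"
    by (intro sum.cong refl) (simp add: pint_smult Leg_orthonormal)
  also have "\<dots> = (\<Sum>k<K. (a k)\<^sup>2)" by (simp add: power2_eq_square)
  finally show ?thesis unfolding L2_dist_poly[OF g] 1 by (simp only:)
qed

lemma lc_bessel: "sqi g \<Longrightarrow> integral\<^sup>L ulm (\<lambda>x. (g x - poly (\<Sum>k<K. smult (lc g k) (Leg k)) x)\<^sup>2)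
    = integral\<^sup>L ulm (\<lambda>x. (g x)\<^sup>2) - (\<Sum>k<K. (lc g k)\<^sup>2)"
  by (subst L2_dist_Leg_sum) (simp_all add: power2_eq_square)

lemma lc_parseval:
  assumes g: "sqi g" shows "(\<lambda>k. (lc g k)\<^sup>2) sums integral\<^sup>L ulm (\<lambda>x. (g x)\<^sup>2)"
  unfolding sums_def
proof (rule LIMSEQ_I)
  let ?G = "integral\<^sup>L ulm (\<lambda>x. (g x)\<^sup>2)"
  fix e :: real assume "e > 0"
  then obtain p where p: "integral\<^sup>L ulm (\<lambda>x. (g x - poly p x)\<^sup>2) < e" using L2_poly_dense[OF g] by blast
  have "norm ((\<Sum>k<K. (lc g k)\<^sup>2) - ?G) < e" if "K \<ge> Suc (degree p)" for K
  proof -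
    define a where "a k = pint (p * Leg k)" for k
    have "p = (\<Sum>j\<le>K - 1. smult (a j) (Leg j))"
      unfolding a_def using that by (intro Leg_expansion) simp
    also have "{..K - 1} = {..<K}" using that by auto
    finally have "?G - 2 * (\<Sum>k<K. a k * lc g k) + (\<Sum>k<K. (a k)\<^sup>2) < e"
      using p L2_dist_Leg_sum[OF g, of a K] by simp
    \<comment> \<open>By this nonnegative amount the squared distance from \<open>g\<close> to
      \<open>p\<close> exceeds the remainder in Bessel's identity, so the partial Legendre sum is at
      least as close to \<open>g\<close> as \<open>p\<close> is.\<close>
    moreover have "(\<Sum>k<K. (lc g k - a k)\<^sup>2) = (\<Sum>k<K. (lc g k)\<^sup>2) - 2 * (\<Sum>k<K. a k * lc g k) + (\<Sum>k<K. (a k)\<^sup>2)"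
      by (simp add: power2_diff sum.distrib sum_subtractf sum_distrib_left algebra_simps)
    moreover have "(\<Sum>k<K. (lc g k - a k)\<^sup>2) \<ge> 0" by (intro sum_nonneg) auto
    moreover have "0 \<le> ?G - (\<Sum>k<K. (lc g k)\<^sup>2)"
      unfolding lc_bessel[OF g, symmetric] by (rule Bochner_Integration.integral_nonneg) auto
    ultimately show ?thesis by auto
  qed
  then show "\<exists>no. \<forall>K\<ge>no. norm ((\<Sum>k<K. (lc g k)\<^sup>2) - ?G) < e" by blast
qed

lemma lc_add: "sqi g \<Longrightarrow> sqi h \<Longrightarrow> lc (\<lambda>x. g x + h x) k = lc g k + lc h k"
  unfolding lc_def by (simp add: distrib_right sqi_mult_integrable)

lemma lc_diff: "sqi g \<Longrightarrow> sqi h \<Longrightarrow> lc (\<lambda>x. g x - h x) k = lc g k - lc h k"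
  unfolding lc_def by (simp add: left_diff_distrib sqi_mult_integrable)

text \<open>Polarisation of Parseval's identity.\<close>

lemma lc_parseval_mult:
  assumes g: "sqi g" and h: "sqi h"
  shows "(\<lambda>k. lc g k * lc h k) sums integral\<^sup>L ulm (\<lambda>x. g x * h x)"
proof -
  have "(\<lambda>k. ((lc (\<lambda>x. g x + h x) k)\<^sup>2 - (lc (\<lambda>x. g x - h x) k)\<^sup>2) / 4) sums
    ((integral\<^sup>L ulm (\<lambda>x. (g x + h x)\<^sup>2) - integral\<^sup>L ulm (\<lambda>x. (g x - h x)\<^sup>2)) / 4)"
    by (intro sums_divide sums_diff lc_parseval sqi_add sqi_diff g h)
  moreover have "((lc (\<lambda>x. g x + h x) k)\<^sup>2 - (lc (\<lambda>x. g x - h x) k)\<^sup>2) / 4 = lc g k * lc h k" for k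
    by (simp add: lc_add lc_diff g h power2_eq_square algebra_simps)
  moreover have "integral\<^sup>L ulm (\<lambda>x. (g x + h x)\<^sup>2) - integral\<^sup>L ulm (\<lambda>x. (g x - h x)\<^sup>2)
    = integral\<^sup>L ulm (\<lambda>x. (g x + h x)\<^sup>2 - (g x - h x)\<^sup>2)"
    using sqi_add[OF g h] sqi_diff[OF g h] by (simp add: sqi_def)
  moreover have "\<dots> = integral\<^sup>L ulm (\<lambda>x. 4 * (g x * h x))"
    by (rule Bochner_Integration.integral_cong) (auto simp: power2_eq_square algebra_simps)
  moreover have "\<dots> = 4 * integral\<^sup>L ulm (\<lambda>x. g x * h x)" by simp
  ultimately show ?thesis by simp
qed

subsection \<open>An orthonormal expansion for the univariate Sobolev inner product\<close>

lemma sob_chainD: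
  assumes "sob_chain m f g"
  shows "x \<in> {0..1} \<Longrightarrow> g 0 x = f x"
    and "l < m \<Longrightarrow> g (Suc l) absolutely_integrable_on {0..1}"
    and "l < m \<Longrightarrow> x \<in> {0..1} \<Longrightarrow> g l x = g l 0 + integral {0..x} (g (Suc l))"
    and "g m measurable_on {0..1}" and "(\<lambda>t. (g m t)\<^sup>2) integrable_on {0..1}"
proof -
  note c = assms[unfolded sob_chain_def]
  note c1 = c[THEN conjunct2, THEN conjunct1]
  show "x \<in> {0..1} \<Longrightarrow> g 0 x = f x" by (rule bspec[OF c[THEN conjunct1]])
  show "l < m \<Longrightarrow> g (Suc l) absolutely_integrable_on {0..1}"
    by (rule c1[THEN spec, THEN mp, THEN conjunct1])
  show "l < m \<Longrightarrow> x \<in> {0..1} \<Longrightarrow> g l x = g l 0 + integral {0..x} (g (Suc l))"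
    by (rule c1[THEN spec, THEN mp, THEN conjunct2, THEN bspec])
  show "g m measurable_on {0..1}" by (rule c[THEN conjunct2, THEN conjunct2, THEN conjunct1])
  show "(\<lambda>t. (g m t)\<^sup>2) integrable_on {0..1}" by (rule c[THEN conjunct2, THEN conjunct2, THEN conjunct2])
qed
lemma sob_chain_sqi:
  assumes c: "sob_chain m f g" shows "sqi (g m)"
proof -
  have "(\<lambda>t. (g m t)\<^sup>2) absolutely_integrable_on {0..1}"
    by (rule nonnegative_absolutely_integrable_1[OF sob_chainD(5)[OF c]]) simp
  then have "integrable ulm (norm \<circ> (\<lambda>t. (g m t)\<^sup>2))"
    using absolutely_integrable_measurable[of "{0..1::real}" "\<lambda>t. (g m t)\<^sup>2"] by simp
  moreover have "norm \<circ> (\<lambda>t. (g m t)\<^sup>2) = (\<lambda>t. (g m t)\<^sup>2)" by auto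
  ultimately show ?thesis using sob_chainD(4)[OF c]
    by (simp add: sqi_def measurable_on_iff_borel_measurable)
qed

lemma sob_chain_continuous:
  assumes "sob_chain m f g" "l < m" shows "continuous_on {0..1} (g l)"
proof -
  have "g (Suc l) integrable_on {0..1}"
    using sob_chainD(2)[OF assms] by (simp add: absolutely_integrable_on_def)
  then have "continuous_on {0..1} (\<lambda>x. g l 0 + integral {0..x} (g (Suc l)))"
    by (intro continuous_on_add continuous_on_const indefinite_integral_continuous_1)
  then show ?thesis
    by (rule continuous_on_eq) (rule sob_chainD(3)[OF assms, symmetric])
qed

lemma sob_chain_sqi_le: "sob_chain m f g \<Longrightarrow> l \<le> m \<Longrightarrow> sqi (g l)"
  using sob_chain_sqi[of m f g] sqi_continuous[OF sob_chain_continuous, of m f g l]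
  by (cases "l = m") auto

text \<open>The oscillation of \<open>g l\<close> is at most the L1 norm of its derivative;
  averaging \<open>g l x - g l y\<close> over \<open>y\<close> replaces the second value by the
  mean.\<close>

lemma sob_chain_osc:
  assumes c: "sob_chain m f g" and l: "l < m" and x: "x \<in> {0..1}"
  shows "\<bar>g l x - integral {0..1} (g l)\<bar> \<le> integral\<^sup>L ulm (\<lambda>t. \<bar>g (Suc l) t\<bar>)"
proof -
  let ?h = "g (Suc l)"
  let ?I = "integral\<^sup>L ulm (\<lambda>t. \<bar>?h t\<bar>)"
  have sh: "sqi ?h" using sob_chain_sqi_le[OF c, of "Suc l"] l by simp
  have Ieq: "integral {0..1} (\<lambda>t. \<bar>?h t\<bar>) = ?I" by (intro integral_ulm sqi_integrable sqi_abs sh)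
  have hi: "?h integrable_on {0..1}" and hai: "(\<lambda>t. \<bar>?h t\<bar>) integrable_on {0..1}"
    by (rule integrable_on_lebesgue_on[OF sqi_integrable[OF sh]], simp)
      (rule integrable_on_lebesgue_on[OF sqi_integrable[OF sqi_abs[OF sh]]], simp)
  have ord: "\<bar>g l b - g l a\<bar> \<le> ?I" if "0 \<le> a" "a \<le> b" "b \<le> 1" for a b
  proof -
    have ii: "?h integrable_on {u..v}" "(\<lambda>t. \<bar>?h t\<bar>) integrable_on {u..v}" if "0 \<le> u" "v \<le> 1" for u v
      by (rule integrable_on_subinterval[OF hi], use that in simp)
        (rule integrable_on_subinterval[OF hai], use that in simp)
    have "integral {0..a} ?h + integral {a..b} ?h = integral {0..b} ?h"
      by (rule Henstock_Kurzweil_Integration.integral_combine) (use that ii[of 0 b] in simp_all)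
    moreover have "g l a = g l 0 + integral {0..a} ?h" "g l b = g l 0 + integral {0..b} ?h"
      by (rule sob_chainD(3)[OF c l]; use that in simp)+
    ultimately have "g l b - g l a = integral {a..b} ?h" by linarith
    also have "\<bar>\<dots>\<bar> \<le> integral {a..b} (\<lambda>t. \<bar>?h t\<bar>)"
      using integral_norm_bound_integral[of ?h "{a..b}" "\<lambda>t. \<bar>?h t\<bar>"] ii[of a b] that by simp
    also have "\<dots> \<le> integral {0..1} (\<lambda>t. \<bar>?h t\<bar>)"
      by (rule integral_subset_le[OF _ ii(2) hai]) (use that in auto)
    finally show ?thesis by (simp add: Ieq)
  qed
  have osc: "\<bar>g l x - g l y\<bar> \<le> ?I" if "y \<in> {0..1}" for y
    using ord[of x y] ord[of y x] x that abs_minus_commute[of "g l x" "g l y"] by (cases "x \<le> y") simp_all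
  have gi: "g l integrable_on {0..1}" using sob_chain_continuous[OF c l] by (rule integrable_continuous_interval)
  have "integral {0..1} (\<lambda>y. g l x - g l y) = g l x - integral {0..1} (g l)"
    using Henstock_Kurzweil_Integration.integral_diff[OF integrable_const_ivl gi, of "g l x"] by simp
  moreover have "norm (integral {0..1} (\<lambda>y. g l x - g l y)) \<le> integral {0..1::real} (\<lambda>y. ?I)"
    by (rule integral_norm_bound_integral[OF integrable_diff[OF integrable_const_ivl gi] integrable_const_ivl])
      (use osc in simp)
  ultimately show ?thesis by simp
qed

text \<open>Each derivative is bounded by its mean plus the L1 norm of the next one, and the chain
  of these bounds ends at the L2 norm of \<open>g m\<close>. This is what makes the evaluation of
  derivatives of order below m continuous.\<close>

lemma sob_chain_sup:
  assumes c: "sob_chain m f g" and l: "l < m"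
  shows "\<forall>x\<in>{0..1}. \<bar>g l x\<bar> \<le> (\<Sum>i\<in>{l..<m}. \<bar>integral {0..1} (g i)\<bar>) + sqrt (integral\<^sup>L ulm (\<lambda>t. (g m t)\<^sup>2))"
  using l
proof (induction "m - l" arbitrary: l rule: less_induct)
  case (less l)
  let ?r = "sqrt (integral\<^sup>L ulm (\<lambda>t. (g m t)\<^sup>2))"
  let ?I = "integral\<^sup>L ulm (\<lambda>t. \<bar>g (Suc l) t\<bar>)"
  have I: "?I \<le> (\<Sum>i\<in>{Suc l..<m}. \<bar>integral {0..1} (g i)\<bar>) + ?r"
  proof (cases "Suc l = m")
    case True
    then show ?thesis using sqi_abs_integral[OF sob_chain_sqi[OF c]] by simp
  next
    case False
    then have sl: "Suc l < m" using less.prems by simp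
    let ?B = "(\<Sum>i\<in>{Suc l..<m}. \<bar>integral {0..1} (g i)\<bar>) + ?r"
    have "?I \<le> integral\<^sup>L ulm (\<lambda>t. ?B)"
    proof (rule integral_mono)
      show "integrable ulm (\<lambda>t. \<bar>g (Suc l) t\<bar>)"
        using sob_chain_sqi_le[OF c, of "Suc l"] sl by (intro sqi_integrable sqi_abs) simp
      show "integrable ulm (\<lambda>t. ?B)" using sqi_integrable[OF sqi_poly[of "[:?B:]"]] by simp
      show "\<bar>g (Suc l) t\<bar> \<le> ?B" if "t \<in> space ulm" for t
        using less.hyps[of "Suc l"] sl that by auto
    qed
    also have "\<dots> = ?B" by (simp add: measure_restrict_space)
    finally show ?thesis .
  qed
  have "{l..<m} = insert l {Suc l..<m}" using less.prems by auto
  then have s: "(\<Sum>i\<in>{l..<m}. \<bar>integral {0..1} (g i)\<bar>) = \<bar>integral {0..1} (g l)\<bar> + (\<Sum>i\<in>{Suc l..<m}. \<bar>integral {0..1} (g i)\<bar>)"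
    by simp
  show ?case
  proof
    fix x :: real assume "x \<in> {0..1}"
    then show "\<bar>g l x\<bar> \<le> (\<Sum>i\<in>{l..<m}. \<bar>integral {0..1} (g i)\<bar>) + ?r"
      using sob_chain_osc[OF c less.prems] I unfolding s by fastforce
  qed
qed

section \<open>Polynomials as Sobolev functions and a dual basis\<close>

lemma sob_chain_poly: "sob_chain m (poly p) (\<lambda>l. poly ((pderiv ^^ l) p))"
proof -
  have 1: "poly q x = poly q 0 + integral {0..x} (poly (pderiv q))" if "x \<in> {0..1}" for q :: "real poly" and x
  proof -
    have "(poly (pderiv q) has_integral (poly q x - poly q 0)) {0..x}"
      using that by (intro fundamental_theorem_of_calculus)
        (auto intro!: DERIV_subset[OF poly_DERIV] simp flip: has_real_derivative_iff_has_vector_derivative)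
    then show ?thesis by (simp add: integral_unique)
  qed
  have 2: "poly q absolutely_integrable_on {0..1}" for q :: "real poly"
    by (rule absolutely_integrable_continuous_real) (rule continuous_on_poly_real)
  have 3: "poly q measurable_on {0..1}" for q :: "real poly"
    using sqi_poly[of q] by (simp add: sqi_def measurable_on_iff_borel_measurable)
  have 4: "(\<lambda>t. (poly q t)\<^sup>2) integrable_on {0..1}" for q :: "real poly"
    using poly_integrable_on[of "q * q" 0 1] by (simp add: power2_eq_square poly_mult[abs_def])
  show ?thesis unfolding sob_chain_def
  proof (intro conjI ballI allI impI 2 3 4)
    fix l and x :: real assume "x \<in> {0..1}"
    then show "poly ((pderiv ^^ l) p) x = poly ((pderiv ^^ l) p) 0 + integral {0..x} (poly ((pderiv ^^ Suc l) p))"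
      using 1[of x "(pderiv ^^ l) p"] unfolding funpow.simps o_apply by blast
  qed simp
qed

lemma sob_chain_diff:
  assumes "sob_chain m f g" "sob_chain m f' g'"
  shows "sob_chain m (\<lambda>x. f x - f' x) (\<lambda>l x. g l x - g' l x)"
proof -
  have 1: "g l x - g' l x = g l 0 - g' l 0 + integral {0..x} (\<lambda>t. g (Suc l) t - g' (Suc l) t)"
    if "l < m" "x \<in> {0..1}" for l x
  proof -
    have "g (Suc l) integrable_on {0..1}" "g' (Suc l) integrable_on {0..1}"
      using sob_chainD(2)[OF assms(1) that(1)] sob_chainD(2)[OF assms(2) that(1)]
      by (auto simp: absolutely_integrable_on_def)
    then have "g (Suc l) integrable_on {0..x}" "g' (Suc l) integrable_on {0..x}"
      using that by (auto elim!: integrable_on_subinterval)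
    then have "integral {0..x} (\<lambda>t. g (Suc l) t - g' (Suc l) t) = integral {0..x} (g (Suc l)) - integral {0..x} (g' (Suc l))"
      by (rule Henstock_Kurzweil_Integration.integral_diff)
    moreover have "g l x = g l 0 + integral {0..x} (g (Suc l))" "g' l x = g' l 0 + integral {0..x} (g' (Suc l))"
      using sob_chainD(3)[OF assms(1) that] sob_chainD(3)[OF assms(2) that] .
    ultimately show ?thesis by linarith
  qed
  have "sqi (\<lambda>x. g m x - g' m x)"
    by (intro sqi_diff sob_chain_sqi[OF assms(1)] sob_chain_sqi[OF assms(2)])
  then have 2: "(\<lambda>x. g m x - g' m x) measurable_on {0..1}" "(\<lambda>t. (g m t - g' m t)\<^sup>2) integrable_on {0..1}"
    by (auto simp: sqi_def measurable_on_iff_borel_measurable intro: integrable_on_lebesgue_on)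
  show ?thesis
    unfolding sob_chain_def
  proof (intro conjI ballI allI impI 1 2)
    show "g 0 x - g' 0 x = f x - f' x" if "x \<in> {0..1}" for x
      by (simp only: sob_chainD(1)[OF assms(1) that] sob_chainD(1)[OF assms(2) that])
    show "(\<lambda>x. g (Suc l) x - g' (Suc l) x) absolutely_integrable_on {0..1}" if "l < m" for l
      using set_integral_diff(1)[OF sob_chainD(2)[OF assms(1) that] sob_chainD(2)[OF assms(2) that]] .
  qed
qed

text \<open>The two conditions determine the antiderivative, so the choice is unique. Iterates
  applied to 1 are the Bernoulli polynomials divided by factorials.\<close>

definition Ip :: "real poly \<Rightarrow> real poly" where
  "Ip p = (SOME q. pderiv q = p \<and> pint q = 0)"

lemma Ip: "pderiv (Ip p) = p" "pint (Ip p) = 0"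
proof -
  define q0 where "q0 = (\<Sum>i\<le>degree p. monom (coeff p i / real (Suc i)) (Suc i))"
  have "pderiv q0 = (\<Sum>i\<le>degree p. monom (coeff p i) i)"
    using higher_pderiv_sum[of 1 "\<lambda>i. monom (coeff p i / real (Suc i)) (Suc i)" "{..degree p}"]
    by (simp add: q0_def pderiv_monom)
  then have "pderiv (q0 - [:pint q0:]) = p" by (simp add: pderiv_diff poly_as_sum_of_monoms)
  moreover have "pint (q0 - [:pint q0:]) = 0"
    using pint_smult[of "pint q0" 1] by (simp add: pint_diff)
  ultimately have "\<exists>q. pderiv q = p \<and> pint q = 0" by blast
  from someI_ex[OF this] show "pderiv (Ip p) = p" "pint (Ip p) = 0" by (auto simp: Ip_def)
qed

lemma funpow_pderiv_Ip: "l \<le> r \<Longrightarrow> (pderiv ^^ l) ((Ip ^^ r) p) = (Ip ^^ (r - l)) p"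
proof (induction l)
  case (Suc l)
  then have "r - l = Suc (r - Suc l)" by simp
  then show ?case using Suc by (simp add: Ip)
qed simp

text \<open>The functionals \<open>bf\<close>, the means of the derivatives followed by the Legendre coefficients of the highest
  derivative, are orthonormal coordinates for \<open>sob_ip\<close>; the polynomials \<open>ek\<close> are the dual basis.\<close>

definition ek :: "nat \<Rightarrow> nat \<Rightarrow> real poly" where
  "ek m k = (if k < m - 1 then (Ip ^^ Suc k) 1 else (Ip ^^ m) (Leg (k - (m - 1))))"

definition bf :: "nat \<Rightarrow> nat \<Rightarrow> (real \<Rightarrow> real) \<Rightarrow> real" where
  "bf m k f = (if k < m - 1 then integral {0..1} (sob_der m f (Suc k))
     else lc (sob_der m f m) (k - (m - 1)))"

text \<open>Every application of \<open>Ip\<close> produces mean zero, and differentiation undoes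
  it. Among the derivatives of order below m, only the constant 1 at the start of the construction
  has a nonzero mean.\<close>

lemma ek_mean:
  assumes "l < m" shows "pint ((pderiv ^^ l) (ek m k)) = (if l = Suc k then 1 else 0)"
proof (cases "k < m - 1")
  case True
  show ?thesis
  proof (cases "l \<le> k")
    case True
    then have "(pderiv ^^ l) (ek m k) = Ip ((Ip ^^ (k - l)) 1)"
      using \<open>k < m - 1\<close> funpow_pderiv_Ip[of l "Suc k" 1] by (simp add: ek_def Suc_diff_le del: funpow.simps) simp
    then show ?thesis using True by (simp add: Ip)
  next
    case False
    then obtain i where i: "l = i + Suc k" by (metis add.commute less_eq_Suc_le nat_le_iff_add not_le)
    have "(pderiv ^^ l) (ek m k) = (pderiv ^^ i) 1"
      using True funpow_pderiv_Ip[of "Suc k" "Suc k" 1]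
      by (simp add: ek_def i funpow_add del: funpow.simps add_Suc_right)
    then show ?thesis using i funpow_pderiv_eq_0[of 1 i] by (cases "i = 0") auto
  qed
next
  case False
  have "(pderiv ^^ l) (ek m k) = Ip ((Ip ^^ (m - l - 1)) (Leg (k - (m - 1))))"
    using assms False funpow_pderiv_Ip[of l m "Leg (k - (m - 1))"]
    by (simp add: ek_def) (metis Suc_diff_Suc diff_Suc_eq_diff_pred diff_commute funpow.simps(2) o_apply)
  then show ?thesis using False assms by (simp add: Ip)
qed

lemma ek_top: "(pderiv ^^ m) (ek m k) = (if k < m - 1 then 0 else Leg (k - (m - 1)))"
proof (cases "k < m - 1")
  case True
  then have "m = (m - Suc k) + Suc k" "m - Suc k > 0" by auto
  then have "(pderiv ^^ m) (ek m k) = (pderiv ^^ (m - Suc k)) ((pderiv ^^ Suc k) ((Ip ^^ Suc k) 1))"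
    using True by (metis comp_apply ek_def funpow_add)
  also have "\<dots> = 0" using \<open>m - Suc k > 0\<close>
    by (subst funpow_pderiv_Ip) (auto simp: funpow_pderiv_eq_0)
  finally show ?thesis using True by simp
qed (simp add: ek_def funpow_pderiv_Ip)

text \<open>The squared norm of \<open>sob_ip\<close> for polynomials, written with their actual
  derivatives because \<open>sob_der\<close> selects derivatives by choice.\<close>

definition Qf :: "nat \<Rightarrow> real poly \<Rightarrow> real" where
  "Qf m p = (\<Sum>l=1..m-1. (pint ((pderiv ^^ l) p))\<^sup>2) + pint ((pderiv ^^ m) p * (pderiv ^^ m) p)"

lemma Qf_sum_ek:
  assumes "finite F" "1 \<le> m"
  shows "Qf m (\<Sum>k\<in>F. smult (b k) (ek m k)) = (\<Sum>k\<in>F. (b k)\<^sup>2)"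
proof -
  let ?p = "\<Sum>k\<in>F. smult (b k) (ek m k)"
  have 1: "(pint ((pderiv ^^ l) ?p))\<^sup>2 = (\<Sum>k\<in>F. if l = Suc k then (b k)\<^sup>2 else 0)" if "l \<in> {1..m-1}" for l
  proof -
    have "l < m" using that by auto
    then have "pint ((pderiv ^^ l) ?p) = (\<Sum>k\<in>F. if l - 1 = k then b k else 0)"
      using that by (auto simp: higher_pderiv_sum higher_pderiv_smult pint_sum pint_smult ek_mean intro!: sum.cong)
    moreover have "(\<Sum>k\<in>F. if l = Suc k then (b k)\<^sup>2 else 0) = (\<Sum>k\<in>F. if l - 1 = k then (b k)\<^sup>2 else 0)"
      using that by (intro sum.cong) auto
    ultimately show ?thesis using assms(1) by simp
  qed
  have 2: "(\<Sum>l=1..m-1. (pint ((pderiv ^^ l) ?p))\<^sup>2) = (\<Sum>k\<in>F. if k < m - 1 then (b k)\<^sup>2 else 0)"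
  proof -
    have "(\<Sum>l=1..m-1. (pint ((pderiv ^^ l) ?p))\<^sup>2) = (\<Sum>k\<in>F. \<Sum>l=1..m-1. if l = Suc k then (b k)\<^sup>2 else 0)"
      by (subst sum.swap) (intro sum.cong refl 1)
    also have "\<dots> = (\<Sum>k\<in>F. if k < m - 1 then (b k)\<^sup>2 else 0)"
      by (intro sum.cong refl) auto
    finally show ?thesis .
  qed
  have "(pderiv ^^ m) ?p = (\<Sum>k\<in>F. smult (b k) (if k < m - 1 then 0 else Leg (k - (m - 1))))"
    by (simp add: higher_pderiv_sum higher_pderiv_smult ek_top)
  then have "pint ((pderiv ^^ m) ?p * (pderiv ^^ m) ?p) = (\<Sum>i\<in>F. \<Sum>j\<in>F. pint (smult (b i) (if i < m - 1 then 0 else Leg (i - (m - 1)))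
      * smult (b j) (if j < m - 1 then 0 else Leg (j - (m - 1)))))"
    by (simp only: sum_product pint_sum)
  also have "\<dots> = (\<Sum>i\<in>F. \<Sum>j\<in>F. if i = j then (if i < m - 1 then 0 else (b i)\<^sup>2) else 0)"
    by (intro sum.cong refl) (auto simp: pint_smult Leg_orthonormal power2_eq_square)
  also have "\<dots> = (\<Sum>i\<in>F. if i < m - 1 then 0 else (b i)\<^sup>2)" using assms(1) by simp
  finally have 3: "pint ((pderiv ^^ m) ?p * (pderiv ^^ m) ?p) = (\<Sum>i\<in>F. if i < m - 1 then 0 else (b i)\<^sup>2)" .
  show ?thesis unfolding Qf_def 2 3 sum.distrib[symmetric] by (intro sum.cong) auto
qed

text \<open>The supremum bound has at most m terms, namely means of orders 1 to m - 1 and one L2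
  norm, since the mean of order zero vanishes. The Cauchy-Schwarz inequality over them gives the
  factor \<open>m\<close>.\<close>

lemma poly_sup_Qf:
  assumes "pint p = 0" "l < m" "x \<in> {0..1}"
  shows "(poly ((pderiv ^^ l) p) x)\<^sup>2 \<le> real m * Qf m p"
proof -
  define y where "y i = (if i = m then sqrt (pint ((pderiv ^^ m) p * (pderiv ^^ m) p)) else \<bar>pint ((pderiv ^^ i) p)\<bar>)" for i
  have "\<bar>poly ((pderiv ^^ l) p) x\<bar> \<le> (\<Sum>i\<in>{l..<m}. \<bar>pint ((pderiv ^^ i) p)\<bar>) + sqrt (pint ((pderiv ^^ m) p * (pderiv ^^ m) p))"
    using sob_chain_sup[OF sob_chain_poly[of m p] assms(2)] assms(3)
    by (simp add: pint_def[symmetric] pint_ulm[of "_ * _"] poly_mult[abs_def] power2_eq_square)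
  also have "(\<Sum>i\<in>{l..<m}. \<bar>pint ((pderiv ^^ i) p)\<bar>) = (\<Sum>i\<in>{l..<m} - {0}. y i)"
    by (rule sum.mono_neutral_cong_right) (auto simp: y_def assms(1))
  also have "\<dots> + sqrt (pint ((pderiv ^^ m) p * (pderiv ^^ m) p)) = (\<Sum>i\<in>insert m ({l..<m} - {0}). y i)"
    by (subst sum.insert) (auto simp: y_def)
  also have "\<dots> \<le> (\<Sum>i\<in>{1..m}. y i)"
    using assms(2) by (intro sum_mono2) (auto simp: y_def pint_square_nonneg)
  finally have "(poly ((pderiv ^^ l) p) x)\<^sup>2 \<le> (\<Sum>i\<in>{1..m}. y i)\<^sup>2"
    by (metis abs_ge_zero power2_abs power_mono)
  also have "\<dots> \<le> (\<Sum>i\<in>{1..m}. (y i)\<^sup>2) * card {1..m}" by (rule sum_squared_le_sum_of_squares)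
  also have "{1..m} = insert m {1..m - 1}" using assms(2) by auto
  also have "(\<Sum>i\<in>insert m {1..m - 1}. (y i)\<^sup>2) = Qf m p"
    using assms(2) unfolding Qf_def
    by (subst sum.insert) (auto simp: y_def pint_square_nonneg intro!: sum.cong)
  finally show ?thesis using assms(2) by (simp add: mult.commute)
qed

definition sK :: "nat \<Rightarrow> (nat \<Rightarrow> real) \<Rightarrow> nat set \<Rightarrow> real poly" where
  "sK m b F = (\<Sum>k\<in>F. smult (b k) (ek m k))"

lemma sK_mean:
  assumes "finite F" "l < m"
  shows "pint ((pderiv ^^ l) (sK m b F)) = (if 0 < l \<and> l - 1 \<in> F then b (l - 1) else 0)"
proof -
  have "pint ((pderiv ^^ l) (sK m b F)) = (\<Sum>k\<in>F. if l = Suc k then b k else 0)"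
    using assms(2) by (auto simp: sK_def higher_pderiv_sum higher_pderiv_smult pint_sum pint_smult ek_mean intro!: sum.cong)
  also have "\<dots> = (if 0 < l \<and> l - 1 \<in> F then b (l - 1) else 0)"
    using assms(1) by (cases l) auto
  finally show ?thesis .
qed

lemma sK_sup:
  assumes "finite F" "l < m" "x \<in> {0..1}"
  shows "(poly ((pderiv ^^ l) (sK m b F)) x)\<^sup>2 \<le> real m * (\<Sum>k\<in>F. (b k)\<^sup>2)"
  using poly_sup_Qf[of "sK m b F" l m x] sK_mean[of F 0 m b] Qf_sum_ek[of F m b] assms
  by (simp add: sK_def)

text \<open>The supremum bound for the coefficients \<open>poly (ek m k) x\<close> themselves gives
  E^2 \<le> m E. The sum E is a partial sum of the reproducing kernel on the diagonal.\<close>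

lemma ek_sq_sum:
  assumes "x \<in> {0..1}" "finite F" "1 \<le> m"
  shows "(\<Sum>k\<in>F. (poly (ek m k) x)\<^sup>2) \<le> real m"
proof -
  let ?E = "\<Sum>k\<in>F. (poly (ek m k) x)\<^sup>2"
  have "poly (sK m (\<lambda>k. poly (ek m k) x) F) x = ?E"
    by (simp add: sK_def poly_sum power2_eq_square)
  then have "?E\<^sup>2 \<le> real m * ?E"
    using sK_sup[OF assms(2) _ assms(1), of 0 m "\<lambda>k. poly (ek m k) x"] assms(3) by simp
  moreover have "0 \<le> ?E" by (intro sum_nonneg) auto
  ultimately show ?thesis by (cases "?E = 0") (auto simp: power2_eq_square)
qed

lemma sob0_chain:
  assumes "f \<in> sob0 m" shows "sob_chain m f (sob_der m f)" "integral {0..1} (sob_der m f 0) = 0"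
proof -
  have "\<exists>g. sob_chain m f g" using assms by (auto simp: sob0_def sobolev_def)
  then show c: "sob_chain m f (sob_der m f)" unfolding sob_der_def by (rule someI_ex)
  have "integral {0..1} (sob_der m f 0) = integral {0..1} f"
    by (intro Henstock_Kurzweil_Integration.integral_cong sob_chainD(1)[OF c])
  then show "integral {0..1} (sob_der m f 0) = 0" using assms by (simp add: sob0_def)
qed

lemma bf_sums_sob_ip:
  assumes "f \<in> sob0 m" "h \<in> sob0 m" "1 \<le> m"
  shows "(\<lambda>k. bf m k f * bf m k h) sums sob_ip m f h"
proof -
  let ?F = "\<lambda>k. bf m k f * bf m k h"
  have sf: "sqi (sob_der m f m)" and sh: "sqi (sob_der m h m)"
    using sob_chain_sqi sob0_chain assms by blast+
  have "(\<lambda>i. ?F (i + (m - 1))) sums integral\<^sup>L ulm (\<lambda>x. sob_der m f m x * sob_der m h m x)"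
    using lc_parseval_mult[OF sf sh] by (simp add: bf_def)
  then have "?F sums (integral\<^sup>L ulm (\<lambda>x. sob_der m f m x * sob_der m h m x) + (\<Sum>k<m - 1. ?F k))"
    by (rule sums_iff_shift[THEN iffD1])
  moreover have "(\<Sum>k<m - 1. ?F k) = (\<Sum>l=1..m-1. integral {0..1} (sob_der m f l) * integral {0..1} (sob_der m h l))"
    by (simp add: sum.atLeast1_atMost_eq bf_def)
  moreover have "integral\<^sup>L ulm (\<lambda>x. sob_der m f m x * sob_der m h m x) = integral {0..1} (\<lambda>x. sob_der m f m x * sob_der m h m x)"
    by (rule integral_ulm[symmetric]) (rule sqi_mult_integrable[OF sf sh])
  ultimately show ?thesis by (simp add: sob_ip_def add.commute)
qed

text \<open>The remainder after K + m - 1 terms has vanishing means of all orders below m. Its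
  supremum is then at most the L2 norm of the Legendre remainder of the highest derivative.\<close>

lemma bf_sums_eval:
  assumes f: "f \<in> sob0 m" and m: "1 \<le> m" and x: "x \<in> {0..1}"
  shows "(\<lambda>k. bf m k f * poly (ek m k) x) sums f x"
proof -
  let ?g = "sob_der m f" and ?b = "\<lambda>k. bf m k f"
  let ?G = "integral\<^sup>L ulm (\<lambda>x. (?g m x)\<^sup>2)"
  note c = sob0_chain[OF f]
  have sg: "sqi (?g m)" by (rule sob_chain_sqi[OF c(1)])
  have bd: "\<bar>f x - poly (sK m ?b {..<K + (m - 1)}) x\<bar> \<le> sqrt (?G - (\<Sum>k<K. (lc (?g m) k)\<^sup>2))" for K
  proof -
    define s where "s = sK m ?b {..<K + (m - 1)}"
    have cr: "sob_chain m (\<lambda>x. f x - poly s x) (\<lambda>l x. ?g l x - poly ((pderiv ^^ l) s) x)"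
      by (rule sob_chain_diff[OF c(1) sob_chain_poly])
    have mean: "integral {0..1} (\<lambda>x. ?g i x - poly ((pderiv ^^ i) s) x) = 0" if "i < m" for i
    proof -
      have "?g i integrable_on {0..1}"
        using sob_chain_continuous[OF c(1) that] by (rule integrable_continuous_interval)
      then have "integral {0..1} (\<lambda>x. ?g i x - poly ((pderiv ^^ i) s) x) = integral {0..1} (?g i) - pint ((pderiv ^^ i) s)"
        unfolding pint_def by (rule Henstock_Kurzweil_Integration.integral_diff) simp
      moreover have "pint ((pderiv ^^ i) s) = integral {0..1} (?g i)"
        using that c(2) m by (subst s_def, subst sK_mean) (cases i; auto simp: bf_def)+
      ultimately show ?thesis by simp
    qed
    have "(pderiv ^^ m) s = (\<Sum>k<K + (m - 1). smult (?b k) (if k < m - 1 then 0 else Leg (k - (m - 1))))"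
      by (simp add: s_def sK_def higher_pderiv_sum higher_pderiv_smult ek_top)
    also have "\<dots> = (\<Sum>k\<in>{m-1..<K + (m - 1)}. smult (?b k) (if k < m - 1 then 0 else Leg (k - (m - 1))))"
      by (rule sum.mono_neutral_right) auto
    also have "\<dots> = (\<Sum>k<K. smult (lc (?g m) k) (Leg k))"
      by (rule sum.reindex_bij_witness[of _ "\<lambda>k. k + (m - 1)" "\<lambda>k. k - (m - 1)"]) (auto simp: bf_def)
    finally have top: "integral\<^sup>L ulm (\<lambda>x. (?g m x - poly ((pderiv ^^ m) s) x)\<^sup>2) = ?G - (\<Sum>k<K. (lc (?g m) k)\<^sup>2)"
      using lc_bessel[OF sg] by simp
    have "\<bar>?g 0 x - poly ((pderiv ^^ 0) s) x\<bar> \<le> sqrt (?G - (\<Sum>k<K. (lc (?g m) k)\<^sup>2))"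
      using sob_chain_sup[OF cr, of 0] x m unfolding top by (simp add: mean)
    then show ?thesis using sob_chainD(1)[OF c(1) x] by (simp add: s_def)
  qed
  have "(\<lambda>K. sqrt (?G - (\<Sum>k<K. (lc (?g m) k)\<^sup>2))) \<longlonglongrightarrow> sqrt (?G - ?G)"
    using lc_parseval[OF sg] unfolding sums_def by (intro tendsto_intros)
  then have lim: "(\<lambda>K. sqrt (?G - (\<Sum>k<K. (lc (?g m) k)\<^sup>2))) \<longlonglongrightarrow> 0" by simp
  have "(\<lambda>K. f x - poly (sK m ?b {..<K + (m - 1)}) x) \<longlonglongrightarrow> 0"
    by (rule Lim_null_comparison[OF always_eventually lim]) (simp only: real_norm_def bd simp_thms)
  from tendsto_diff[OF tendsto_const[of "f x"] this]
  have "(\<lambda>K. poly (sK m ?b {..<K + (m - 1)}) x) \<longlonglongrightarrow> f x" by (simp only: diff_diff_eq2 add_diff_cancel_left' diff_zero)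
  then have "(\<lambda>K. \<Sum>k<K + (m - 1). ?b k * poly (ek m k) x) \<longlonglongrightarrow> f x"
    by (simp only: sK_def poly_sum poly_smult)
  then show ?thesis unfolding sums_def by (rule LIMSEQ_offset)
qed

section \<open>Uniqueness of square summable expansions in the dual basis\<close>

lemma poly_deriv_bound:
  assumes lip: "\<And>u v. u \<in> {0..1} \<Longrightarrow> v \<in> {0..1} \<Longrightarrow> \<bar>poly p u - poly p v\<bar> \<le> e * \<bar>u - v\<bar>"
    and x: "x \<in> {0..1::real}"
  shows "\<bar>poly (pderiv p) x\<bar> \<le> e"
proof -
  have "(poly p has_field_derivative poly (pderiv p) x) (at x within {0..1})"
    by (rule DERIV_subset[OF poly_DERIV]) simp
  then have "((\<lambda>y. (poly p y - poly p x) / (y - x)) \<longlongrightarrow> poly (pderiv p) x) (at x within {0..1})"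
    by (simp only: has_field_derivative_iff)
  then have "((\<lambda>y. \<bar>(poly p y - poly p x) / (y - x)\<bar>) \<longlongrightarrow> \<bar>poly (pderiv p) x\<bar>) (at x within {0..1})"
    by (rule tendsto_rabs)
  moreover have "\<forall>\<^sub>F y in at x within {0..1}. \<bar>(poly p y - poly p x) / (y - x)\<bar> \<le> e"
    unfolding eventually_at_filter
  proof (rule always_eventually, intro allI impI)
    fix y assume "y \<noteq> x" "y \<in> {0..1}"
    then show "\<bar>(poly p y - poly p x) / (y - x)\<bar> \<le> e"
      using lip[of y x] x by (simp add: divide_le_eq)
  qed
  moreover have "at x within {0..1} \<noteq> bot"
    using x by (simp add: trivial_limit_within islimpt_Icc)
  ultimately show ?thesis by (rule tendsto_upperbound)
qed

lemma poly_lipschitz: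
  assumes "\<And>x. x \<in> {0..1} \<Longrightarrow> \<bar>poly (pderiv q) x\<bar> \<le> e" "u \<in> {0..1}" "v \<in> {0..1::real}"
  shows "\<bar>poly q u - poly q v\<bar> \<le> e * \<bar>u - v\<bar>"
  using field_differentiable_bound[of "{0..1}" "poly q" "poly (pderiv q)" e u v] assms
  by (auto intro!: DERIV_subset[OF poly_DERIV])

lemma sK_diff:
  assumes "M \<le> K"
  shows "sK m b {..<K} = sK m b {..<M} + sK m b {M..<K}"
  unfolding sK_def by (subst sum.union_disjoint[symmetric]) (use assms in \<open>auto intro!: sum.cong\<close>)

text \<open>Derivatives of order below \<open>m\<close> of the partial sums converge uniformly, so the vanishing of the
  sum passes from each derivative to the next one.\<close>

lemma ek_unique:
  assumes m: "1 \<le> m" and sb: "summable (\<lambda>k. (b k)\<^sup>2)"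
    and z: "\<And>x. x \<in> {0..1} \<Longrightarrow> (\<lambda>k. b k * poly (ek m k) x) sums 0"
  shows "b k = 0"
proof -
  define s where "s K = sK m b {..<K}" for K
  \<comment> \<open>By orthonormality the derivatives of order below m of a block of the series are
    bounded, uniformly in x, by the squares of its coefficients.\<close>
  have cauchy: "\<exists>N. \<forall>M\<ge>N. \<forall>K\<ge>M. \<forall>l<m. \<forall>x\<in>{0..1}. \<bar>poly ((pderiv ^^ l) (s K)) x - poly ((pderiv ^^ l) (s M)) x\<bar> \<le> e"
    if e: "e > 0" for e :: real
  proof -
    have "e\<^sup>2 / real m > 0" using e m by simp
    then obtain N where N: "\<And>M K. M \<ge> N \<Longrightarrow> norm (\<Sum>k\<in>{M..<K}. (b k)\<^sup>2) < e\<^sup>2 / real m"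
      using sb unfolding summable_Cauchy by blast
    have "\<bar>poly ((pderiv ^^ l) (s K)) x - poly ((pderiv ^^ l) (s M)) x\<bar> \<le> e"
      if "M \<ge> N" "K \<ge> M" "l < m" "x \<in> {0..1}" for M K l x
    proof -
      have "(poly ((pderiv ^^ l) (sK m b {M..<K})) x)\<^sup>2 \<le> real m * (\<Sum>k\<in>{M..<K}. (b k)\<^sup>2)"
        using that by (intro sK_sup) auto
      also have "\<dots> \<le> e\<^sup>2" using N[OF that(1), of K] m by (simp add: sum_nonneg field_simps)
      finally have "\<bar>poly ((pderiv ^^ l) (sK m b {M..<K})) x\<bar> \<le> e"
        using e abs_le_square_iff[of _ e] by simp
      then show ?thesis unfolding s_def sK_diff[OF that(2)] by (simp add: higher_pderiv_add)
    qed
    then show ?thesis by blast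
  qed
  have uc: "\<exists>N. \<forall>K\<ge>N. \<forall>x\<in>{0..1}. \<bar>poly ((pderiv ^^ l) (s K)) x\<bar> \<le> e" if "l < m" "e > 0" for l and e :: real
    using that
  proof (induction l arbitrary: e)
    case 0
    obtain N where N: "\<forall>M\<ge>N. \<forall>K\<ge>M. \<forall>l<m. \<forall>x\<in>{0..1}. \<bar>poly ((pderiv ^^ l) (s K)) x - poly ((pderiv ^^ l) (s M)) x\<bar> \<le> e"
      using cauchy[OF \<open>e > 0\<close>] by blast
    have "\<bar>poly (s M) x\<bar> \<le> e" if "M \<ge> N" "x \<in> {0..1}" for M x
    proof -
      have "(\<lambda>K. poly (s K) x) \<longlonglongrightarrow> 0"
        using z[OF that(2)] unfolding sums_def s_def sK_def by (simp add: poly_sum)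
      then have "(\<lambda>K. \<bar>poly (s K) x - poly (s M) x\<bar>) \<longlonglongrightarrow> \<bar>0 - poly (s M) x\<bar>" by (intro tendsto_intros)
      moreover have "\<forall>K\<ge>M. \<bar>poly (s K) x - poly (s M) x\<bar> \<le> e"
        using N that \<open>0 < m\<close> by (metis funpow_0)
      ultimately have "\<bar>0 - poly (s M) x\<bar> \<le> e" by (intro LIMSEQ_le_const2) auto
      then show ?thesis by simp
    qed
    then show ?case by (intro exI[of _ N]) auto
  next
    case (Suc l)
    then have l: "l < m" by simp
    obtain N where N: "\<forall>M\<ge>N. \<forall>K\<ge>M. \<forall>l<m. \<forall>x\<in>{0..1}. \<bar>poly ((pderiv ^^ l) (s K)) x - poly ((pderiv ^^ l) (s M)) x\<bar> \<le> e"
      using cauchy[OF \<open>e > 0\<close>] by blast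
    have lim: "(\<lambda>K. poly ((pderiv ^^ l) (s K)) x) \<longlonglongrightarrow> 0" if x: "x \<in> {0..1}" for x
    proof (rule LIMSEQ_I)
      fix r :: real assume "r > 0"
      then obtain N' where "\<forall>K\<ge>N'. \<forall>x\<in>{0..1}. \<bar>poly ((pderiv ^^ l) (s K)) x\<bar> \<le> r / 2"
        using Suc.IH[OF l, of "r/2"] by auto
      then show "\<exists>no. \<forall>n\<ge>no. norm (poly ((pderiv ^^ l) (s n)) x - 0) < r"
        using x \<open>r > 0\<close> by (intro exI[of _ N']) fastforce
    qed
    have "\<bar>poly ((pderiv ^^ Suc l) (s M)) x\<bar> \<le> e" if M: "M \<ge> N" and x: "x \<in> {0..1}" for M x
    proof -
      let ?p = "(pderiv ^^ l) (s M)"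
      have "\<bar>poly ?p u - poly ?p v\<bar> \<le> e * \<bar>u - v\<bar>" if uv: "u \<in> {0..1}" "v \<in> {0..1}" for u v
      proof -
        let ?q = "\<lambda>K. ?p - (pderiv ^^ l) (s K)"
        have "\<bar>poly (?q K) u - poly (?q K) v\<bar> \<le> e * \<bar>u - v\<bar>" if "K \<ge> M" for K
        proof (rule poly_lipschitz[OF _ uv])
          fix y :: real assume "y \<in> {0..1}"
          then have "\<bar>poly ((pderiv ^^ Suc l) (s K)) y - poly ((pderiv ^^ Suc l) (s M)) y\<bar> \<le> e"
            using N M that Suc.prems(1) by blast
          then show "\<bar>poly (pderiv (?q K)) y\<bar> \<le> e" by (simp add: pderiv_diff abs_minus_commute)
        qed
        moreover have "(\<lambda>K. \<bar>poly (?q K) u - poly (?q K) v\<bar>) \<longlonglongrightarrow> \<bar>(poly ?p u - 0) - (poly ?p v - 0)\<bar>"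
          unfolding poly_diff by (intro tendsto_intros lim uv)
        ultimately have "\<bar>(poly ?p u - 0) - (poly ?p v - 0)\<bar> \<le> e * \<bar>u - v\<bar>"
          by (intro LIMSEQ_le_const2) auto
        then show ?thesis by simp
      qed
      \<comment> \<open>The Cauchy bound at order l + 1 was turned into a Lipschitz bound at order
        l. The latter survives the limit in \<open>K\<close> and bounds the derivative
        again.\<close>
      from poly_deriv_bound[OF this x] show ?thesis by simp
    qed
    then show ?case by blast
  qed
  show ?thesis
  proof (cases "k < m - 1")
    case True
    \<comment> \<open>Here \<open>b k\<close> is the mean of a derivative of order below m, and
      these derivatives tend to zero uniformly.\<close>
    have "\<bar>b k\<bar> \<le> e" if "e > 0" for e
    proof -
      have "Suc k < m" using True by simp
      from uc[OF this \<open>e > 0\<close>]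
      obtain N where N: "\<forall>K\<ge>N. \<forall>x\<in>{0..1}. \<bar>poly ((pderiv ^^ Suc k) (s K)) x\<bar> \<le> e" by blast
      let ?K = "max N (Suc k)" let ?p = "(pderiv ^^ Suc k) (s ?K)"
      have "pint ?p = b k"
        unfolding s_def using \<open>Suc k < m\<close> by (subst sK_mean) auto
      moreover have "pint ?p \<le> pint [:e:]" "pint (- [:e:]) \<le> pint ?p"
      proof -
        have bnd: "\<bar>poly ?p x\<bar> \<le> e" if "x \<in> {0..1}" for x using N that by simp
        show "pint ?p \<le> pint [:e:]" using bnd by (intro pint_mono) (fastforce simp: abs_le_iff)
        show "pint (- [:e:]) \<le> pint ?p" using bnd by (intro pint_mono) (fastforce simp: abs_le_iff)
      qed
      moreover have "pint [:e:] = e" "pint (- [:e:]) = - e"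
        using pint_smult[of e 1] pint_smult[of "-e" 1] by simp_all
      ultimately show ?thesis by linarith
    qed
    then show ?thesis using field_le_epsilon[of "\<bar>b k\<bar>" 0] by simp
  next
    case False
    \<comment> \<open>Here \<open>b k\<close> is a Legendre coefficient of the m-th derivative,
      about which the uniform convergence says nothing. Integration by parts moves it to order m -
      1; the constant \<open>C\<close> collects the boundary values and the bound
      \<open>D\<close>.\<close>
    define j where "j = k - (m - 1)"
    obtain D where D: "\<And>x. x \<in> {0..1} \<Longrightarrow> \<bar>poly (pderiv (Leg j)) x\<bar> \<le> D"
    proof -
      have "bounded (poly (pderiv (Leg j)) ` {0..1})"
        by (intro compact_imp_bounded compact_continuous_image continuous_on_poly_real) auto
      then obtain a where "\<forall>x\<in>{0..1}. \<bar>poly (pderiv (Leg j)) x\<bar> \<le> a" by (auto simp: bounded_iff)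
      then show thesis by (intro that[of a]) blast
    qed
    have D0: "0 \<le> D" using D[of 0] by simp
    define C where "C = \<bar>poly (Leg j) 1\<bar> + \<bar>poly (Leg j) 0\<bar> + D"
    have C0: "0 \<le> C" using D0 by (simp add: C_def)
    have "\<bar>b k\<bar> \<le> e" if "e > 0" for e
    proof -
      have e': "e / (C + 1) > 0" using that C0 by simp
      obtain N where N: "\<forall>K\<ge>N. \<forall>x\<in>{0..1}. \<bar>poly ((pderiv ^^ (m - 1)) (s K)) x\<bar> \<le> e / (C + 1)"
        using uc[OF _ e', of "m - 1"] m by auto
      let ?K = "max N (Suc k)"
      define p where "p = (pderiv ^^ (m - 1)) (s ?K)"
      have pb: "\<bar>poly p x\<bar> \<le> e / (C + 1)" if "x \<in> {0..1}" for x using N that unfolding p_def by simp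
      have "pderiv p = (pderiv ^^ m) (s ?K)" using m unfolding p_def
        by (metis Suc_diff_1 funpow.simps(2) less_eq_Suc_le One_nat_def o_apply)
      also have "\<dots> = (\<Sum>i<?K. smult (b i) (if i < m - 1 then 0 else Leg (i - (m - 1))))"
        by (simp add: s_def sK_def higher_pderiv_sum higher_pderiv_smult ek_top)
      finally have "pint (pderiv p * Leg j) = (\<Sum>i<?K. pint (smult (b i) (if i < m - 1 then 0 else Leg (i - (m - 1))) * Leg j))"
        by (simp only: sum_distrib_right pint_sum)
      also have "\<dots> = (\<Sum>i<?K. if i = k then b k else 0)"
        using False by (intro sum.cong refl) (auto simp: pint_smult Leg_orthonormal j_def)
      also have "\<dots> = b k" by simp
      finally have bk: "b k = pint (pderiv p * Leg j)" ..
      have "pint (pderiv p * Leg j) + pint (p * pderiv (Leg j)) = poly p 1 * poly (Leg j) 1 - poly p 0 * poly (Leg j) 0"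
        using pint_pderiv[of "p * Leg j"] by (simp add: pderiv_mult pint_add algebra_simps)
      then have eq: "b k = poly p 1 * poly (Leg j) 1 - poly p 0 * poly (Leg j) 0 - pint (p * pderiv (Leg j))"
        using bk by linarith
      let ?d = "e / (C + 1)"
      have "\<bar>poly p x * poly (pderiv (Leg j)) x\<bar> \<le> ?d * D" if "x \<in> {0..1}" for x
        unfolding abs_mult using pb[OF that] D[OF that] e' by (intro mult_mono) auto
      then have "pint (p * pderiv (Leg j)) \<le> pint [:?d * D:]" "pint (- [:?d * D:]) \<le> pint (p * pderiv (Leg j))"
        by (intro pint_mono; fastforce simp: abs_le_iff)+
      moreover have "pint [:?d * D:] = ?d * D" "pint (- [:?d * D:]) = - (?d * D)"
        using pint_smult[of "?d * D" 1] pint_smult[of "- (?d * D)" 1] by simp_all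
      ultimately have 1: "\<bar>pint (p * pderiv (Leg j))\<bar> \<le> ?d * D" by linarith
      have 2: "\<bar>poly p 1 * poly (Leg j) 1\<bar> \<le> ?d * \<bar>poly (Leg j) 1\<bar>" "\<bar>poly p 0 * poly (Leg j) 0\<bar> \<le> ?d * \<bar>poly (Leg j) 0\<bar>"
        unfolding abs_mult by (rule mult_right_mono[OF pb]; simp)+
      have "\<bar>b k\<bar> \<le> ?d * \<bar>poly (Leg j) 1\<bar> + ?d * \<bar>poly (Leg j) 0\<bar> + ?d * D"
        unfolding eq using 1 2 by linarith
      also have "\<dots> = ?d * C" by (simp only: C_def distrib_left)
      also have "\<dots> \<le> e" using C0 that by (simp add: field_simps)
      finally show ?thesis .
    qed
    then show ?thesis using field_le_epsilon[of "\<bar>b k\<bar>" 0] by simp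
  qed
qed

section \<open>The change of basis to Legendre polynomials\<close>

definition Acoef :: "nat \<Rightarrow> nat \<Rightarrow> nat \<Rightarrow> real" where
  "Acoef m k j = pint (ek m k * Leg (Suc j))"

text \<open>The Legendre polynomial of degree 0 is missing because every \<open>ek\<close> has mean
  zero. This is the reason for the shift by one in \<open>Acoef\<close>.\<close>

lemma ek_Leg_expansion:
  assumes "1 \<le> m" "degree (ek m k) \<le> N"
  shows "poly (ek m k) x = (\<Sum>j<N. Acoef m k j * poly (Leg (Suc j)) x)"
proof -
  have "ek m k = (\<Sum>j\<le>N. smult (pint (ek m k * Leg j)) (Leg j))"
    by (rule Leg_expansion) fact
  also have "\<dots> = smult (pint (ek m k * Leg 0)) (Leg 0) + (\<Sum>j<N. smult (Acoef m k j) (Leg (Suc j)))"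
    by (simp only: Acoef_def sum.atMost_shift)
  also have "pint (ek m k * Leg 0) = 0" using ek_mean[of 0 m k] assms by simp
  finally have "poly (ek m k) x = poly (\<Sum>j<N. smult (Acoef m k j) (Leg (Suc j))) x" by simp
  then show ?thesis by (simp add: poly_sum)
qed

text \<open>The first summand belongs to degrees below m, where the weight is at most m^(2m) and the
  squared L2 norm is at most m times the squared Sobolev norm. The second is the factor of
  \<open>leg_mu_lower\<close>.\<close>

definition CU :: "nat \<Rightarrow> real" where
  "CU m = real m ^ (2 * m) * real m + (real m + 1) ^ m"

lemma CU_pos: "1 \<le> CU m"
proof -
  have "1 \<le> (real m + 1) ^ m" by (rule one_le_power) simp
  then show ?thesis by (simp add: CU_def add_increasing)
qed

text \<open>The univariate case of the weighted coefficient inequality, for finite sums and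
  uniformly in \<open>N\<close>; as an operator bound it passes to tensor products. The eigenvalues
  vanish for degrees below m, so there the supremum bound takes over.\<close>

lemma Acoef_bound:
  assumes "finite F" "1 \<le> m"
  shows "(\<Sum>j<N. real (Suc j) ^ (2 * m) * (\<Sum>k\<in>F. b k * Acoef m k j)\<^sup>2) \<le> CU m * (\<Sum>k\<in>F. (b k)\<^sup>2)"
proof -
  define s where "s = sK m b F"
  let ?B = "\<Sum>k\<in>F. (b k)\<^sup>2"
  define n where "n = max N (degree s)"
  have dn: "degree s \<le> n" by (simp add: n_def)
  have c: "(\<Sum>k\<in>F. b k * Acoef m k j) = pint (s * Leg (Suc j))" for j
    by (simp add: s_def sK_def Acoef_def sum_distrib_right pint_sum pint_smult)
  have Q: "Qf m s = ?B" using Qf_sum_ek[OF assms] by (simp add: s_def sK_def)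
  have top: "pint ((pderiv ^^ m) s * (pderiv ^^ m) s) \<le> ?B"
    unfolding Q[symmetric] Qf_def by (simp add: sum_nonneg)
  have low: "pint (s * s) \<le> real m * ?B"
  proof -
    have "pint (s * s) \<le> pint [:real m * ?B:]"
      using sK_sup[OF assms(1), of 0 m _ b] assms(2) by (intro pint_mono) (simp add: s_def power2_eq_square)
    also have "\<dots> = real m * ?B" using pint_smult[of "real m * ?B" 1] by simp
    finally show ?thesis .
  qed
  have pt: "real j ^ (2 * m) * y\<^sup>2 \<le> real m ^ (2 * m) * y\<^sup>2 + (real m + 1) ^ m * (leg_mu m j * y\<^sup>2)" for j and y :: real
  proof (cases "m \<le> j")
    case True
    have "real j ^ (2 * m) * y\<^sup>2 \<le> ((real m + 1) ^ m * leg_mu m j) * y\<^sup>2"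
      by (intro mult_right_mono leg_mu_lower True) simp
    then show ?thesis by (simp add: add_increasing mult.assoc)
  next
    case False
    then have "real j ^ (2 * m) * y\<^sup>2 \<le> real m ^ (2 * m) * y\<^sup>2" by (intro mult_right_mono power_mono) auto
    then show ?thesis using leg_mu_nonneg[of m j] by (simp add: add_increasing2)
  qed
  have "(\<Sum>j<N. real (Suc j) ^ (2 * m) * (\<Sum>k\<in>F. b k * Acoef m k j)\<^sup>2)
     = (\<Sum>j\<in>Suc ` {..<N}. real j ^ (2 * m) * (pint (s * Leg j))\<^sup>2)"
    by (subst sum.reindex) (auto simp: c)
  also have "\<dots> \<le> (\<Sum>j\<le>n. real j ^ (2 * m) * (pint (s * Leg j))\<^sup>2)"
    by (rule sum_mono2) (auto simp: n_def)
  also have "\<dots> \<le> (\<Sum>j\<le>n. real m ^ (2 * m) * (pint (s * Leg j))\<^sup>2 + (real m + 1) ^ m * (leg_mu m j * (pint (s * Leg j))\<^sup>2))"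
    by (intro sum_mono pt)
  also have "\<dots> = real m ^ (2 * m) * pint (s * s) + (real m + 1) ^ m * (\<Sum>j\<le>n. leg_mu m j * (pint (s * Leg j))\<^sup>2)"
    unfolding pint_square_Leg[OF dn] by (simp only: sum.distrib sum_distrib_left)
  also have "\<dots> \<le> real m ^ (2 * m) * (real m * ?B) + (real m + 1) ^ m * ?B"
    using low order.trans[OF sum_leg_mu_le[OF dn] top] by (intro add_mono mult_left_mono) auto
  also have "\<dots> = CU m * ?B" by (simp add: CU_def algebra_simps)
  finally show ?thesis .
qed

subsection \<open>Square summable families\<close>

definition l2 :: "'a set \<Rightarrow> ('a \<Rightarrow> real) \<Rightarrow> bool" where
  "l2 I a \<longleftrightarrow> (\<lambda>k. (a k)\<^sup>2) summable_on I"

lemma l2_mult_abs: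
  assumes "l2 I a" "l2 I b" shows "(\<lambda>k. \<bar>a k * b k\<bar>) summable_on I"
proof -
  have "(\<lambda>k. norm (a k * b k)) summable_on I"
  proof (rule Infinite_Sum.abs_summable_on_comparison_test')
    show "(\<lambda>k. (a k)\<^sup>2 + (b k)\<^sup>2) summable_on I"
      using assms unfolding l2_def by (rule summable_on_add)
    fix k
    have "\<bar>u * v\<bar> \<le> u\<^sup>2 + v\<^sup>2" for u v :: real
      using sum_squares_bound[of u v] sum_squares_bound[of u "-v"] zero_le_power2[of u] zero_le_power2[of v]
      by (auto simp: abs_le_iff)
    then show "norm (a k * b k) \<le> (a k)\<^sup>2 + (b k)\<^sup>2" by simp
  qed
  then show ?thesis by simp
qed

lemma l2_mult: "l2 I a \<Longrightarrow> l2 I b \<Longrightarrow> (\<lambda>k. a k * b k) summable_on I"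
  by (rule abs_summable_summable) (simp add: l2_mult_abs)

lemma l2_lin:
  assumes "l2 I a" "l2 I b" shows "l2 I (\<lambda>k. s * a k + t * b k)"
    and "infsum (\<lambda>k. (s * a k + t * b k)\<^sup>2) I
      = s\<^sup>2 * infsum (\<lambda>k. (a k)\<^sup>2) I + 2 * s * t * infsum (\<lambda>k. a k * b k) I + t\<^sup>2 * infsum (\<lambda>k. (b k)\<^sup>2) I"
proof -
  have eq: "(\<lambda>k. (s * a k + t * b k)\<^sup>2) = (\<lambda>k. s\<^sup>2 * (a k)\<^sup>2 + 2 * s * t * (a k * b k) + t\<^sup>2 * (b k)\<^sup>2)"
    by (auto simp: power2_eq_square algebra_simps)
  note h = has_sum_infsum[OF assms(1)[unfolded l2_def]] has_sum_infsum[OF l2_mult[OF assms]] has_sum_infsum[OF assms(2)[unfolded l2_def]]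
  have "((\<lambda>k. (s * a k + t * b k)\<^sup>2) has_sum
     (s\<^sup>2 * infsum (\<lambda>k. (a k)\<^sup>2) I + 2 * s * t * infsum (\<lambda>k. a k * b k) I + t\<^sup>2 * infsum (\<lambda>k. (b k)\<^sup>2) I)) I"
    unfolding eq by (intro has_sum_add has_sum_cmult_right h)
  then show "l2 I (\<lambda>k. s * a k + t * b k)" "infsum (\<lambda>k. (s * a k + t * b k)\<^sup>2) I
      = s\<^sup>2 * infsum (\<lambda>k. (a k)\<^sup>2) I + 2 * s * t * infsum (\<lambda>k. a k * b k) I + t\<^sup>2 * infsum (\<lambda>k. (b k)\<^sup>2) I"
    by (auto simp: l2_def has_sum_imp_summable infsumI)
qed

lemma l2_diff: "l2 I a \<Longrightarrow> l2 I b \<Longrightarrow> l2 I (\<lambda>k. a k - b k)"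
  using l2_lin(1)[of I a b 1 "-1"] by simp

lemma l2_CS:
  assumes "l2 I a" "l2 I b"
  shows "(infsum (\<lambda>k. a k * b k) I)\<^sup>2 \<le> infsum (\<lambda>k. (a k)\<^sup>2) I * infsum (\<lambda>k. (b k)\<^sup>2) I"
proof (rule quadratic_nonneg_discriminant)
  show "0 \<le> infsum (\<lambda>k. (b k)\<^sup>2) I" by (rule infsum_nonneg) simp
  fix t :: real
  have "0 \<le> infsum (\<lambda>k. (1 * a k + t * b k)\<^sup>2) I" by (rule infsum_nonneg) simp
  then show "0 \<le> infsum (\<lambda>k. (a k)\<^sup>2) I + 2 * t * infsum (\<lambda>k. a k * b k) I + t\<^sup>2 * infsum (\<lambda>k. (b k)\<^sup>2) I"
    unfolding l2_lin(2)[OF assms] by simp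
qed

lemma l2_bound:
  assumes "\<And>F. finite F \<Longrightarrow> F \<subseteq> I \<Longrightarrow> (\<Sum>k\<in>F. (a k)\<^sup>2) \<le> B"
  shows "l2 I a" "infsum (\<lambda>k. (a k)\<^sup>2) I \<le> B"
proof -
  show "l2 I a" unfolding l2_def
    by (rule nonneg_bdd_above_summable_on) (use assms in \<open>auto intro!: bdd_aboveI\<close>)
  then show "infsum (\<lambda>k. (a k)\<^sup>2) I \<le> B"
    unfolding l2_def by (rule infsum_le_finite_sums) (rule assms)
qed

lemma l2_finite_le: "l2 I a \<Longrightarrow> finite F \<Longrightarrow> F \<subseteq> I \<Longrightarrow> (\<Sum>k\<in>F. (a k)\<^sup>2) \<le> infsum (\<lambda>k. (a k)\<^sup>2) I"
  unfolding l2_def by (rule finite_sum_le_infsum) auto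

lemma l2_nat_iff: "l2 (UNIV :: nat set) a \<longleftrightarrow> summable (\<lambda>k. (a k)\<^sup>2)"
  unfolding l2_def by (rule summable_on_UNIV_nonneg_real_iff) simp

text \<open>Absolute summability turns the ordered series of the univariate theory into the
  unordered sums used for multi-indices.\<close>

lemma sums_has_sum:
  fixes f :: "nat \<Rightarrow> real"
  assumes "f sums s" "(\<lambda>k. \<bar>f k\<bar>) summable_on UNIV" shows "(f has_sum s) UNIV"
proof -
  have f: "f summable_on UNIV" by (rule abs_summable_summable) (use assms(2) in simp)
  have "infsum f UNIV = s"
    by (rule sums_unique2[OF has_sum_imp_sums[OF has_sum_infsum[OF f]] assms(1)])
  then show ?thesis using has_sum_infsum[OF f] by simp
qed

subsection \<open>Tensor products\<close>

text \<open>Extensionality makes a multi-index determined by its values on \<open>S\<close>, so that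
  distinct indices belong to distinct tensors.\<close>

abbreviation mi :: "nat set \<Rightarrow> (nat \<Rightarrow> nat) set" where "mi S \<equiv> PiE S (\<lambda>_. UNIV)"

definition ibox :: "nat set \<Rightarrow> nat \<Rightarrow> (nat \<Rightarrow> nat) set" where "ibox S N = PiE S (\<lambda>_. {..<N})"

lemma finite_box [simp]: "finite S \<Longrightarrow> finite (ibox S N)"
  by (simp add: ibox_def finite_PiE)

lemma box_subset_mi: "ibox S N \<subseteq> mi S"
  by (auto simp: ibox_def)

lemma box_mono: "N \<le> M \<Longrightarrow> ibox S N \<subseteq> ibox S M"
  unfolding ibox_def by (rule PiE_mono) auto

lemma finite_subset_box:
  assumes "finite S" "finite X" "X \<subseteq> mi S" shows "\<exists>N. X \<subseteq> ibox S N"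
proof -
  have "finite ((\<lambda>(k, j). k j) ` (X \<times> S))" using assms by simp
  then obtain N where "\<forall>y\<in>(\<lambda>(k, j). k j) ` (X \<times> S). y < N" using finite_nat_set_iff_bounded by blast
  then have "X \<subseteq> ibox S N" using assms(3) by (fastforce simp: ibox_def PiE_iff)
  then show ?thesis by blast
qed

text \<open>Every finite set of multi-indices lies in a box, and over a box the sum of products
  factorises. This gives absolute summability, after which the product formula for unordered sums
  applies.\<close>

lemma has_sum_prod_PiE_abs:
  fixes F :: "nat \<Rightarrow> nat \<Rightarrow> real"
  assumes S: "finite S" and F: "\<And>j. j \<in> S \<Longrightarrow> (F j has_sum s j) UNIV" "\<And>j. j \<in> S \<Longrightarrow> (\<lambda>k. \<bar>F j k\<bar>) summable_on UNIV"
  shows "((\<lambda>k. \<Prod>j\<in>S. F j (k j)) has_sum (\<Prod>j\<in>S. s j)) (mi S)"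
    and "(\<lambda>k. \<bar>\<Prod>j\<in>S. F j (k j)\<bar>) summable_on mi S"
proof -
  show abs: "(\<lambda>k. \<bar>\<Prod>j\<in>S. F j (k j)\<bar>) summable_on mi S"
  proof (rule nonneg_bdd_above_summable_on)
    show "bdd_above (sum (\<lambda>k. \<bar>\<Prod>j\<in>S. F j (k j)\<bar>) ` {X. X \<subseteq> mi S \<and> finite X})"
    proof (rule bdd_aboveI2)
      fix X assume "X \<in> {X. X \<subseteq> mi S \<and> finite X}"
      then have X: "X \<subseteq> mi S" "finite X" by auto
      obtain N where N: "X \<subseteq> ibox S N" using finite_subset_box[OF S X(2) X(1)] by blast
      have "(\<Sum>k\<in>X. \<bar>\<Prod>j\<in>S. F j (k j)\<bar>) \<le> (\<Sum>k\<in>ibox S N. \<bar>\<Prod>j\<in>S. F j (k j)\<bar>)"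
        using N S by (intro sum_mono2) auto
      also have "\<dots> = (\<Prod>j\<in>S. \<Sum>k<N. \<bar>F j k\<bar>)"
        unfolding ibox_def by (subst prod_sum_PiE) (auto simp: S abs_prod)
      also have "\<dots> \<le> (\<Prod>j\<in>S. infsum (\<lambda>k. \<bar>F j k\<bar>) UNIV)"
        by (intro prod_mono conjI sum_nonneg finite_sum_le_infsum F(2)) auto
      finally show "(\<Sum>k\<in>X. \<bar>\<Prod>j\<in>S. F j (k j)\<bar>) \<le> (\<Prod>j\<in>S. infsum (\<lambda>k. \<bar>F j k\<bar>) UNIV)" .
    qed
  qed simp
  have "(\<lambda>k. \<Prod>j\<in>S. F j (k j)) summable_on mi S" by (rule abs_summable_summable) (use abs in simp)
  moreover have "infsum (\<lambda>k. \<Prod>j\<in>S. F j (k j)) (mi S) = (\<Prod>j\<in>S. infsum (F j) UNIV)"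
    by (rule infsum_prod_PiE_abs) (use S F(2) in auto)
  moreover have "(\<Prod>j\<in>S. infsum (F j) UNIV) = (\<Prod>j\<in>S. s j)"
    by (intro prod.cong refl infsumI F(1))
  ultimately show "((\<lambda>k. \<Prod>j\<in>S. F j (k j)) has_sum (\<Prod>j\<in>S. s j)) (mi S)"
    by (metis has_sum_infsum)
qed

section \<open>Coordinates of algebraic tensors\<close>

definition tE :: "nat \<Rightarrow> nat set \<Rightarrow> (nat \<Rightarrow> nat) \<Rightarrow> (nat \<Rightarrow> real) \<Rightarrow> real" where
  "tE m S k x = (\<Prod>j\<in>S. poly (ek m (k j)) (x j))"

definition bP :: "nat \<Rightarrow> nat set \<Rightarrow> (nat \<Rightarrow> real \<Rightarrow> real) \<Rightarrow> (nat \<Rightarrow> nat) \<Rightarrow> real" where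
  "bP m S \<phi> k = (\<Prod>j\<in>S. bf m (k j) (\<phi> j))"

definition bL :: "nat \<Rightarrow> nat set \<Rightarrow> tensor_rep \<Rightarrow> (nat \<Rightarrow> nat) \<Rightarrow> real" where
  "bL m S L k = sum_list (map (\<lambda>(c, \<phi>). c * bP m S \<phi> k) L)"

definition okrep :: "nat \<Rightarrow> nat set \<Rightarrow> tensor_rep \<Rightarrow> bool" where
  "okrep m S L \<longleftrightarrow> (\<forall>(c, \<phi>)\<in>set L. \<forall>j\<in>S. \<phi> j \<in> sob0 m)"

text \<open>In contrast to \<open>cube d\<close> only the coordinates in \<open>S\<close> are
  constrained, a form that is stable when coordinates are added one by one.\<close>

definition in_cube :: "nat set \<Rightarrow> (nat \<Rightarrow> real) \<Rightarrow> bool" where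
  "in_cube S x \<longleftrightarrow> (\<forall>j\<in>S. x j \<in> {0..1})"

lemma l2_ek: "1 \<le> m \<Longrightarrow> x \<in> {0..1} \<Longrightarrow> l2 UNIV (\<lambda>k. poly (ek m k) x)"
  "1 \<le> m \<Longrightarrow> x \<in> {0..1} \<Longrightarrow> infsum (\<lambda>k. (poly (ek m k) x)\<^sup>2) UNIV \<le> real m"
  using l2_bound[of UNIV "\<lambda>k. poly (ek m k) x" "real m"] ek_sq_sum[of x _ m] by blast+

text \<open>The squared norm of point evaluation: the univariate bound \<open>m\<close> once for
  each coordinate.\<close>

lemma l2_tE:
  assumes "finite S" "1 \<le> m" "in_cube S x"
  shows "l2 (mi S) (\<lambda>k. tE m S k x)" "infsum (\<lambda>k. (tE m S k x)\<^sup>2) (mi S) \<le> real m ^ card S"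
proof -
  have j: "((\<lambda>k. (poly (ek m k) (x j))\<^sup>2) has_sum infsum (\<lambda>k. (poly (ek m k) (x j))\<^sup>2) UNIV) UNIV"
    "(\<lambda>k. \<bar>(poly (ek m k) (x j))\<^sup>2\<bar>) summable_on UNIV"
    "infsum (\<lambda>k. (poly (ek m k) (x j))\<^sup>2) UNIV \<le> real m" if "j \<in> S" for j
    using l2_ek[of m "x j"] assms that by (auto simp: in_cube_def l2_def intro: has_sum_infsum)
  have h: "((\<lambda>k. (tE m S k x)\<^sup>2) has_sum (\<Prod>j\<in>S. infsum (\<lambda>k. (poly (ek m k) (x j))\<^sup>2) UNIV)) (mi S)"
    using has_sum_prod_PiE_abs(1)[OF assms(1), of "\<lambda>j k. (poly (ek m k) (x j))\<^sup>2", OF j(1) j(2)]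
    by (simp add: tE_def prod_power_distrib)
  then show "l2 (mi S) (\<lambda>k. tE m S k x)" by (auto simp: l2_def has_sum_imp_summable)
  have "infsum (\<lambda>k. (tE m S k x)\<^sup>2) (mi S) = (\<Prod>j\<in>S. infsum (\<lambda>k. (poly (ek m k) (x j))\<^sup>2) UNIV)"
    using h by (rule infsumI)
  also have "\<dots> \<le> (\<Prod>j\<in>S. real m)"
    by (intro prod_mono conjI infsum_nonneg j(3)) auto
  finally show "infsum (\<lambda>k. (tE m S k x)\<^sup>2) (mi S) \<le> real m ^ card S" by simp
qed

lemma bf_has_sum:
  assumes "f \<in> sob0 m" "h \<in> sob0 m" "1 \<le> m"
  shows "((\<lambda>k. bf m k f * bf m k h) has_sum sob_ip m f h) UNIV" "(\<lambda>k. \<bar>bf m k f * bf m k h\<bar>) summable_on UNIV"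
    and "l2 UNIV (\<lambda>k. bf m k f)"
proof -
  have l: "l2 UNIV (\<lambda>k. bf m k f)" if "f \<in> sob0 m" for f
    using bf_sums_sob_ip[OF that that assms(3)] by (auto simp: l2_nat_iff power2_eq_square sums_iff)
  show "l2 UNIV (\<lambda>k. bf m k f)" by (rule l) fact
  show a: "(\<lambda>k. \<bar>bf m k f * bf m k h\<bar>) summable_on UNIV" by (rule l2_mult_abs; rule l; fact)
  show "((\<lambda>k. bf m k f * bf m k h) has_sum sob_ip m f h) UNIV"
    by (rule sums_has_sum[OF bf_sums_sob_ip a]) fact+
qed

lemma bf_has_sum_eval:
  assumes "f \<in> sob0 m" "1 \<le> m" "x \<in> {0..1}"
  shows "((\<lambda>k. bf m k f * poly (ek m k) x) has_sum f x) UNIV" "(\<lambda>k. \<bar>bf m k f * poly (ek m k) x\<bar>) summable_on UNIV"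
proof -
  show a: "(\<lambda>k. \<bar>bf m k f * poly (ek m k) x\<bar>) summable_on UNIV"
    by (rule l2_mult_abs[OF bf_has_sum(3) l2_ek(1)]) fact+
  show "((\<lambda>k. bf m k f * poly (ek m k) x) has_sum f x) UNIV"
    by (rule sums_has_sum[OF bf_sums_eval a]) fact+
qed

lemma bP_has_sum:
  assumes "finite S" "1 \<le> m" "\<And>j. j \<in> S \<Longrightarrow> \<phi> j \<in> sob0 m" "\<And>j. j \<in> S \<Longrightarrow> \<psi> j \<in> sob0 m"
  shows "((\<lambda>k. bP m S \<phi> k * bP m S \<psi> k) has_sum (\<Prod>j\<in>S. sob_ip m (\<phi> j) (\<psi> j))) (mi S)"
  using has_sum_prod_PiE_abs(1)[OF assms(1), of "\<lambda>j k. bf m k (\<phi> j) * bf m k (\<psi> j)" "\<lambda>j. sob_ip m (\<phi> j) (\<psi> j)"]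
    bf_has_sum assms by (simp add: bP_def prod.distrib)

lemma bP_has_sum_eval:
  assumes "finite S" "1 \<le> m" "\<And>j. j \<in> S \<Longrightarrow> \<phi> j \<in> sob0 m" "in_cube S x"
  shows "((\<lambda>k. bP m S \<phi> k * tE m S k x) has_sum (\<Prod>j\<in>S. \<phi> j (x j))) (mi S)"
  using has_sum_prod_PiE_abs(1)[OF assms(1), of "\<lambda>j k. bf m k (\<phi> j) * poly (ek m k) (x j)" "\<lambda>j. \<phi> j (x j)"]
    bf_has_sum_eval assms by (simp add: bP_def tE_def prod.distrib in_cube_def)

lemma bL_Cons: "bL m S ((c, \<phi>) # L) k = c * bP m S \<phi> k + bL m S L k"
  by (simp add: bL_def)

lemma okrep_Cons: "okrep m S ((c, \<phi>) # L) \<longleftrightarrow> (\<forall>j\<in>S. \<phi> j \<in> sob0 m) \<and> okrep m S L"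
  by (auto simp: okrep_def)

text \<open>In the coordinates \<open>bL\<close> the bilinear form \<open>tip\<close> is the inner
  product of l2, and the Cauchy condition in \<open>tapprox\<close> becomes one in l2.\<close>

lemma tip_has_sum:
  assumes S: "finite S" "1 \<le> m" and L: "okrep m S L" and M: "okrep m S M"
  shows "((\<lambda>k. bL m S L k * bL m S M k) has_sum tip m S L M) (mi S)"
  using L
proof (induction L)
  case Nil
  then show ?case by (simp add: bL_def tip_def)
next
  case (Cons a L)
  obtain c \<phi> where a: "a = (c, \<phi>)" by (cases a)
  have ok: "\<forall>j\<in>S. \<phi> j \<in> sob0 m" "okrep m S L" using Cons.prems by (auto simp: a okrep_Cons)
  have "((\<lambda>k. bP m S \<phi> k * bL m S M k) has_sum
     sum_list (map (\<lambda>(c', \<psi>). c' * (\<Prod>j\<in>S. sob_ip m (\<phi> j) (\<psi> j))) M)) (mi S)"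
    using M
  proof (induction M)
    case Nil
    then show ?case by (simp add: bL_def)
  next
    case (Cons b M)
    obtain c' \<psi> where b: "b = (c', \<psi>)" by (cases b)
    have "\<forall>j\<in>S. \<psi> j \<in> sob0 m" "okrep m S M" using Cons.prems by (auto simp: b okrep_Cons)
    then have "((\<lambda>k. c' * (bP m S \<phi> k * bP m S \<psi> k) + bP m S \<phi> k * bL m S M k) has_sum
       (c' * (\<Prod>j\<in>S. sob_ip m (\<phi> j) (\<psi> j)) + sum_list (map (\<lambda>(c', \<psi>). c' * (\<Prod>j\<in>S. sob_ip m (\<phi> j) (\<psi> j))) M))) (mi S)"
      using ok by (intro has_sum_add has_sum_cmult_right bP_has_sum S Cons.IH) auto
    then show ?case by (simp add: b bL_Cons algebra_simps)
  qed
  from has_sum_add[OF has_sum_cmult_right[OF this, of c] Cons.IH[OF ok(2)]]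
  have "((\<lambda>k. c * (bP m S \<phi> k * bL m S M k) + bL m S L k * bL m S M k) has_sum
     (c * sum_list (map (\<lambda>(c', \<psi>). c' * (\<Prod>j\<in>S. sob_ip m (\<phi> j) (\<psi> j))) M) + tip m S L M)) (mi S)" .
  moreover have "c * sum_list (map (\<lambda>(c', \<psi>). c' * (\<Prod>j\<in>S. sob_ip m (\<phi> j) (\<psi> j))) M) + tip m S L M = tip m S (a # L) M"
    by (simp add: tip_def a sum_list_const_mult[symmetric] case_prod_unfold mult.assoc)
  ultimately show ?case by (simp add: a bL_Cons algebra_simps)
qed

lemma tev_has_sum:
  assumes S: "finite S" "1 \<le> m" "in_cube S x" and L: "okrep m S L"
  shows "((\<lambda>k. bL m S L k * tE m S k x) has_sum tev S L x) (mi S)"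
  using L
proof (induction L)
  case Nil
  then show ?case by (simp add: bL_def tev_def)
next
  case (Cons a L)
  obtain c \<phi> where a: "a = (c, \<phi>)" by (cases a)
  have ok: "\<forall>j\<in>S. \<phi> j \<in> sob0 m" "okrep m S L" using Cons.prems by (auto simp: a okrep_Cons)
  then have "((\<lambda>k. c * (bP m S \<phi> k * tE m S k x) + bL m S L k * tE m S k x) has_sum
      (c * (\<Prod>j\<in>S. \<phi> j (x j)) + tev S L x)) (mi S)"
    by (intro has_sum_add has_sum_cmult_right bP_has_sum_eval S Cons.IH) auto
  then show ?case by (simp add: a bL_Cons tev_def algebra_simps)
qed

lemma okrep_rdiff: "okrep m S L \<Longrightarrow> okrep m S M \<Longrightarrow> okrep m S (rdiff L M)"
  by (auto simp: okrep_def rdiff_def)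

lemma bL_rdiff: "bL m S (rdiff L M) k = bL m S L k - bL m S M k"
proof -
  have "sum_list (map (\<lambda>(c, \<phi>). c * bP m S \<phi> k) (map (\<lambda>(c, \<phi>). (- c, \<phi>)) M)) = - bL m S M k"
    by (induction M) (auto simp: bL_def)
  then show ?thesis by (simp add: rdiff_def bL_def)
qed

text \<open>Every function in \<open>HS\<close> has a unique square summable coordinate family, and \<open>JS\<close> is the sum of its squares.
  This makes \<open>JS\<close>, which is defined by an arbitrary approximating sequence, a quadratic form.\<close>

definition rep :: "nat \<Rightarrow> nat \<Rightarrow> nat set \<Rightarrow> ((nat \<Rightarrow> real) \<Rightarrow> real) \<Rightarrow> ((nat \<Rightarrow> nat) \<Rightarrow> real) \<Rightarrow> bool" where
  "rep m d S f b \<longleftrightarrow> l2 (mi S) b \<and> (\<forall>x\<in>cube d. ((\<lambda>k. b k * tE m S k x) has_sum f x) (mi S))"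

lemma in_cube_cube: "x \<in> cube d \<Longrightarrow> S \<subseteq> {1..d} \<Longrightarrow> in_cube S x"
  by (auto simp: cube_def in_cube_def PiE_iff)

text \<open>Completeness of l2: the Cauchy condition gives coordinatewise limits and then
  convergence in norm. Point values converge because the family \<open>tE\<close> at a point is
  square summable.\<close>

lemma tapprox_limit:
  assumes S: "S \<subseteq> {1..d}" and m: "1 \<le> m" and t: "tapprox m d S f L"
  shows "\<exists>b. rep m d S f b \<and> (\<lambda>n. tip m S (L n) (L n)) \<longlonglongrightarrow> infsum (\<lambda>k. (b k)\<^sup>2) (mi S)"
proof -
  have fS: "finite S" using S finite_subset by blast
  have ok: "okrep m S (L n)" for n using t by (auto simp: tapprox_def okrep_def)
  define \<beta> where "\<beta> n = bL m S (L n)" for n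
  have tipd: "((\<lambda>k. (\<beta> n k - \<beta> p k)\<^sup>2) has_sum tip m S (rdiff (L n) (L p)) (rdiff (L n) (L p))) (mi S)" for n p
    using tip_has_sum[OF fS m okrep_rdiff[OF ok ok] okrep_rdiff[OF ok ok], of n p n p]
    by (simp add: bL_rdiff \<beta>_def power2_eq_square)
  have tip0: "((\<lambda>k. (\<beta> n k)\<^sup>2) has_sum tip m S (L n) (L n)) (mi S)" for n
    using tip_has_sum[OF fS m ok ok, of n n] by (simp add: \<beta>_def power2_eq_square)
  have cau: "\<exists>N. \<forall>n\<ge>N. \<forall>p\<ge>N. tip m S (rdiff (L n) (L p)) (rdiff (L n) (L p)) < e" if "e > 0" for e
    using t that unfolding tapprox_def by blast
  have fin: "(\<Sum>k\<in>F. (\<beta> n k - \<beta> p k)\<^sup>2) \<le> tip m S (rdiff (L n) (L p)) (rdiff (L n) (L p))"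
    if "finite F" "F \<subseteq> mi S" for F n p
    using finite_sum_le_infsum[OF has_sum_imp_summable[OF tipd[of n p]] that] infsumI[OF tipd[of n p]] by simp
  have "\<exists>l. (\<lambda>n. \<beta> n k) \<longlonglongrightarrow> l" if k: "k \<in> mi S" for k
  proof -
    have "Cauchy (\<lambda>n. \<beta> n k)"
    proof (rule CauchyI)
      fix e :: real assume "e > 0"
      then obtain N where N: "\<forall>n\<ge>N. \<forall>p\<ge>N. tip m S (rdiff (L n) (L p)) (rdiff (L n) (L p)) < e\<^sup>2"
        using cau[of "e\<^sup>2"] by auto
      have "norm (\<beta> n k - \<beta> p k) < e" if "n \<ge> N" "p \<ge> N" for n p
      proof -
        have "(\<beta> n k - \<beta> p k)\<^sup>2 < e\<^sup>2"
          using fin[of "{k}" n p] N that k by fastforce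
        then show ?thesis using \<open>e > 0\<close> by (metis abs_of_pos power2_abs power2_less_imp_less real_norm_def less_imp_le)
      qed
      then show "\<exists>M. \<forall>n\<ge>M. \<forall>p\<ge>M. norm (\<beta> n k - \<beta> p k) < e" by blast
    qed
    then show ?thesis using Cauchy_convergent_iff convergent_def by blast
  qed
  then obtain b where b: "\<And>k. k \<in> mi S \<Longrightarrow> (\<lambda>n. \<beta> n k) \<longlonglongrightarrow> b k" by metis
  have lim: "\<exists>N. \<forall>n\<ge>N. l2 (mi S) (\<lambda>k. \<beta> n k - b k) \<and> infsum (\<lambda>k. (\<beta> n k - b k)\<^sup>2) (mi S) \<le> e" if e: "e > 0" for e
  proof -
    obtain N where N: "\<forall>n\<ge>N. \<forall>p\<ge>N. tip m S (rdiff (L n) (L p)) (rdiff (L n) (L p)) < e"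
      using cau[OF e] by blast
    have "(\<Sum>k\<in>F. (\<beta> n k - b k)\<^sup>2) \<le> e" if F: "finite F" "F \<subseteq> mi S" and n: "n \<ge> N" for F n
    proof -
      have "(\<lambda>p. \<Sum>k\<in>F. (\<beta> n k - \<beta> p k)\<^sup>2) \<longlonglongrightarrow> (\<Sum>k\<in>F. (\<beta> n k - b k)\<^sup>2)"
        using b F(2) by (intro tendsto_intros) auto
      moreover have "\<forall>p\<ge>N. (\<Sum>k\<in>F. (\<beta> n k - \<beta> p k)\<^sup>2) \<le> e"
        using fin[OF F] N n by (meson le_less_trans less_imp_le)
      ultimately show ?thesis by (intro LIMSEQ_le_const2) auto
    qed
    then have "l2 (mi S) (\<lambda>k. \<beta> n k - b k) \<and> infsum (\<lambda>k. (\<beta> n k - b k)\<^sup>2) (mi S) \<le> e" if "n \<ge> N" for n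
      using l2_bound[of "mi S" "\<lambda>k. \<beta> n k - b k" e] that by blast
    then show ?thesis by blast
  qed
  obtain N0 where N0: "\<forall>n\<ge>N0. l2 (mi S) (\<lambda>k. \<beta> n k - b k)" using lim[of 1] by auto
  have l\<beta>: "l2 (mi S) (\<beta> n)" for n using has_sum_imp_summable[OF tip0] by (simp add: l2_def)
  have lb: "l2 (mi S) b" using l2_diff[OF l\<beta>[of N0] N0[rule_format, of N0]] by simp
  have ld: "l2 (mi S) (\<lambda>k. \<beta> n k - b k)" for n by (rule l2_diff[OF l\<beta> lb])
  define a where "a n = infsum (\<lambda>k. (\<beta> n k - b k)\<^sup>2) (mi S)" for n
  have a0: "0 \<le> a n" for n unfolding a_def by (rule infsum_nonneg) simp
  have alim: "a \<longlonglongrightarrow> 0"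
  proof (rule LIMSEQ_I)
    fix r :: real assume "r > 0"
    then obtain N where "\<forall>n\<ge>N. a n \<le> r / 2" using lim[of "r/2"] by (auto simp: a_def)
    then show "\<exists>no. \<forall>n\<ge>no. norm (a n - 0) < r" using a0 \<open>r > 0\<close> by (intro exI[of _ N]) fastforce
  qed
  \<comment> \<open>Used twice: with the basis values at a point to identify \<open>f\<close>, and
    with \<open>b\<close> itself for the limit of the squared norms.\<close>
  have lim0: "(\<lambda>n. infsum (\<lambda>k. c k * (\<beta> n k - b k)) (mi S)) \<longlonglongrightarrow> 0" if c: "l2 (mi S) c" for c
  proof -
    have "(\<lambda>n. sqrt (infsum (\<lambda>k. (c k)\<^sup>2) (mi S) * a n)) \<longlonglongrightarrow> sqrt (infsum (\<lambda>k. (c k)\<^sup>2) (mi S) * 0)"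
      by (intro tendsto_intros alim)
    then have l: "(\<lambda>n. sqrt (infsum (\<lambda>k. (c k)\<^sup>2) (mi S) * a n)) \<longlonglongrightarrow> 0" by simp
    have "norm (infsum (\<lambda>k. c k * (\<beta> n k - b k)) (mi S)) \<le> sqrt (infsum (\<lambda>k. (c k)\<^sup>2) (mi S) * a n)" for n
      using l2_CS[OF c ld[of n]] by (simp add: a_def real_le_rsqrt)
    then show ?thesis by (intro Lim_null_comparison[OF always_eventually l]) blast
  qed
  have "((\<lambda>k. b k * tE m S k x) has_sum f x) (mi S)" if x: "x \<in> cube d" for x
  proof -
    have ic: "in_cube S x" by (rule in_cube_cube[OF x S])
    note lE = l2_tE(1)[OF fS m ic]
    let ?s = "infsum (\<lambda>k. b k * tE m S k x) (mi S)"
    have "tev S (L n) x = ?s + infsum (\<lambda>k. tE m S k x * (\<beta> n k - b k)) (mi S)" for n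
    proof -
      have "tev S (L n) x = infsum (\<lambda>k. \<beta> n k * tE m S k x) (mi S)"
        using tev_has_sum[OF fS m ic ok, of n] by (simp add: \<beta>_def infsumI)
      also have "\<dots> = infsum (\<lambda>k. b k * tE m S k x + tE m S k x * (\<beta> n k - b k)) (mi S)"
        by (intro infsum_cong) (simp add: algebra_simps)
      also have "\<dots> = ?s + infsum (\<lambda>k. tE m S k x * (\<beta> n k - b k)) (mi S)"
        by (intro infsum_add l2_mult lb lE ld)
      finally show ?thesis .
    qed
    then have "(\<lambda>n. tev S (L n) x) \<longlonglongrightarrow> ?s + 0"
      using tendsto_add[OF tendsto_const lim0[OF lE]] by simp
    moreover have "(\<lambda>n. tev S (L n) x) \<longlonglongrightarrow> f x" using t x by (simp add: tapprox_def)
    ultimately have "f x = ?s" using LIMSEQ_unique by force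
    then show ?thesis using has_sum_infsum[OF l2_mult[OF lb lE]] by simp
  qed
  then have r: "rep m d S f b" using lb by (simp add: rep_def)
  have "tip m S (L n) (L n) = infsum (\<lambda>k. (b k)\<^sup>2) (mi S) + 2 * infsum (\<lambda>k. b k * (\<beta> n k - b k)) (mi S) + a n" for n
  proof -
    have "tip m S (L n) (L n) = infsum (\<lambda>k. (\<beta> n k)\<^sup>2) (mi S)" using infsumI[OF tip0] by simp
    also have "\<dots> = infsum (\<lambda>k. (1 * b k + 1 * (\<beta> n k - b k))\<^sup>2) (mi S)" by simp
    finally show ?thesis unfolding l2_lin(2)[OF lb ld] a_def by simp
  qed
  moreover have "(\<lambda>n. infsum (\<lambda>k. (b k)\<^sup>2) (mi S) + 2 * infsum (\<lambda>k. b k * (\<beta> n k - b k)) (mi S) + a n)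
      \<longlonglongrightarrow> infsum (\<lambda>k. (b k)\<^sup>2) (mi S) + 2 * 0 + 0"
    by (intro tendsto_intros lim0 lb alim)
  ultimately have "(\<lambda>n. tip m S (L n) (L n)) \<longlonglongrightarrow> infsum (\<lambda>k. (b k)\<^sup>2) (mi S)" by simp
  then show ?thesis using r by blast
qed

section \<open>Uniqueness of the coordinate family\<close>

lemma bij_betw_mi_insert:
  assumes "j \<notin> S" shows "bij_betw (\<lambda>(i, k). k(j := i)) (UNIV \<times> mi S) (mi (insert j S))"
  unfolding bij_betw_def PiE_insert_eq using inj_combinator[OF assms, of "\<lambda>_. UNIV"] by simp

lemma tE_insert:
  assumes "finite S" "j \<notin> S"
  shows "tE m (insert j S) (k(j := i)) (x(j := y)) = poly (ek m i) y * tE m S k x"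
  using assms by (auto simp: tE_def intro!: prod.cong)

text \<open>Splitting off one coordinate \<open>y\<close> leaves a univariate expansion with
  coefficients \<open>g i\<close>, which vanish by \<open>ek_unique\<close>. Each \<open>g i\<close>
  is in turn an expansion in the remaining coordinates, to which the induction hypothesis
  applies.\<close>

lemma tE_unique:
  assumes "finite S" "1 \<le> m" "l2 (mi S) b"
    "\<And>x. in_cube S x \<Longrightarrow> infsum (\<lambda>k. b k * tE m S k x) (mi S) = 0" "k \<in> mi S"
  shows "b k = 0"
  using assms(1,3-)
proof (induction S arbitrary: b k rule: finite_induct)
  case empty
  then have "infsum (\<lambda>k. b k * tE m {} k undefined) (mi {}) = 0" by (simp add: in_cube_def)
  then show ?case using empty by (simp add: tE_def)
next
  case (insert j S)
  let ?h = "\<lambda>(i, k). k(j := i)"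
  note bij = bij_betw_mi_insert[OF insert.hyps(2)]
  define h where "h i k = b (k(j := i))" for i k
  have sm: "(\<lambda>(i, k). (h i k)\<^sup>2) summable_on UNIV \<times> mi S"
    using summable_on_reindex_bij_betw[OF bij, of "\<lambda>k. (b k)\<^sup>2"] insert.prems(1)
    by (simp add: l2_def h_def case_prod_unfold)
  have lh: "l2 (mi S) (h i)" for i
    using summable_on_SigmaD1[OF sm, of i] by (simp add: l2_def)
  have sh: "(\<lambda>i. infsum (\<lambda>k. (h i k)\<^sup>2) (mi S)) summable_on UNIV"
    using summable_on_Sigma_banach[OF sm] by simp
  have g0: "infsum (\<lambda>k. h i k * tE m S k x) (mi S) = 0" if x: "in_cube S x" for i x
  proof -
    note lE = l2_tE[OF insert.hyps(1) assms(2) x]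
    define g where "g i = infsum (\<lambda>k. h i k * tE m S k x) (mi S)" for i
    have g2: "(g i)\<^sup>2 \<le> infsum (\<lambda>k. (h i k)\<^sup>2) (mi S) * real m ^ card S" for i
      unfolding g_def by (rule order.trans[OF l2_CS[OF lh lE(1)]], rule mult_left_mono[OF lE(2)])
        (rule infsum_nonneg, simp)
    have "(\<lambda>i. norm ((g i)\<^sup>2)) summable_on UNIV"
      by (rule Infinite_Sum.abs_summable_on_comparison_test'[OF summable_on_cmult_left[OF sh, of "real m ^ card S"]])
        (use g2 in simp)
    then have sg: "summable (\<lambda>i. (g i)\<^sup>2)" using l2_nat_iff[of g] by (simp add: l2_def)
    have "g i = 0" for i
    proof (rule ek_unique[OF assms(2) sg])
      fix y :: real assume y: "y \<in> {0..1}"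
      have ic: "in_cube (insert j S) (x(j := y))" using x y by (auto simp: in_cube_def)
      have sE: "(\<lambda>k. b k * tE m (insert j S) k (x(j := y))) summable_on mi (insert j S)"
        using insert.prems(1) l2_tE(1)[OF _ assms(2) ic] insert.hyps(1) by (intro l2_mult) auto
      have p: "(\<lambda>(i, k). poly (ek m i) y * (h i k * tE m S k x)) summable_on UNIV \<times> mi S"
        using summable_on_reindex_bij_betw[OF bij, THEN iffD2, OF sE]
        by (simp add: h_def case_prod_unfold tE_insert[OF insert.hyps] mult.left_commute)
      have "infsum (\<lambda>(i, k). poly (ek m i) y * (h i k * tE m S k x)) (UNIV \<times> mi S) = 0"
        using infsum_reindex_bij_betw[OF bij, of "\<lambda>k. b k * tE m (insert j S) k (x(j := y))"] insert.prems(2)[OF ic]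
        by (simp add: h_def case_prod_unfold tE_insert[OF insert.hyps] mult.left_commute)
      then have "infsum (\<lambda>i. infsum (\<lambda>k. poly (ek m i) y * (h i k * tE m S k x)) (mi S)) UNIV = 0"
        using infsum_Sigma'_banach[OF p] by simp
      then have i0: "infsum (\<lambda>i. poly (ek m i) y * g i) UNIV = 0"
        by (simp add: g_def infsum_cmult_right')
      have "(\<lambda>i. infsum (\<lambda>k. poly (ek m i) y * (h i k * tE m S k x)) (mi S)) summable_on UNIV"
        using summable_on_Sigma_banach[OF p] by simp
      then have "(\<lambda>i. poly (ek m i) y * g i) summable_on UNIV" by (simp add: g_def infsum_cmult_right')
      from has_sum_imp_sums[OF has_sum_infsum[OF this]] i0
      show "(\<lambda>i. g i * poly (ek m i) y) sums 0" by (simp add: mult.commute)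
    qed
    then show ?thesis by (simp add: g_def)
  qed
  have hz: "h i k' = 0" if "k' \<in> mi S" for i k'
    by (rule insert.IH[OF lh g0 that])
  have "k \<in> ?h ` (UNIV \<times> mi S)" using insert.prems(3) bij by (simp add: bij_betw_def)
  then show ?case using hz by (auto simp: h_def)
qed

lemma rep_unique:
  assumes S: "S \<subseteq> {1..d}" and m: "1 \<le> m" and r: "rep m d S f b" "rep m d S g b'"
    and eq: "\<And>x. x \<in> cube d \<Longrightarrow> f x = g x" and k: "k \<in> mi S"
  shows "b k = b' k"
proof -
  have fS: "finite S" using S finite_subset by blast
  have "b k - b' k = 0"
  proof (rule tE_unique[OF fS m _ _ k])
    show "l2 (mi S) (\<lambda>k. b k - b' k)" using r by (intro l2_diff) (auto simp: rep_def)
    fix x assume x: "in_cube S x"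
    \<comment> \<open>Since \<open>cube d\<close> is extensional, the point is filled up with 0 on
      the other coordinates and with \<open>undefined\<close> beyond them.\<close>
    define y where "y = (\<lambda>j. if j \<in> S then x j else if j \<in> {1..d} then 0 else undefined)"
    have y: "y \<in> cube d" using x S by (auto simp: y_def cube_def in_cube_def PiE_iff extensional_def)
    have tEy: "tE m S k x = tE m S k y" for k by (simp add: tE_def y_def cong: prod.cong)
    have "((\<lambda>k. b k * tE m S k y + (- 1) * (b' k * tE m S k y)) has_sum (f y + (- 1) * g y)) (mi S)"
      by (intro has_sum_add has_sum_cmult_right) (use r y in \<open>auto simp: rep_def\<close>)
    then have "((\<lambda>k. (b k - b' k) * tE m S k x) has_sum 0) (mi S)"
      by (simp add: eq[OF y] tEy algebra_simps)
    then show "infsum (\<lambda>k. (b k - b' k) * tE m S k x) (mi S) = 0" by (rule infsumI)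
  qed
  then show ?thesis by simp
qed

lemma HS_rep: "S \<subseteq> {1..d} \<Longrightarrow> 1 \<le> m \<Longrightarrow> f \<in> HS m d S \<Longrightarrow> \<exists>b. rep m d S f b"
  unfolding HS_def using tapprox_limit by blast

lemma JS_rep:
  assumes S: "S \<subseteq> {1..d}" "S \<noteq> {}" and m: "1 \<le> m" and f: "f \<in> HS m d S" and r: "rep m d S f b"
  shows "JS m d S f = infsum (\<lambda>k. (b k)\<^sup>2) (mi S)"
proof -
  define L where "L = (SOME L. tapprox m d S f L)"
  have "tapprox m d S f L" unfolding L_def using f by (simp add: HS_def someI_ex)
  then obtain b' where b': "rep m d S f b'" and lim: "(\<lambda>n. tip m S (L n) (L n)) \<longlonglongrightarrow> infsum (\<lambda>k. (b' k)\<^sup>2) (mi S)"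
    using tapprox_limit[OF S(1) m] by blast
  have "infsum (\<lambda>k. (b' k)\<^sup>2) (mi S) = infsum (\<lambda>k. (b k)\<^sup>2) (mi S)"
    by (intro infsum_cong) (simp add: rep_unique[OF S(1) m b' r])
  then show ?thesis using S(2) limI[OF lim] by (simp add: JS_def L_def[symmetric])
qed

section \<open>Linear combinations in the tensor product space\<close>

lemma rep_lin:
  assumes "rep m d S f b" "rep m d S g b'"
  shows "rep m d S (\<lambda>x. s * f x + t * g x) (\<lambda>k. s * b k + t * b' k)"
  unfolding rep_def
proof (intro conjI ballI)
  show "l2 (mi S) (\<lambda>k. s * b k + t * b' k)" using assms by (intro l2_lin) (auto simp: rep_def)
  fix x assume "x \<in> cube d"
  then have "((\<lambda>k. s * (b k * tE m S k x) + t * (b' k * tE m S k x)) has_sum (s * f x + t * g x)) (mi S)"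
    using assms by (intro has_sum_add has_sum_cmult_right) (auto simp: rep_def)
  then show "((\<lambda>k. (s * b k + t * b' k) * tE m S k x) has_sum (s * f x + t * g x)) (mi S)"
    by (simp add: algebra_simps)
qed

definition rscale :: "real \<Rightarrow> tensor_rep \<Rightarrow> tensor_rep" where
  "rscale a L = map (\<lambda>(c, \<phi>). (a * c, \<phi>)) L"

lemma rscale_simps:
  "bL m S (rscale a L) k = a * bL m S L k" "tev S (rscale a L) x = a * tev S L x"
  "bL m S (L @ M) k = bL m S L k + bL m S M k" "tev S (L @ M) x = tev S L x + tev S M x"
  "okrep m S (rscale a L) \<longleftrightarrow> okrep m S L" "okrep m S (L @ M) \<longleftrightarrow> okrep m S L \<and> okrep m S M"
proof -
  show "bL m S (rscale a L) k = a * bL m S L k"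
    by (induction L) (auto simp: bL_def rscale_def algebra_simps)
  show "tev S (rscale a L) x = a * tev S L x"
    by (induction L) (auto simp: tev_def rscale_def algebra_simps)
qed (auto simp: bL_def tev_def rscale_def okrep_def)

text \<open>Scaled representatives are concatenated. The coordinates are linear under this, so the
  Cauchy condition follows from (u + v)^2 \<le> 2 u^2 + 2 v^2.\<close>

lemma HS_lin:
  assumes S: "S \<subseteq> {1..d}" and m: "1 \<le> m" and f: "f \<in> HS m d S" and g: "g \<in> HS m d S"
  shows "(\<lambda>x. s * f x + t * g x) \<in> HS m d S"
proof -
  have fS: "finite S" using S finite_subset by blast
  obtain L M where L: "tapprox m d S f L" and M: "tapprox m d S g M" using f g by (auto simp: HS_def)
  have ok: "okrep m S (L n)" "okrep m S (M n)" for n using L M by (auto simp: tapprox_def okrep_def)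
  define N where "N n = rscale s (L n) @ rscale t (M n)" for n
  have okN: "okrep m S (N n)" for n by (simp add: N_def rscale_simps ok)
  have le: "tip m S (rdiff (N n) (N p)) (rdiff (N n) (N p)) \<le> 2 * s\<^sup>2 * tip m S (rdiff (L n) (L p)) (rdiff (L n) (L p))
      + 2 * t\<^sup>2 * tip m S (rdiff (M n) (M p)) (rdiff (M n) (M p))" for n p
  proof (rule has_sum_mono)
    show "((\<lambda>k. bL m S (rdiff (N n) (N p)) k * bL m S (rdiff (N n) (N p)) k) has_sum tip m S (rdiff (N n) (N p)) (rdiff (N n) (N p))) (mi S)"
      by (intro tip_has_sum fS m okrep_rdiff okN)
    show "((\<lambda>k. 2 * s\<^sup>2 * (bL m S (rdiff (L n) (L p)) k * bL m S (rdiff (L n) (L p)) k)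
       + 2 * t\<^sup>2 * (bL m S (rdiff (M n) (M p)) k * bL m S (rdiff (M n) (M p)) k)) has_sum
       (2 * s\<^sup>2 * tip m S (rdiff (L n) (L p)) (rdiff (L n) (L p)) + 2 * t\<^sup>2 * tip m S (rdiff (M n) (M p)) (rdiff (M n) (M p)))) (mi S)"
      by (intro has_sum_add has_sum_cmult_right tip_has_sum fS m okrep_rdiff ok)
    fix k
    have "(s * u + t * v) * (s * u + t * v) \<le> 2 * s\<^sup>2 * (u * u) + 2 * t\<^sup>2 * (v * v)" for u v
      using zero_le_power2[of "s * u - t * v"] by (simp add: power2_eq_square algebra_simps)
    moreover have "bL m S (rdiff (N n) (N p)) k = s * bL m S (rdiff (L n) (L p)) k + t * bL m S (rdiff (M n) (M p)) k"
      by (simp add: bL_rdiff N_def rscale_simps algebra_simps)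
    ultimately show "bL m S (rdiff (N n) (N p)) k * bL m S (rdiff (N n) (N p)) k \<le> 2 * s\<^sup>2 * (bL m S (rdiff (L n) (L p)) k * bL m S (rdiff (L n) (L p)) k)
       + 2 * t\<^sup>2 * (bL m S (rdiff (M n) (M p)) k * bL m S (rdiff (M n) (M p)) k)"
      by simp
  qed
  have "tapprox m d S (\<lambda>x. s * f x + t * g x) N"
    unfolding tapprox_def
  proof (intro conjI allI impI ballI)
    fix k a assume "a \<in> set (N k)"
    then show "case a of (c, \<phi>) \<Rightarrow> \<forall>j\<in>S. \<phi> j \<in> sob0 m" using okN[of k] by (auto simp: okrep_def)
  next
    fix e :: real assume e: "e > 0"
    \<comment> \<open>The summand 1 keeps the denominator positive when \<open>s\<close> and
      \<open>t\<close> are zero.\<close>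
    define e' where "e' = e / (2 * s\<^sup>2 + 2 * t\<^sup>2 + 1)"
    have pos: "2 * s\<^sup>2 + 2 * t\<^sup>2 + 1 > 0" by (intro add_nonneg_pos) auto
    have e': "e' > 0" using e pos by (simp add: e'_def)
    obtain N1 where N1: "\<forall>n\<ge>N1. \<forall>p\<ge>N1. tip m S (rdiff (L n) (L p)) (rdiff (L n) (L p)) < e'"
      using L e' unfolding tapprox_def by blast
    obtain N2 where N2: "\<forall>n\<ge>N2. \<forall>p\<ge>N2. tip m S (rdiff (M n) (M p)) (rdiff (M n) (M p)) < e'"
      using M e' unfolding tapprox_def by blast
    have "tip m S (rdiff (N n) (N p)) (rdiff (N n) (N p)) < e" if "n \<ge> max N1 N2" "p \<ge> max N1 N2" for n p
    proof -
      have "tip m S (rdiff (N n) (N p)) (rdiff (N n) (N p)) \<le> 2 * s\<^sup>2 * e' + 2 * t\<^sup>2 * e'"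
        by (rule order.trans[OF le]) (intro add_mono mult_left_mono; use N1 N2 that in \<open>simp add: less_imp_le\<close>)
      also have "\<dots> < (2 * s\<^sup>2 + 2 * t\<^sup>2 + 1) * e'" using e' by (simp add: algebra_simps)
      also have "\<dots> = e" using pos by (simp add: e'_def)
      finally show ?thesis .
    qed
    then show "\<exists>N0. \<forall>k\<ge>N0. \<forall>l\<ge>N0. tip m S (rdiff (N k) (N l)) (rdiff (N k) (N l)) < e" by blast
  next
    fix x assume "x \<in> cube d"
    then show "(\<lambda>k. tev S (N k) x) \<longlonglongrightarrow> s * f x + t * g x"
      using L M unfolding N_def rscale_simps tapprox_def by (intro tendsto_intros) auto
  qed
  then show ?thesis by (auto simp: HS_def)
qed

subsection \<open>Legendre coefficients of tensor products\<close>

lemma sum_PiE_insert: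
  assumes "j \<notin> S"
  shows "sum f (PiE (insert j S) (\<lambda>_. K)) = (\<Sum>i\<in>K. \<Sum>k\<in>PiE S (\<lambda>_. K). f (k(j := i)))"
  unfolding PiE_insert_eq
  by (subst sum.reindex[OF inj_combinator[OF assms, of "\<lambda>_. K"]])
    (simp add: sum.cartesian_product case_prod_unfold)

lemma prod_insert_upd:
  assumes "finite S" "j \<notin> S"
  shows "(\<Prod>i\<in>insert j S. F ((k(j := a)) i) ((l(j := b)) i)) = F a b * (\<Prod>i\<in>S. F (k i) (l i))"
proof -
  have "(\<Prod>i\<in>S. F ((k(j := a)) i) ((l(j := b)) i)) = (\<Prod>i\<in>S. F (k i) (l i))"
    using assms(2) by (intro prod.cong) auto
  then show ?thesis using assms by simp
qed

text \<open>The norm of a tensor power of an operator is at most the power of its norm: the matrix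
  acts in one coordinate while the others are frozen, and the induction hypothesis treats the
  rest.\<close>

lemma tensor_operator_bound:
  fixes M :: "nat \<Rightarrow> nat \<Rightarrow> real"
  assumes "finite S" and C: "0 \<le> C"
    and M: "\<And>b. (\<Sum>i\<in>I. (\<Sum>k\<in>K. b k * M k i)\<^sup>2) \<le> C * (\<Sum>k\<in>K. (b k)\<^sup>2)"
  shows "(\<Sum>i\<in>PiE S (\<lambda>_. I). (\<Sum>k\<in>PiE S (\<lambda>_. K). b k * (\<Prod>j\<in>S. M (k j) (i j)))\<^sup>2)
      \<le> C ^ card S * (\<Sum>k\<in>PiE S (\<lambda>_. K). (b k)\<^sup>2)"
  using assms(1)
proof (induction S arbitrary: b rule: finite_induct)
  case empty
  then show ?case by simp
next
  case (insert j S)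
  let ?I = "PiE S (\<lambda>_. I)" and ?K = "PiE S (\<lambda>_. K)"
  define v where "v i k = (\<Sum>k'\<in>?K. b (k'(j := k)) * (\<Prod>j\<in>S. M (k' j) (i j)))" for i k
  have "(\<Sum>i\<in>PiE (insert j S) (\<lambda>_. I). (\<Sum>k\<in>PiE (insert j S) (\<lambda>_. K). b k * (\<Prod>j\<in>insert j S. M (k j) (i j)))\<^sup>2)
     = (\<Sum>i'\<in>I. \<Sum>i\<in>?I. (\<Sum>k\<in>K. v i k * M k i')\<^sup>2)"
    unfolding sum_PiE_insert[OF insert.hyps(2)] prod_insert_upd[OF insert.hyps, of M]
    by (simp add: v_def sum_distrib_left sum_distrib_right mult.left_commute mult.commute)
  also have "\<dots> = (\<Sum>i\<in>?I. \<Sum>i'\<in>I. (\<Sum>k\<in>K. v i k * M k i')\<^sup>2)" by (rule sum.swap)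
  also have "\<dots> \<le> (\<Sum>i\<in>?I. C * (\<Sum>k\<in>K. (v i k)\<^sup>2))" by (intro sum_mono M)
  also have "\<dots> = C * (\<Sum>k\<in>K. \<Sum>i\<in>?I. (v i k)\<^sup>2)" by (subst sum.swap) (simp add: sum_distrib_left)
  also have "\<dots> \<le> C * (\<Sum>k\<in>K. C ^ card S * (\<Sum>k'\<in>?K. (b (k'(j := k)))\<^sup>2))"
    unfolding v_def by (intro mult_left_mono sum_mono insert.IH C)
  also have "\<dots> = C ^ card (insert j S) * (\<Sum>k\<in>PiE (insert j S) (\<lambda>_. K). (b k)\<^sup>2)"
    unfolding sum_PiE_insert[OF insert.hyps(2)] using insert.hyps by (simp add: sum_distrib_left mult.assoc)
  finally show ?case .
qed

section \<open>Tensor products of nonconstant Legendre polynomials\<close>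

definition tL :: "nat set \<Rightarrow> (nat \<Rightarrow> nat) \<Rightarrow> (nat \<Rightarrow> real) \<Rightarrow> real" where
  "tL S k x = (\<Prod>j\<in>S. poly (Leg (Suc (k j))) (x j))"

text \<open>Each factor is the degree of the corresponding polynomial in \<open>tL\<close>; hence no
  weight is below 1.\<close>

definition tw :: "nat set \<Rightarrow> (nat \<Rightarrow> nat) \<Rightarrow> real" where
  "tw S k = (\<Prod>j\<in>S. real (Suc (k j)))"

lemma tw_ge1: "1 \<le> tw S k"
  unfolding tw_def by (rule prod_ge_1) simp

text \<open>The bound 2k + 1 of \<open>Leg_sup\<close> is at most 3k for degrees k \<ge> 1, which
  gives one factor 3 for each coordinate.\<close>

lemma tL_sq_le: "in_cube S x \<Longrightarrow> (tL S k x)\<^sup>2 \<le> 3 ^ card S * tw S k"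
proof -
  assume x: "in_cube S x"
  have "(tL S k x)\<^sup>2 = (\<Prod>j\<in>S. (poly (Leg (Suc (k j))) (x j))\<^sup>2)"
    by (simp add: tL_def prod_power_distrib)
  also have "\<dots> \<le> (\<Prod>j\<in>S. 3 * real (Suc (k j)))"
  proof (intro prod_mono conjI)
    fix j assume "j \<in> S"
    then have "(poly (Leg (Suc (k j))) (x j))\<^sup>2 \<le> 2 * real (Suc (k j)) + 1"
      using x by (intro Leg_sup) (simp add: in_cube_def)
    then show "(poly (Leg (Suc (k j))) (x j))\<^sup>2 \<le> 3 * real (Suc (k j))" by simp
  qed simp
  also have "\<dots> = 3 ^ card S * tw S k" by (simp only: prod.distrib prod_constant tw_def)
  finally show ?thesis .
qed

lemma sum_inverse_squares_le: "(\<Sum>i<N. 1 / (real (Suc i))\<^sup>2) \<le> 2"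
proof -
  have "(\<Sum>i<Suc N. 1 / (real (Suc i))\<^sup>2) \<le> 2 - 1 / real (Suc N)" for N
  proof (induction N)
    case (Suc N)
    have "1 / (real (Suc (Suc N)))\<^sup>2 \<le> 1 / (real (Suc N) * real (Suc (Suc N)))"
      unfolding power2_eq_square by (intro divide_left_mono mult_right_mono) auto
    also have "\<dots> = 1 / real (Suc N) - 1 / real (Suc (Suc N))" by (simp add: field_simps)
    finally show ?case using Suc.IH by simp
  qed simp
  then have "(\<Sum>i<Suc N. 1 / (real (Suc i))\<^sup>2) \<le> 2" for N
    by (rule order.trans) simp
  then show ?thesis by (cases N) auto
qed

text \<open>For m \<ge> 2 the terms still decay like \<open>1 / (tw S k)\<^sup>2\<close> after one
  power of the weight is lost to the bound on \<open>tL\<close>. The 6 is 3 times the bound 2 for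
  the sum of inverse squares.\<close>

lemma sum_tL_tw_le:
  assumes "finite S" "2 \<le> m" "in_cube S x"
  shows "(\<Sum>k\<in>ibox S N. (tL S k x)\<^sup>2 / tw S k ^ (2 * m)) \<le> 6 ^ card S"
proof -
  have "(\<Sum>k\<in>ibox S N. (tL S k x)\<^sup>2 / tw S k ^ (2 * m)) \<le> (\<Sum>k\<in>ibox S N. 3 ^ card S * (1 / (tw S k)\<^sup>2))"
  proof (rule sum_mono)
    fix k
    have "(tL S k x)\<^sup>2 / tw S k ^ (2 * m) \<le> 3 ^ card S * tw S k / tw S k ^ (2 * m)"
      using tL_sq_le[OF assms(3), of k] tw_ge1[of S k] by (intro divide_right_mono) auto
    also have "\<dots> \<le> 3 ^ card S * tw S k / tw S k ^ 3"
      using tw_ge1[of S k] assms(2) by (intro divide_left_mono power_increasing mult_pos_pos zero_less_power mult_nonneg_nonneg) auto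
    also have "\<dots> = 3 ^ card S * (1 / (tw S k)\<^sup>2)"
      using tw_ge1[of S k] by (simp add: power2_eq_square power3_eq_cube)
    finally show "(tL S k x)\<^sup>2 / tw S k ^ (2 * m) \<le> 3 ^ card S * (1 / (tw S k)\<^sup>2)" .
  qed
  also have "\<dots> = 3 ^ card S * (\<Prod>j\<in>S. \<Sum>i<N. 1 / (real (Suc i))\<^sup>2)"
    unfolding ibox_def
    by (subst prod_sum_PiE) (auto simp: assms(1) sum_distrib_left tw_def prod_power_distrib prod_dividef simp del: of_nat_Suc
        intro!: sum.cong)
  also have "\<dots> \<le> 3 ^ card S * (\<Prod>j\<in>S. 2)"
    by (intro mult_left_mono prod_mono conjI sum_nonneg sum_inverse_squares_le) auto
  also have "\<dots> = 6 ^ card S" by (simp flip: power_mult_distrib)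
  finally show ?thesis .
qed

lemma tE_tL_expansion:
  assumes S: "finite S" "1 \<le> m" and k: "k \<in> ibox S n"
    and N: "\<And>i. i < n \<Longrightarrow> degree (ek m i) \<le> N"
  shows "tE m S k x = (\<Sum>l\<in>ibox S N. (\<Prod>j\<in>S. Acoef m (k j) (l j)) * tL S l x)"
proof -
  have "tE m S k x = (\<Prod>j\<in>S. \<Sum>i<N. Acoef m (k j) i * poly (Leg (Suc i)) (x j))"
    unfolding tE_def
  proof (rule prod.cong[OF refl])
    fix j assume "j \<in> S"
    then have "k j < n" using k by (auto simp: ibox_def PiE_iff)
    then show "poly (ek m (k j)) (x j) = (\<Sum>i<N. Acoef m (k j) i * poly (Leg (Suc i)) (x j))"
      by (intro ek_Leg_expansion S N)
  qed
  also have "\<dots> = (\<Sum>l\<in>ibox S N. (\<Prod>j\<in>S. Acoef m (k j) (l j) * poly (Leg (Suc (l j))) (x j)))"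
    unfolding ibox_def by (rule prod_sum_PiE) (auto simp: S)
  finally show ?thesis by (simp add: prod.distrib tL_def)
qed

text \<open>Unordered sums over multi-indices may be computed along boxes, so that
  \<open>has_sum\<close> turns into the limit of a sequence.\<close>

lemma box_at_top:
  assumes "finite S" shows "filterlim (ibox S) (finite_subsets_at_top (mi S)) sequentially"
  unfolding filterlim_finite_subsets_at_top
proof (intro allI impI)
  fix X assume "finite X \<and> X \<subseteq> mi S"
  then have "\<exists>N. X \<subseteq> ibox S N" by (intro finite_subset_box assms) auto
  then obtain N where N: "X \<subseteq> ibox S N" ..
  have "finite (ibox S n) \<and> X \<subseteq> ibox S n \<and> ibox S n \<subseteq> mi S" if "n \<ge> N" for n
    using subset_trans[OF N box_mono[OF that]] box_subset_mi finite_box[OF assms] by (intro conjI)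
  then show "\<forall>\<^sub>F n in sequentially. finite (ibox S n) \<and> X \<subseteq> ibox S n \<and> ibox S n \<subseteq> mi S"
    unfolding eventually_sequentially by blast
qed

text \<open>Truncating the expansion in the tensorised basis to boxes gives Cauchy sequences of Legendre
  coefficients in the weighted norm, because the coefficient map is bounded on finite sums.\<close>

lemma rep_Legendre:
  assumes S: "S \<subseteq> {1..d}" and m: "2 \<le> m" and r: "rep m d S f b"
  shows "\<exists>c. (\<forall>N. (\<Sum>l\<in>ibox S N. tw S l ^ (2 * m) * (c l)\<^sup>2) \<le> CU m ^ card S * infsum (\<lambda>k. (b k)\<^sup>2) (mi S))
     \<and> (\<forall>x\<in>cube d. (\<lambda>N. \<Sum>l\<in>ibox S N. c l * tL S l x) \<longlonglongrightarrow> f x)"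
proof -
  have fS: "finite S" using S finite_subset by blast
  have m1: "1 \<le> m" using m by simp
  have lb: "l2 (mi S) b" using r by (simp add: rep_def)
  define T where "T n = (\<Sum>k\<in>ibox S n. (b k)\<^sup>2)" for n
  define cN where "cN n l = (\<Sum>k\<in>ibox S n. b k * (\<Prod>j\<in>S. Acoef m (k j) (l j)))" for n l
  let ?C = "CU m ^ card S"
  have C1: "1 \<le> ?C" using CU_pos by (rule one_le_power)
  have op: "(\<Sum>l\<in>ibox S N. tw S l ^ (2 * m) * (\<Sum>k\<in>ibox S n. b' k * (\<Prod>j\<in>S. Acoef m (k j) (l j)))\<^sup>2)
     \<le> ?C * (\<Sum>k\<in>ibox S n. (b' k)\<^sup>2)" for b' n N
  proof -
    have "(\<Sum>l\<in>ibox S N. (\<Sum>k\<in>ibox S n. b' k * (\<Prod>j\<in>S. real (Suc (l j)) ^ m * Acoef m (k j) (l j)))\<^sup>2)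
      \<le> ?C * (\<Sum>k\<in>ibox S n. (b' k)\<^sup>2)"
      unfolding ibox_def
    proof (rule tensor_operator_bound[OF fS])
      show "0 \<le> CU m" using CU_pos[of m] by simp
      fix b :: "nat \<Rightarrow> real"
      have "(\<Sum>k<n. b k * (real (Suc i) ^ m * Acoef m k i))\<^sup>2 = real (Suc i) ^ (2 * m) * (\<Sum>k<n. b k * Acoef m k i)\<^sup>2" for i
      proof -
        have "(\<Sum>k<n. b k * (real (Suc i) ^ m * Acoef m k i)) = real (Suc i) ^ m * (\<Sum>k<n. b k * Acoef m k i)"
          by (simp add: sum_distrib_left mult.left_commute)
        then show ?thesis by (simp add: power_mult_distrib power_mult[symmetric] mult.commute)
      qed
      then show "(\<Sum>i<N. (\<Sum>k<n. b k * (real (Suc i) ^ m * Acoef m k i))\<^sup>2) \<le> CU m * (\<Sum>k<n. (b k)\<^sup>2)"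
        using Acoef_bound[where F = "{..<n}" and m = m and N = N and b = b] m1 by (simp only: finite_lessThan simp_thms)
    qed
    also have "(\<Sum>l\<in>ibox S N. (\<Sum>k\<in>ibox S n. b' k * (\<Prod>j\<in>S. real (Suc (l j)) ^ m * Acoef m (k j) (l j)))\<^sup>2)
      = (\<Sum>l\<in>ibox S N. tw S l ^ (2 * m) * (\<Sum>k\<in>ibox S n. b' k * (\<Prod>j\<in>S. Acoef m (k j) (l j)))\<^sup>2)"
    proof (rule sum.cong[OF refl])
      fix l
      have "(\<Sum>k\<in>ibox S n. b' k * (\<Prod>j\<in>S. real (Suc (l j)) ^ m * Acoef m (k j) (l j)))
          = tw S l ^ m * (\<Sum>k\<in>ibox S n. b' k * (\<Prod>j\<in>S. Acoef m (k j) (l j)))"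
        by (simp add: prod.distrib tw_def prod_power_distrib sum_distrib_left mult.left_commute del: of_nat_Suc)
      then show "(\<Sum>k\<in>ibox S n. b' k * (\<Prod>j\<in>S. real (Suc (l j)) ^ m * Acoef m (k j) (l j)))\<^sup>2
        = tw S l ^ (2 * m) * (\<Sum>k\<in>ibox S n. b' k * (\<Prod>j\<in>S. Acoef m (k j) (l j)))\<^sup>2"
        by (simp add: power_mult_distrib power_mult[symmetric] mult.commute)
    qed
    finally show ?thesis .
  qed
  have tw0: "tw S l \<noteq> 0" for l using tw_ge1[of S l] by linarith
  have opd: "(\<Sum>l\<in>ibox S N. tw S l ^ (2 * m) * (cN n' l - cN n l)\<^sup>2) \<le> ?C * (T n' - T n)" if "n \<le> n'" for n n' N
  proof -
    \<comment> \<open>The difference of two truncations is a truncation of the family set to zero on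
      the smaller box, so that \<open>op\<close> applies to it.\<close>
    let ?b = "\<lambda>k. if k \<in> ibox S n then 0 else b k"
    have sub: "ibox S n \<subseteq> ibox S n'" by (rule box_mono[OF that])
    have split: "(\<Sum>k\<in>ibox S n'. g k) - (\<Sum>k\<in>ibox S n. g k) = (\<Sum>k\<in>ibox S n'. if k \<in> ibox S n then 0 else g k)" for g :: "(nat \<Rightarrow> nat) \<Rightarrow> real"
    proof -
      have "(\<Sum>k\<in>ibox S n'. g k) - (\<Sum>k\<in>ibox S n. g k) = (\<Sum>k\<in>ibox S n' - ibox S n. g k)"
        using sub fS by (simp add: sum_diff)
      also have "\<dots> = (\<Sum>k\<in>ibox S n'. if k \<in> ibox S n then 0 else g k)"
        using fS by (intro sum.mono_neutral_cong_left) auto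
      finally show ?thesis .
    qed
    have "cN n' l - cN n l = (\<Sum>k\<in>ibox S n'. ?b k * (\<Prod>j\<in>S. Acoef m (k j) (l j)))" for l
      unfolding cN_def split by (intro sum.cong) auto
    moreover have "T n' - T n = (\<Sum>k\<in>ibox S n'. (?b k)\<^sup>2)"
      unfolding T_def split by (intro sum.cong) auto
    ultimately show ?thesis using op[where b' = ?b and n = n' and N = N] by simp
  qed
  have Tinc: "incseq T" unfolding T_def using fS box_mono by (intro incseq_SucI sum_mono2) auto
  have Tle: "T n \<le> infsum (\<lambda>k. (b k)\<^sup>2) (mi S)" for n
    unfolding T_def using fS box_subset_mi by (intro l2_finite_le lb) auto
  obtain Ti where Ti: "T \<longlonglongrightarrow> Ti" and TTi: "\<And>n. T n \<le> Ti"
    using incseq_convergent[OF Tinc, of "infsum (\<lambda>k. (b k)\<^sup>2) (mi S)"] Tle by blast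
  have Tile: "Ti \<le> infsum (\<lambda>k. (b k)\<^sup>2) (mi S)" using Ti Tle by (intro LIMSEQ_le_const2) auto
  have pw: "\<exists>c. (\<lambda>n. cN n l) \<longlonglongrightarrow> c" if l: "l \<in> mi S" for l
  proof -
    obtain N where N: "l \<in> ibox S N" using finite_subset_box[OF fS, of "{l}"] l by auto
    have one: "(cN n' l - cN n l)\<^sup>2 \<le> ?C * (T n' - T n)" if "n \<le> n'" for n n'
    proof -
      have "(cN n' l - cN n l)\<^sup>2 \<le> tw S l ^ (2 * m) * (cN n' l - cN n l)\<^sup>2"
        using one_le_power[OF tw_ge1[of S l], of "2 * m"] by (simp add: mult_left_le mult_le_cancel_right1)
      also have "\<dots> \<le> (\<Sum>l\<in>ibox S N. tw S l ^ (2 * m) * (cN n' l - cN n l)\<^sup>2)"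
        using N fS tw_ge1[of S] by (intro member_le_sum) (auto intro!: mult_nonneg_nonneg zero_le_power intro: order.trans[OF zero_le_one])
      also have "\<dots> \<le> ?C * (T n' - T n)" by (rule opd[OF that])
      finally show ?thesis .
    qed
    have "Cauchy (\<lambda>n. cN n l)"
    proof (rule CauchyI')
      fix e :: real assume e: "e > 0"
      have "e\<^sup>2 / ?C > 0" using e C1 by (intro divide_pos_pos) auto
      then obtain M where M: "\<And>n. n \<ge> M \<Longrightarrow> norm (T n - Ti) < e\<^sup>2 / ?C" using Ti by (metis LIMSEQ_iff)
      have "dist (cN n l) (cN n' l) < e" if "n \<ge> M" "n' > n" for n n'
      proof -
        have "(cN n' l - cN n l)\<^sup>2 \<le> ?C * (T n' - T n)" using one that by simp
        also have "\<dots> \<le> ?C * (Ti - T n)" using TTi C1 by (intro mult_left_mono) auto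
        also have "\<dots> < ?C * (e\<^sup>2 / ?C)" using M[OF that(1)] C1 by (intro mult_strict_left_mono) auto
        also have "\<dots> = e\<^sup>2" by (rule times_divide_eq_right[THEN trans, OF nonzero_mult_div_cancel_left]) (use C1 in linarith)
        finally have "\<bar>cN n' l - cN n l\<bar>\<^sup>2 < e\<^sup>2" unfolding power2_abs .
        then have "\<bar>cN n' l - cN n l\<bar> < e" by (rule power2_less_imp_less) (use e in simp)
        then show ?thesis using e by (simp add: dist_real_def abs_minus_commute)
      qed
      then show "\<exists>M. \<forall>n\<ge>M. \<forall>n'>n. dist (cN n l) (cN n' l) < e" by blast
    qed
    then show ?thesis using Cauchy_convergent_iff convergent_def by blast
  qed
  then obtain c where c: "\<And>l. l \<in> mi S \<Longrightarrow> (\<lambda>n. cN n l) \<longlonglongrightarrow> c l" by metis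
  have cb: "l \<in> ibox S N \<Longrightarrow> (\<lambda>n. cN n l) \<longlonglongrightarrow> c l" for l N using c box_subset_mi by blast
  have lim: "(\<Sum>l\<in>ibox S N. tw S l ^ (2 * m) * (c l - cN n l)\<^sup>2) \<le> ?C * (Ti - T n)" for n N
  proof -
    have "(\<lambda>n'. \<Sum>l\<in>ibox S N. tw S l ^ (2 * m) * (cN n' l - cN n l)\<^sup>2) \<longlonglongrightarrow> (\<Sum>l\<in>ibox S N. tw S l ^ (2 * m) * (c l - cN n l)\<^sup>2)"
      by (intro tendsto_intros cb)
    moreover have "(\<Sum>l\<in>ibox S N. tw S l ^ (2 * m) * (cN n' l - cN n l)\<^sup>2) \<le> ?C * (Ti - T n)" if "n \<le> n'" for n'
      by (rule order.trans[OF opd[OF that]]) (intro mult_left_mono diff_right_mono TTi; use C1 in simp)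
    ultimately show ?thesis by (intro LIMSEQ_le_const2) auto
  qed
  have 1: "(\<Sum>l\<in>ibox S N. tw S l ^ (2 * m) * (c l)\<^sup>2) \<le> ?C * infsum (\<lambda>k. (b k)\<^sup>2) (mi S)" for N
  proof -
    have "(\<lambda>n'. \<Sum>l\<in>ibox S N. tw S l ^ (2 * m) * (cN n' l)\<^sup>2) \<longlonglongrightarrow> (\<Sum>l\<in>ibox S N. tw S l ^ (2 * m) * (c l)\<^sup>2)"
      by (intro tendsto_intros cb)
    moreover have "(\<Sum>l\<in>ibox S N. tw S l ^ (2 * m) * (cN n' l)\<^sup>2) \<le> ?C * infsum (\<lambda>k. (b k)\<^sup>2) (mi S)" for n'
      using op[where b' = b and n = n' and N = N] Tle[of n'] C1 unfolding cN_def T_def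
      by (meson mult_left_mono order.trans zero_le_one)
    ultimately show ?thesis by (intro LIMSEQ_le_const2) auto
  qed
  have 2: "(\<lambda>N. \<Sum>l\<in>ibox S N. c l * tL S l x) \<longlonglongrightarrow> f x" if x: "x \<in> cube d" for x
  proof -
    have ic: "in_cube S x" by (rule in_cube_cube[OF x S])
    define g where "g n = (\<Sum>k\<in>ibox S n. b k * tE m S k x)" for n
    have gl: "g \<longlonglongrightarrow> f x"
      unfolding g_def using r x filterlim_compose[OF _ box_at_top[OF fS]] unfolding rep_def has_sum_def by blast
    have app: "\<exists>N0. \<forall>N\<ge>N0. \<bar>g n - (\<Sum>l\<in>ibox S N. c l * tL S l x)\<bar> \<le> sqrt (?C * (Ti - T n) * 6 ^ card S)" for n
    proof -
      \<comment> \<open>The sum is a common bound for the degrees; from there on the Legendre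
        expansions of the basis functions in the box \<open>n\<close> are exact.\<close>
      define N0 where "N0 = (\<Sum>i<n. degree (ek m i))"
      have "\<bar>g n - (\<Sum>l\<in>ibox S N. c l * tL S l x)\<bar> \<le> sqrt (?C * (Ti - T n) * 6 ^ card S)" if N: "N \<ge> N0" for N
      proof -
        have deg: "degree (ek m i) \<le> N" if "i < n" for i
          using member_le_sum[of i "{..<n}" "\<lambda>i. degree (ek m i)"] that N by (simp add: N0_def)
        have "g n = (\<Sum>k\<in>ibox S n. \<Sum>l\<in>ibox S N. b k * ((\<Prod>j\<in>S. Acoef m (k j) (l j)) * tL S l x))"
          unfolding g_def sum_distrib_left[symmetric]
          by (intro sum.cong refl arg_cong2[where f = times] tE_tL_expansion[OF fS m1 _ deg])
        also have "\<dots> = (\<Sum>l\<in>ibox S N. cN n l * tL S l x)"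
          by (subst sum.swap) (simp add: cN_def sum_distrib_right mult.assoc)
        finally have "(\<Sum>l\<in>ibox S N. c l * tL S l x) - g n = (\<Sum>l\<in>ibox S N. (tw S l ^ m * (c l - cN n l)) * (tL S l x / tw S l ^ m))"
          by (simp add: sum_subtractf[symmetric] left_diff_distrib tw0)
        \<comment> \<open>The weights split the error into the coefficient error controlled by
          \<open>lim\<close> and the uniformly bounded sum of \<open>sum_tL_tw_le\<close>.\<close>
        also have "(\<dots>)\<^sup>2 \<le> (\<Sum>l\<in>ibox S N. (tw S l ^ m * (c l - cN n l))\<^sup>2) * (\<Sum>l\<in>ibox S N. (tL S l x / tw S l ^ m)\<^sup>2)"
          by (rule Cauchy_Schwarz_ineq_sum)
        also have "\<dots> = (\<Sum>l\<in>ibox S N. tw S l ^ (2 * m) * (c l - cN n l)\<^sup>2) * (\<Sum>l\<in>ibox S N. (tL S l x)\<^sup>2 / tw S l ^ (2 * m))"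
          by (simp add: power_mult_distrib power_divide power_mult[symmetric] mult.commute)
        also have "\<dots> \<le> (?C * (Ti - T n)) * 6 ^ card S"
        proof (rule mult_mono[OF lim sum_tL_tw_le[OF fS m ic]])
          show "0 \<le> ?C * (Ti - T n)" using TTi[of n] C1 by (intro mult_nonneg_nonneg) linarith+
          show "0 \<le> (\<Sum>l\<in>ibox S N. (tL S l x)\<^sup>2 / tw S l ^ (2 * m))"
            by (intro sum_nonneg) (simp add: power_mult)
        qed
        finally have "\<bar>(\<Sum>l\<in>ibox S N. c l * tL S l x) - g n\<bar> \<le> sqrt (?C * (Ti - T n) * 6 ^ card S)"
          by (intro real_le_rsqrt) simp
        then show ?thesis by (simp add: abs_minus_commute)
      qed
      then show ?thesis by blast
    qed
    have el: "(\<lambda>n. \<bar>f x - g n\<bar> + sqrt (?C * (Ti - T n) * 6 ^ card S)) \<longlonglongrightarrow> \<bar>f x - f x\<bar> + sqrt (?C * (Ti - Ti) * 6 ^ card S)"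
      by (intro tendsto_intros gl Ti)
    show ?thesis
    proof (rule LIMSEQ_I)
      fix e :: real assume "e > 0"
      then obtain n where n: "\<bar>f x - g n\<bar> + sqrt (?C * (Ti - T n) * 6 ^ card S) < e"
        using el order_tendstoD(2)[OF el, of e] by (auto simp: eventually_sequentially)
      obtain N0 where N0: "\<forall>N\<ge>N0. \<bar>g n - (\<Sum>l\<in>ibox S N. c l * tL S l x)\<bar> \<le> sqrt (?C * (Ti - T n) * 6 ^ card S)"
        using app by blast
      have "norm ((\<Sum>l\<in>ibox S N. c l * tL S l x) - f x) < e" if "N \<ge> N0" for N
        using N0[rule_format, OF that] n unfolding real_norm_def by linarith
      then show "\<exists>no. \<forall>N\<ge>no. norm ((\<Sum>l\<in>ibox S N. c l * tL S l x) - f x) < e" by blast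
    qed
  qed
  show ?thesis using 1 2 by blast
qed

subsection \<open>Empirical processes of centred functions\<close>

lemma product_sigma_finite_const: "prob_space M \<Longrightarrow> product_sigma_finite (\<lambda>_. M)"
  by (intro product_sigma_finite.intro prob_space_imp_sigma_finite)

lemma (in prob_space) sum_centred_square:
  fixes h :: "'a \<Rightarrow> real"
  assumes h: "integrable M h" "integrable M (\<lambda>x. (h x)\<^sup>2)" "(\<integral>x. h x \<partial>M) = 0"
  shows "integrable (PiM {..<n} (\<lambda>_. M)) (\<lambda>\<omega>. (\<Sum>i<n. h (\<omega> i))\<^sup>2)"
    and "(\<integral>\<omega>. (\<Sum>i<n. h (\<omega> i))\<^sup>2 \<partial>PiM {..<n} (\<lambda>_. M)) = real n * (\<integral>x. (h x)\<^sup>2 \<partial>M)"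
proof -
  interpret P: product_sigma_finite "\<lambda>_::nat. M" by (rule product_sigma_finite_const) unfold_locales
  let ?P = "PiM {..<n} (\<lambda>_. M)"
  \<comment> \<open>Padding with factors 1 writes a product of two coordinates as a product over all
    of them, to which Fubini's theorem for \<open>PiM\<close> applies; the case \<open>i = j\<close>
    is included.\<close>
  define G where "G i j l x = (if l = i then h x else 1) * (if l = j then h x else 1)" for i j l :: nat and x
  have iG: "integrable M (G i j l)" for i j l
    using h by (cases "l = i"; cases "l = j") (auto simp: G_def[abs_def] power2_eq_square)
  have eq: "h (\<omega> i) * h (\<omega> j) = (\<Prod>l<n. G i j l (\<omega> l))" if "i < n" "j < n" for i j \<omega>
    using that by (simp add: G_def prod.distrib)
  have int: "integrable ?P (\<lambda>\<omega>. h (\<omega> i) * h (\<omega> j))" if "i < n" "j < n" for i j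
    unfolding eq[OF that] by (intro P.product_integrable_prod iG) simp
  have val: "(\<integral>\<omega>. h (\<omega> i) * h (\<omega> j) \<partial>?P) = (if i = j then \<integral>x. (h x)\<^sup>2 \<partial>M else 0)" if "i < n" "j < n" for i j
  proof -
    have "(\<integral>\<omega>. h (\<omega> i) * h (\<omega> j) \<partial>?P) = (\<Prod>l<n. \<integral>x. G i j l x \<partial>M)"
      unfolding eq[OF that] by (rule P.product_integral_prod[OF _ iG]) simp
    also have "\<dots> = (if i = j then \<integral>x. (h x)\<^sup>2 \<partial>M else 0)"
    proof (cases "i = j")
      case True
      have "(\<Prod>l<n. \<integral>x. G i j l x \<partial>M) = (\<Prod>l<n. if l = i then \<integral>x. (h x)\<^sup>2 \<partial>M else 1)"
        using True by (intro prod.cong refl) (auto simp: G_def power2_eq_square prob_space)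
      then show ?thesis using True that by simp
    next
      case False
      have "(\<integral>x. G i j i x \<partial>M) = 0" using False h(3) by (simp add: G_def)
      then have "(\<Prod>l<n. \<integral>x. G i j l x \<partial>M) = 0" using that by (intro prod_zero) auto
      then show ?thesis using False by simp
    qed
    finally show ?thesis .
  qed
  have ex: "(\<Sum>i<n. h (\<omega> i))\<^sup>2 = (\<Sum>i<n. \<Sum>j<n. h (\<omega> i) * h (\<omega> j))" for \<omega>
    by (simp add: power2_eq_square sum_product)
  show "integrable ?P (\<lambda>\<omega>. (\<Sum>i<n. h (\<omega> i))\<^sup>2)"
    unfolding ex by (intro Bochner_Integration.integrable_sum int) auto
  have "(\<integral>\<omega>. (\<Sum>i<n. h (\<omega> i))\<^sup>2 \<partial>?P) = (\<Sum>i<n. \<integral>\<omega>. (\<Sum>j<n. h (\<omega> i) * h (\<omega> j)) \<partial>?P)"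
    unfolding ex
    by (rule Bochner_Integration.integral_sum) (intro Bochner_Integration.integrable_sum int; simp)
  also have "\<dots> = (\<Sum>i<n. \<Sum>j<n. \<integral>\<omega>. h (\<omega> i) * h (\<omega> j) \<partial>?P)"
    by (intro sum.cong refl Bochner_Integration.integral_sum int; simp)
  also have "\<dots> = (\<Sum>i<n. \<Sum>j<n. if i = j then \<integral>x. (h x)\<^sup>2 \<partial>M else 0)"
    by (intro sum.cong refl val) auto
  also have "\<dots> = real n * (\<integral>x. (h x)\<^sup>2 \<partial>M)" by simp
  finally show "(\<integral>\<omega>. (\<Sum>i<n. h (\<omega> i))\<^sup>2 \<partial>?P) = real n * (\<integral>x. (h x)\<^sup>2 \<partial>M)" .
qed

text \<open>The exceptional events increase with the index set, so that the bound given by Markov's inequality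
  for each of them passes to their union.\<close>

lemma (in prob_space) empirical_squares_tail:
  fixes h :: "'k \<Rightarrow> 'a \<Rightarrow> real"
  assumes h: "\<And>k. integrable M (h k)" "\<And>k. integrable M (\<lambda>x. (h k x)\<^sup>2)" "\<And>k. (\<integral>x. h k x \<partial>M) = 0"
    and q: "\<forall>N. \<forall>k\<in>K N. (\<integral>x. (h k x)\<^sup>2 \<partial>M) \<le> q k" and K: "\<And>N. finite (K N)" "\<And>N. K N \<subseteq> K (Suc N)"
    and u: "\<And>k. 0 \<le> u k" and Q: "\<And>N. (\<Sum>k\<in>K N. u k * q k) \<le> Q" and n: "0 < n" and t: "0 < t"
  shows "\<exists>A\<in>sets (PiM {..<n} (\<lambda>_. M)). measure (PiM {..<n} (\<lambda>_. M)) A \<le> Q / (real n * t)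
     \<and> (\<forall>\<omega>\<in>space (PiM {..<n} (\<lambda>_. M)) - A. \<forall>N. (\<Sum>k\<in>K N. u k * ((\<Sum>i<n. h k (\<omega> i)) / real n)\<^sup>2) \<le> t)"
proof -
  let ?P = "PiM {..<n} (\<lambda>_. M)"
  interpret P: prob_space ?P by (rule prob_space_PiM) unfold_locales
  define Z where "Z N \<omega> = (\<Sum>k\<in>K N. u k * ((\<Sum>i<n. h k (\<omega> i)) / real n)\<^sup>2)" for N \<omega>
  have Zeq: "Z N = (\<lambda>\<omega>. \<Sum>k\<in>K N. (u k / (real n)\<^sup>2) * (\<Sum>i<n. h k (\<omega> i))\<^sup>2)" for N
    by (auto simp: Z_def power_divide)
  have Zi: "integrable ?P (Z N)" for N
    unfolding Zeq by (intro Bochner_Integration.integrable_sum integrable_mult_right sum_centred_square(1) h)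
  have ZI: "(\<integral>\<omega>. Z N \<omega> \<partial>?P) \<le> Q / real n" for N
  proof -
    have "(\<integral>\<omega>. Z N \<omega> \<partial>?P) = (\<Sum>k\<in>K N. (u k / (real n)\<^sup>2) * (\<integral>\<omega>. (\<Sum>i<n. h k (\<omega> i))\<^sup>2 \<partial>?P))"
      unfolding Zeq
      by (subst Bochner_Integration.integral_sum, intro integrable_mult_right sum_centred_square(1) h) simp
    also have "\<dots> = (\<Sum>k\<in>K N. u k * (\<integral>x. (h k x)\<^sup>2 \<partial>M) / real n)"
      using n by (intro sum.cong refl) (simp only: sum_centred_square(2)[OF h], simp add: power2_eq_square)
    also have "\<dots> = (\<Sum>k\<in>K N. u k * (\<integral>x. (h k x)\<^sup>2 \<partial>M)) / real n" by (simp add: sum_divide_distrib)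
    also have "\<dots> \<le> (\<Sum>k\<in>K N. u k * q k) / real n"
      by (intro divide_right_mono sum_mono mult_left_mono q[rule_format] u) auto
    also have "\<dots> \<le> Q / real n" by (intro divide_right_mono Q) simp
    finally show ?thesis .
  qed
  define A where "A N = {\<omega>\<in>space ?P. t \<le> Z N \<omega>}" for N
  have [measurable]: "Z N \<in> borel_measurable ?P" for N using Zi by (rule borel_measurable_integrable)
  have As: "A N \<in> sets ?P" for N unfolding A_def by measurable
  have mA: "measure ?P (A N) \<le> Q / (real n * t)" for N
  proof -
    have "measure ?P (A N) \<le> (\<integral>\<omega>. Z N \<omega> \<partial>?P) / t"
      unfolding A_def
      by (rule integral_Markov_inequality_measure[OF Zi sets.empty_sets _ t]) (auto simp: Z_def u intro!: sum_nonneg)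
    also have "\<dots> \<le> (Q / real n) / t" using t by (intro divide_right_mono ZI) simp
    finally show ?thesis by simp
  qed
  have "Z N \<omega> \<le> Z (Suc N) \<omega>" for N \<omega>
    unfolding Z_def using K u by (intro sum_mono2) auto
  then have inc: "incseq A" unfolding A_def by (intro incseq_SucI) (auto intro: order.trans)
  have "(\<lambda>N. measure ?P (A N)) \<longlonglongrightarrow> measure ?P (\<Union>N. A N)"
    by (rule P.finite_Lim_measure_incseq) (use As inc in auto)
  then have "measure ?P (\<Union>N. A N) \<le> Q / (real n * t)"
    by (rule LIMSEQ_le_const2) (use mA in blast)
  moreover have "(\<Union>N. A N) \<in> sets ?P" using As by blast
  moreover have "\<forall>\<omega>\<in>space ?P - (\<Union>N. A N). \<forall>N. Z N \<omega> \<le> t" by (auto simp: A_def not_le intro: less_imp_le)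
  ultimately show ?thesis unfolding Z_def by blast
qed

subsection \<open>The uniform distribution on the cube\<close>

abbreviation U01 :: "real measure" where "U01 \<equiv> uniform_measure lborel {0..1}"

lemma prob_space_U01: "prob_space U01"
  by (rule prob_space_uniform_measure) auto

lemma prob_space_unif_cube: "prob_space (unif_cube d)"
  unfolding unif_cube_def by (rule prob_space_PiM) (rule prob_space_U01)

lemma poly_measurable [measurable]: "poly (p :: real poly) \<in> borel_measurable borel"
  by (rule borel_measurable_continuous_onI) (rule continuous_on_poly_real)

lemma U01_poly: "integrable U01 (poly p)" "(\<integral>x. poly p x \<partial>U01) = pint p"
proof -
  have U: "U01 = density lborel (\<lambda>x. ennreal (indicator {0..1} x))"
    unfolding uniform_measure_def by (intro density_cong) (auto simp: divide_ennreal_def split: split_indicator)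
  have si: "set_integrable lborel {0..1} (poly p)"
    by (rule borel_integrable_atLeastAtMost') (rule continuous_on_poly_real)
  show "integrable U01 (poly p)"
    unfolding U using si by (subst integrable_density) (auto simp: set_integrable_def)
  have "(\<integral>x. poly p x \<partial>U01) = (\<integral>x. indicator {0..1} x *\<^sub>R poly p x \<partial>lborel)"
    unfolding U by (rule integral_density) auto
  also have "\<dots> = pint p"
    using set_borel_integral_eq_integral(2)[OF si] by (simp add: set_lebesgue_integral_def pint_def)
  finally show "(\<integral>x. poly p x \<partial>U01) = pint p" .
qed

lemma product_sigma_finite_U01: "product_sigma_finite (\<lambda>_. U01)"
  by (rule product_sigma_finite_const) (rule prob_space_U01)

lemma unif_cube_prod:
  "integrable (unif_cube d) (\<lambda>x. \<Prod>j\<in>{1..d}. poly (p j) (x j))"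
  "(\<integral>x. (\<Prod>j\<in>{1..d}. poly (p j) (x j)) \<partial>unif_cube d) = (\<Prod>j\<in>{1..d}. pint (p j))"
  unfolding unif_cube_def U01_poly(2)[symmetric]
  by (rule product_sigma_finite.product_integrable_prod[OF product_sigma_finite_U01]; simp add: U01_poly(1))
     (rule product_sigma_finite.product_integral_prod[OF product_sigma_finite_U01]; simp add: U01_poly(1))

lemma AE_unif_cube: "AE x in unif_cube d. x \<in> cube d"
proof -
  have "AE x in unif_cube d. x j \<in> {0..1}" if "j \<in> {1..d}" for j
    unfolding unif_cube_def
    by (rule AE_PiM_component[OF prob_space_U01 that]) (auto intro!: AE_uniform_measureI)
  then have "AE x in unif_cube d. \<forall>j\<in>{1..d}. x j \<in> {0..1}" by (intro AE_finite_allI) auto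
  then show ?thesis using AE_space
  proof eventually_elim
    case (elim x)
    then show ?case by (auto simp: cube_def unif_cube_def space_PiM PiE_iff)
  qed
qed

text \<open>The factor 1 at coordinates outside \<open>S\<close> turns \<open>tL S k\<close> into a
  product over all coordinates of the cube.\<close>

definition LegI :: "nat set \<Rightarrow> (nat \<Rightarrow> nat) \<Rightarrow> nat \<Rightarrow> real poly" where
  "LegI S k j = (if j \<in> S then Leg (Suc (k j)) else 1)"

lemma tL_prod: "S \<subseteq> {1..d} \<Longrightarrow> tL S k x = (\<Prod>j\<in>{1..d}. poly (LegI S k j) (x j))"
  unfolding tL_def by (rule prod.mono_neutral_cong_left) (auto simp: LegI_def)

lemma pint_LegI: "pint (LegI S k j * LegI S' k' j) = (if (j \<in> S \<longleftrightarrow> j \<in> S') \<and> (j \<in> S \<longrightarrow> k j = k' j) then 1 else 0)"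
  using Leg_orthonormal[of 0] Leg_orthonormal[of _ 0] by (auto simp: LegI_def Leg_orthonormal)

text \<open>At a coordinate in only one of \<open>S\<close> and \<open>S'\<close> a single
  nonconstant Legendre polynomial is integrated, which gives zero. This is the orthogonality of
  different components under the uniform distribution.\<close>

lemma tL_orthonormal:
  assumes S: "S \<subseteq> {1..d}" "S' \<subseteq> {1..d}" and k: "k \<in> mi S" "k' \<in> mi S'"
  shows "integrable (unif_cube d) (\<lambda>x. tL S k x * tL S' k' x)"
    "(\<integral>x. tL S k x * tL S' k' x \<partial>unif_cube d) = (if S = S' \<and> k = k' then 1 else 0)"
    "integrable (unif_cube d) (\<lambda>x. (tL S k x * tL S' k' x)\<^sup>2)"
    "integrable (unif_cube d) (tL S k)"
proof -
  have eq: "tL S k x * tL S' k' x = (\<Prod>j\<in>{1..d}. poly (LegI S k j * LegI S' k' j) (x j))" for x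
    by (simp add: tL_prod[OF S(1)] tL_prod[OF S(2)] prod.distrib)
  show "integrable (unif_cube d) (\<lambda>x. tL S k x * tL S' k' x)" unfolding eq by (rule unif_cube_prod)
  have "(tL S k x * tL S' k' x)\<^sup>2 = (\<Prod>j\<in>{1..d}. poly ((LegI S k j * LegI S' k' j)\<^sup>2) (x j))" for x
    unfolding eq poly_power prod_power_distrib ..
  then show "integrable (unif_cube d) (\<lambda>x. (tL S k x * tL S' k' x)\<^sup>2)"
    using unif_cube_prod(1)[of d "\<lambda>j. (LegI S k j * LegI S' k' j)\<^sup>2"] by (simp only:)
  show "integrable (unif_cube d) (tL S k)"
    using unif_cube_prod(1)[of d "LegI S k"] tL_prod[OF S(1), of k] by presburger
  have "(\<integral>x. tL S k x * tL S' k' x \<partial>unif_cube d) = (\<Prod>j\<in>{1..d}. if (j \<in> S \<longleftrightarrow> j \<in> S') \<and> (j \<in> S \<longrightarrow> k j = k' j) then 1 else 0)"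
    unfolding eq unif_cube_prod(2) pint_LegI ..
  also have "\<dots> = (if S = S' \<and> k = k' then 1 else 0)"
  proof (cases "S = S' \<and> k = k'")
    case False
    have "\<exists>j\<in>{1..d}. \<not> ((j \<in> S \<longleftrightarrow> j \<in> S') \<and> (j \<in> S \<longrightarrow> k j = k' j))"
    proof (rule ccontr)
      assume n: "\<not> ?thesis"
      then have "S = S'" using S by blast
      moreover have "k = k'"
      proof (rule PiE_ext[OF k(1)])
        show "k' \<in> mi S" using k(2) \<open>S = S'\<close> by simp
        show "k j = k' j" if "j \<in> S" for j using n that S(1) by blast
      qed
      ultimately show False using False by simp
    qed
    then have "(\<Prod>j\<in>{1..d}. if (j \<in> S \<longleftrightarrow> j \<in> S') \<and> (j \<in> S \<longrightarrow> k j = k' j) then 1 else 0 :: real) = 0"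
      by (intro prod_zero) auto
    then show ?thesis using False by simp
  qed simp
  finally show "(\<integral>x. tL S k x * tL S' k' x \<partial>unif_cube d) = (if S = S' \<and> k = k' then 1 else 0)" .
qed

text \<open>The pointwise bound is applied to one factor and orthonormality to the other, so that
  only the weight of \<open>S\<close> is lost.\<close>

lemma tL_mult_second_moment:
  assumes S: "S \<subseteq> {1..d}" "S' \<subseteq> {1..d}" and k: "k \<in> mi S" "k' \<in> mi S'"
  shows "(\<integral>x. (tL S k x * tL S' k' x)\<^sup>2 \<partial>unif_cube d) \<le> 3 ^ card S * tw S k"
proof -
  have "(\<integral>x. (tL S k x * tL S' k' x)\<^sup>2 \<partial>unif_cube d) \<le> (\<integral>x. 3 ^ card S * tw S k * (tL S' k' x * tL S' k' x) \<partial>unif_cube d)"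
  proof (rule integral_mono_AE)
    show "AE x in unif_cube d. (tL S k x * tL S' k' x)\<^sup>2 \<le> 3 ^ card S * tw S k * (tL S' k' x * tL S' k' x)"
      using AE_unif_cube
    proof eventually_elim
      case (elim x)
      have "(tL S k x)\<^sup>2 * (tL S' k' x)\<^sup>2 \<le> 3 ^ card S * tw S k * (tL S' k' x)\<^sup>2"
        by (intro mult_right_mono tL_sq_le in_cube_cube[OF elim S(1)]) simp
      then show ?case unfolding power_mult_distrib power2_eq_square[of "tL S' k' x"] .
    qed
  qed (intro tL_orthonormal(3)[OF S k] integrable_mult_right tL_orthonormal(1)[OF S(2) S(2) k(2) k(2)])+
  also have "\<dots> = 3 ^ card S * tw S k"
    using tL_orthonormal(2)[OF S(2) S(2) k(2) k(2)] by simp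
  finally show ?thesis .
qed

section \<open>Tail bounds for the noise functional and the empirical Gram matrix\<close>

lemma integrable_pair_mult:
  fixes g r :: "_ \<Rightarrow> real"
  assumes "prob_space M" "prob_space N" and g: "integrable M g" and r: "integrable N r"
  shows "integrable (M \<Otimes>\<^sub>M N) (\<lambda>z. g (fst z) * r (snd z))"
    "(\<integral>z. g (fst z) * r (snd z) \<partial>(M \<Otimes>\<^sub>M N)) = (\<integral>x. g x \<partial>M) * (\<integral>y. r y \<partial>N)"
proof -
  interpret M: prob_space M by fact
  interpret N: prob_space N by fact
  interpret P: pair_sigma_finite M N by unfold_locales
  have [measurable]: "g \<in> borel_measurable M" "r \<in> borel_measurable N" using g r by auto
  show i: "integrable (M \<Otimes>\<^sub>M N) (\<lambda>z. g (fst z) * r (snd z))"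
  proof (rule P.Fubini_integrable)
    show "integrable M (\<lambda>x. \<integral>y. norm (g (fst (x, y)) * r (snd (x, y))) \<partial>N)"
      using g by (simp add: abs_mult)
  qed (use r in auto)
  have "(\<integral>z. g (fst z) * r (snd z) \<partial>(M \<Otimes>\<^sub>M N)) = (\<integral>x. \<integral>y. g x * r y \<partial>N \<partial>M)"
    using P.integral_fst'[of "\<lambda>z. g (fst z) * r (snd z)"] i by simp
  then show "(\<integral>z. g (fst z) * r (snd z) \<partial>(M \<Otimes>\<^sub>M N)) = (\<integral>x. g x \<partial>M) * (\<integral>y. r y \<partial>N)" by simp
qed

lemma AE_sample_cube:
  assumes "prob_space \<nu>" shows "AE \<omega> in sample_space d \<nu> n. \<forall>i\<in>{..<n}. fst (\<omega> i) \<in> cube d"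
proof -
  interpret N: prob_space \<nu> by fact
  have "AE z in unif_cube d \<Otimes>\<^sub>M \<nu>. fst z \<in> cube d"
    by (rule AE_distrD[of fst _ "unif_cube d"], simp, subst N.distr_pair_fst, rule AE_unif_cube)
  then show ?thesis unfolding sample_space_def
    by (intro AE_finite_allI AE_PiM_component) (auto intro: prob_space_pair prob_space_unif_cube assms)
qed

text \<open>By independence of noise and design, the product of the noise with a normalised basis
  function is centred and has the second moment of the noise. The weighted sum of squared means then
  has expectation of order \<open>H / n\<close>.\<close>

lemma noise_tail:
  assumes \<nu>: "prob_space \<nu>" "integrable \<nu> (\<lambda>e. e)" "(\<integral>e. e \<partial>\<nu>) = 0" "integrable \<nu> (\<lambda>e. e\<^sup>2)"
    and S: "S \<subseteq> {1..d}" and w: "\<And>k. 0 < w k" and H: "\<And>N. (\<Sum>k\<in>ibox S N. 1 / w k) \<le> H" and n: "0 < n" and t: "0 < t"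
  shows "\<exists>A\<in>sets (sample_space d \<nu> n). measure (sample_space d \<nu> n) A \<le> (\<integral>e. e\<^sup>2 \<partial>\<nu>) * H / (real n * t)
     \<and> (\<forall>\<omega>\<in>space (sample_space d \<nu> n) - A. \<forall>N. (\<Sum>k\<in>ibox S N. ((\<Sum>i<n. snd (\<omega> i) * tL S k (fst (\<omega> i))) / real n)\<^sup>2 / w k) \<le> t)"
proof -
  let ?M = "unif_cube d \<Otimes>\<^sub>M \<nu>"
  have fS: "finite S" using S finite_subset by blast
  note pc = prob_space_unif_cube[of d]
  interpret M: prob_space ?M by (intro prob_space_pair pc \<nu>(1))
  \<comment> \<open>The value zero off \<open>mi S\<close> makes the moment conditions true for all
    indices, as \<open>empirical_squares_tail\<close> requires.\<close>
  define h where "h k z = (if k \<in> mi S then snd z * tL S k (fst z) else 0)" for k and z :: "(nat \<Rightarrow> real) \<times> real"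
  let ?s = "\<integral>e. e\<^sup>2 \<partial>\<nu>"
  have mix: "h k = (\<lambda>z. tL S k (fst z) * snd z)" "(\<lambda>z. (h k z)\<^sup>2) = (\<lambda>z. (tL S k (fst z) * tL S k (fst z)) * (snd z)\<^sup>2)" if "k \<in> mi S" for k
    using that by (auto simp: h_def power2_eq_square algebra_simps)
  note o = tL_orthonormal[OF S S]
  have 1: "integrable ?M (h k)" for k
  proof (cases "k \<in> mi S")
    case True
    then show ?thesis unfolding mix(1)[OF True] by (intro integrable_pair_mult[OF pc \<nu>(1)] o(4) \<nu>(2))
  qed (simp add: h_def[abs_def])
  have 2: "integrable ?M (\<lambda>z. (h k z)\<^sup>2)" for k
  proof (cases "k \<in> mi S")
    case True
    then show ?thesis unfolding mix(2)[OF True] by (intro integrable_pair_mult[OF pc \<nu>(1)] o(1) \<nu>(4))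
  qed (simp add: h_def)
  have 3: "(\<integral>z. h k z \<partial>?M) = 0" for k
  proof (cases "k \<in> mi S")
    case True
    show ?thesis unfolding mix(1)[OF True]
      by (subst integrable_pair_mult(2)[OF pc \<nu>(1) o(4)[OF True True] \<nu>(2)]) (simp add: \<nu>(3))
  qed (simp add: h_def)
  have 4: "\<forall>N. \<forall>k\<in>ibox S N. (\<integral>z. (h k z)\<^sup>2 \<partial>?M) \<le> ?s"
  proof (intro allI ballI)
    fix k N assume "k \<in> ibox S N"
    then have k: "k \<in> mi S" using box_subset_mi by blast
    show "(\<integral>z. (h k z)\<^sup>2 \<partial>?M) \<le> ?s" unfolding mix(2)[OF k]
      by (subst integrable_pair_mult(2)[OF pc \<nu>(1) o(1)[OF k k] \<nu>(4)]) (simp add: o(2)[OF k k])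
  qed
  have 5: "(\<Sum>k\<in>ibox S N. 1 / w k * ?s) \<le> ?s * H" for N
    using mult_left_mono[OF H, of ?s N] by (simp add: sum_distrib_left mult.commute)
  have 6: "ibox S N \<subseteq> ibox S (Suc N)" for N by (rule box_mono) simp
  have 7: "0 \<le> 1 / w k" for k using w[of k] by simp
  have eq: "1 / w k * ((\<Sum>i<n. h k (\<omega> i)) / real n)\<^sup>2 = ((\<Sum>i<n. snd (\<omega> i) * tL S k (fst (\<omega> i))) / real n)\<^sup>2 / w k"
    if "k \<in> ibox S N" for k N \<omega>
  proof -
    have "k \<in> mi S" using that box_subset_mi by blast
    then show ?thesis by (simp add: h_def)
  qed
  have eqs: "(\<Sum>k\<in>ibox S N. 1 / w k * ((\<Sum>i<n. h k (\<omega> i)) / real n)\<^sup>2)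
     = (\<Sum>k\<in>ibox S N. ((\<Sum>i<n. snd (\<omega> i) * tL S k (fst (\<omega> i))) / real n)\<^sup>2 / w k)" for N \<omega>
    by (intro sum.cong refl eq)
  show ?thesis
    using M.empirical_squares_tail[of h "ibox S" "\<lambda>_. ?s" "\<lambda>k. 1 / w k" "?s * H" n t, OF 1 2 3 4 finite_box[OF fS] 6 7 5 n t]
    unfolding sample_space_def eqs .
qed

text \<open>The statistic is a squared Hilbert-Schmidt norm, in weighted coordinates, of the
  deviation of the Gram matrix from its expectation. The bound on its mean factorises into a sum for
  \<open>S\<close>, which carries the lost weight \<open>tw\<close>, and a sum for
  \<open>S'\<close>.\<close>

lemma gram_tail:
  assumes \<nu>: "prob_space \<nu>"
    and S: "S \<subseteq> {1..d}" "S' \<subseteq> {1..d}" and w: "\<And>k. 0 < w k" "\<And>k. 0 < w' k"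
    and H: "\<And>N. (\<Sum>k\<in>ibox S N. tw S k / w k) \<le> H" "\<And>N. (\<Sum>k\<in>ibox S' N. 1 / w' k) \<le> H'"
    and n: "0 < n" and t: "0 < t"
  shows "\<exists>A\<in>sets (sample_space d \<nu> n). measure (sample_space d \<nu> n) A \<le> 3 ^ card S * (H * H') / (real n * t)
     \<and> (\<forall>\<omega>\<in>space (sample_space d \<nu> n) - A. \<forall>N. (\<Sum>k\<in>ibox S N. \<Sum>l\<in>ibox S' N.
        ((\<Sum>i<n. tL S k (fst (\<omega> i)) * tL S' l (fst (\<omega> i))) / real n - (if S = S' \<and> k = l then 1 else 0))\<^sup>2 / (w k * w' l)) \<le> t)"
proof -
  let ?M = "unif_cube d \<Otimes>\<^sub>M \<nu>"
  have fS: "finite S" "finite S'" using S finite_subset by blast+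
  note pc = prob_space_unif_cube[of d]
  interpret C: prob_space "unif_cube d" by (rule pc)
  interpret N: prob_space \<nu> by (rule \<nu>)
  interpret M: prob_space ?M by (intro prob_space_pair pc \<nu>)
  define \<delta> :: "(nat \<Rightarrow> nat) \<times> (nat \<Rightarrow> nat) \<Rightarrow> real" where "\<delta> p = (if S = S' \<and> fst p = snd p then 1 else 0)" for p
  define h0 where "h0 p x = (if fst p \<in> mi S \<and> snd p \<in> mi S' then tL S (fst p) x * tL S' (snd p) x - \<delta> p else 0)" for p x
  define h where "h p z = h0 p (fst z)" for p and z :: "(nat \<Rightarrow> real) \<times> real"
  let ?q = "\<lambda>p. 3 ^ card S * tw S (fst p)"
  have i0: "integrable (unif_cube d) (h0 p)" for p
  proof (cases "fst p \<in> mi S \<and> snd p \<in> mi S'")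
    case True
    then show ?thesis using tL_orthonormal(1)[OF S, of "fst p" "snd p"] by (simp add: h0_def[abs_def])
  next
    case False
    then show ?thesis unfolding h0_def[abs_def] by (simp only: if_False integrable_zero)
  qed
  have sq: "(h0 p x)\<^sup>2 = (tL S (fst p) x * tL S' (snd p) x)\<^sup>2 - 2 * \<delta> p * (tL S (fst p) x * tL S' (snd p) x) + (\<delta> p)\<^sup>2"
    if "fst p \<in> mi S" "snd p \<in> mi S'" for p x
    using that by (simp add: h0_def power2_diff algebra_simps)
  have i2: "integrable (unif_cube d) (\<lambda>x. (h0 p x)\<^sup>2)" for p
  proof (cases "fst p \<in> mi S \<and> snd p \<in> mi S'")
    case True
    then show ?thesis using tL_orthonormal(1,3)[OF S, of "fst p" "snd p"] by (simp add: sq)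
  next
    case False
    then show ?thesis unfolding h0_def[abs_def] by (simp only: if_False) simp
  qed
  have m0: "(\<integral>x. h0 p x \<partial>unif_cube d) = 0" for p
  proof (cases "fst p \<in> mi S \<and> snd p \<in> mi S'")
    case True
    then show ?thesis using tL_orthonormal(1,2)[OF S, of "fst p" "snd p"] C.prob_space by (simp add: h0_def \<delta>_def)
  next
    case False
    then show ?thesis unfolding h0_def by (simp only: if_False) simp
  qed
  have m2: "(\<integral>x. (h0 p x)\<^sup>2 \<partial>unif_cube d) \<le> ?q p" if "fst p \<in> mi S" "snd p \<in> mi S'" for p
  proof -
    have "(\<integral>x. (h0 p x)\<^sup>2 \<partial>unif_cube d) = (\<integral>x. (tL S (fst p) x * tL S' (snd p) x)\<^sup>2 \<partial>unif_cube d) - 2 * \<delta> p * \<delta> p + (\<delta> p)\<^sup>2"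
      using tL_orthonormal(1,2,3)[OF S that] C.prob_space by (simp add: sq[OF that] \<delta>_def)
    also have "\<dots> \<le> (\<integral>x. (tL S (fst p) x * tL S' (snd p) x)\<^sup>2 \<partial>unif_cube d)" by (simp add: power2_eq_square)
    also have "\<dots> \<le> ?q p" by (rule tL_mult_second_moment[OF S that])
    finally show ?thesis .
  qed
  have one: "integrable \<nu> (\<lambda>_. 1 :: real)" by simp
  note pm = integrable_pair_mult[OF pc \<nu> _ one, simplified]
  have 1: "integrable ?M (h p)" for p unfolding h_def[abs_def] using pm(1)[OF i0] by simp
  have 2: "integrable ?M (\<lambda>z. (h p z)\<^sup>2)" for p unfolding h_def using pm(1)[OF i2] by simp
  have 3: "(\<integral>z. h p z \<partial>?M) = 0" for p unfolding h_def using pm(2)[OF i0] m0 N.prob_space by simp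
  have inmi: "fst p \<in> mi S" "snd p \<in> mi S'" if "p \<in> ibox S N \<times> ibox S' N" for p N
    using that subsetD[OF box_subset_mi, of "fst p" S N] subsetD[OF box_subset_mi, of "snd p" S' N]
    by (simp_all add: mem_Times_iff)
  have 4: "\<forall>N. \<forall>p\<in>ibox S N \<times> ibox S' N. (\<integral>z. (h p z)\<^sup>2 \<partial>?M) \<le> ?q p"
  proof (intro allI ballI)
    fix N p assume "p \<in> ibox S N \<times> ibox S' N"
    then have "(\<integral>x. (h0 p x)\<^sup>2 \<partial>unif_cube d) \<le> ?q p" by (intro m2 inmi)
    then show "(\<integral>z. (h p z)\<^sup>2 \<partial>?M) \<le> ?q p"
      unfolding h_def using pm(2)[OF i2, of p] N.prob_space by simp
  qed
  have 5: "(\<Sum>p\<in>ibox S N \<times> ibox S' N. 1 / (w (fst p) * w' (snd p)) * ?q p) \<le> 3 ^ card S * (H * H')" for N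
  proof -
    have "(\<Sum>p\<in>ibox S N \<times> ibox S' N. 1 / (w (fst p) * w' (snd p)) * ?q p)
       = 3 ^ card S * ((\<Sum>k\<in>ibox S N. tw S k / w k) * (\<Sum>l\<in>ibox S' N. 1 / w' l))"
    proof -
      have "(\<Sum>k\<in>ibox S N. tw S k / w k) * (\<Sum>l\<in>ibox S' N. 1 / w' l)
         = (\<Sum>p\<in>ibox S N \<times> ibox S' N. (tw S (fst p) / w (fst p)) * (1 / w' (snd p)))"
        by (simp only: sum_product sum.cartesian_product case_prod_unfold)
      then show ?thesis by (simp add: sum_distrib_left mult_ac)
    qed
    also have "\<dots> \<le> 3 ^ card S * (H * H')"
    proof (intro mult_left_mono mult_mono H)
      show "0 \<le> H" by (rule order.trans[OF sum_nonneg H(1)]) (use w tw_ge1[of S] in \<open>meson divide_nonneg_pos order.trans zero_le_one\<close>)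
      show "0 \<le> (\<Sum>l\<in>ibox S' N. 1 / w' l)" using w(2) by (intro sum_nonneg) (simp add: less_imp_le)
    qed simp
    finally show ?thesis .
  qed
  have 6: "ibox S N \<times> ibox S' N \<subseteq> ibox S (Suc N) \<times> ibox S' (Suc N)" for N
    using box_mono[of N "Suc N" S] box_mono[of N "Suc N" S'] by auto
  have 7: "0 \<le> 1 / (w (fst p) * w' (snd p))" for p using w(1)[of "fst p"] w(2)[of "snd p"] by simp
  have 8: "finite (ibox S N \<times> ibox S' N)" for N using fS by simp
  have eq: "(\<Sum>p\<in>ibox S N \<times> ibox S' N. 1 / (w (fst p) * w' (snd p)) * ((\<Sum>i<n. h p (\<omega> i)) / real n)\<^sup>2)
     = (\<Sum>k\<in>ibox S N. \<Sum>l\<in>ibox S' N.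
        ((\<Sum>i<n. tL S k (fst (\<omega> i)) * tL S' l (fst (\<omega> i))) / real n - (if S = S' \<and> k = l then 1 else 0))\<^sup>2 / (w k * w' l))" for N \<omega>
    unfolding sum.cartesian_product
  proof (intro sum.cong refl)
    fix p assume "p \<in> ibox S N \<times> ibox S' N"
    then have "(\<Sum>i<n. h p (\<omega> i)) / real n = (\<Sum>i<n. tL S (fst p) (fst (\<omega> i)) * tL S' (snd p) (fst (\<omega> i))) / real n - \<delta> p"
      using inmi n by (simp add: h_def h0_def sum_subtractf diff_divide_distrib)
    then show "1 / (w (fst p) * w' (snd p)) * ((\<Sum>i<n. h p (\<omega> i)) / real n)\<^sup>2 = (case p of (k, l) \<Rightarrow>
        ((\<Sum>i<n. tL S k (fst (\<omega> i)) * tL S' l (fst (\<omega> i))) / real n - (if S = S' \<and> k = l then 1 else 0))\<^sup>2 / (w k * w' l))"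
      by (simp add: case_prod_unfold \<delta>_def)
  qed
  show ?thesis
    using M.empirical_squares_tail[of h "\<lambda>N. ibox S N \<times> ibox S' N" ?q "\<lambda>p. 1 / (w (fst p) * w' (snd p))" "3 ^ card S * (H * H')" n t, OF 1 2 3 4 8 6 7 5 n t]
    unfolding sample_space_def eq .
qed

subsection \<open>The first order condition of the penalised least squares problem\<close>

text \<open>The number \<open>c\<close> is the value at \<open>f\<close> and \<open>g\<close> of the
  inner product behind the quadratic form \<open>JS\<close>. It enters later only through its
  Cauchy-Schwarz bound and the expansion along a line.\<close>

lemma HS_quadratic:
  assumes S: "S \<subseteq> {1..d}" and m: "1 \<le> m" and f: "f \<in> HS m d S" and g: "g \<in> HS m d S"
  shows "\<exists>c. c\<^sup>2 \<le> JS m d S f * JS m d S g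
    \<and> (\<forall>t. JS m d S (\<lambda>x. f x + t * g x) = JS m d S f + 2 * t * c + t\<^sup>2 * JS m d S g)"
proof (cases "S = {}")
  case True
  then show ?thesis by (intro exI[of _ 0]) (simp add: JS_def)
next
  case False
  obtain b b' where b: "rep m d S f b" and b': "rep m d S g b'" using HS_rep[OF S m] f g by meson
  have l: "l2 (mi S) b" "l2 (mi S) b'" using b b' by (auto simp: rep_def)
  note J = JS_rep[OF S False m f b] JS_rep[OF S False m g b']
  have "JS m d S (\<lambda>x. f x + t * g x) = JS m d S f + 2 * t * infsum (\<lambda>k. b k * b' k) (mi S) + t\<^sup>2 * JS m d S g" for t
    using JS_rep[OF S False m HS_lin[OF S m f g, of 1 t] rep_lin[OF b b', of 1 t]] l2_lin(2)[OF l, of 1 t] J by simp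
  moreover have "(infsum (\<lambda>k. b k * b' k) (mi S))\<^sup>2 \<le> JS m d S f * JS m d S g"
    unfolding J by (rule l2_CS[OF l])
  ultimately show ?thesis by blast
qed

lemma JS_nonneg:
  assumes "S \<subseteq> {1..d}" "1 \<le> m" "f \<in> HS m d S" shows "0 \<le> JS m d S f"
proof (cases "S = {}")
  case False
  obtain b where "rep m d S f b" using HS_rep[OF assms] by blast
  from JS_rep[OF assms(1) False assms(2,3) this] show ?thesis by (simp add: infsum_nonneg)
qed (simp add: JS_def)

text \<open>The penalty does not see constants, hence the separate case \<open>S = {}\<close>.\<close>

definition rw :: "nat \<Rightarrow> real \<Rightarrow> nat set \<Rightarrow> (nat \<Rightarrow> nat) \<Rightarrow> real" where
  "rw m lam S k = (if S = {} then 1 else 1 + lam * tw S k ^ (2 * m))"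

lemma rw_pos: "0 \<le> lam \<Longrightarrow> 0 < rw m lam S k"
  using tw_ge1[of S k] by (auto simp: rw_def intro!: add_pos_nonneg mult_nonneg_nonneg zero_le_power)

lemma rw_sum_nonneg:
  assumes "0 \<le> lam" shows "0 \<le> (\<Sum>l\<in>A. rw m lam S l * (c l)\<^sup>2)"
  by (intro sum_nonneg mult_nonneg_nonneg zero_le_power2 less_imp_le[OF rw_pos] assms)

text \<open>\<open>VS\<close> is a Bochner integral, hence zero if the square is not integrable, which is harmless for an upper bound.\<close>

lemma VS_le_coefficients:
  assumes S: "S \<subseteq> {1..d}" and lim: "\<And>x. x \<in> cube d \<Longrightarrow> (\<lambda>N. \<Sum>l\<in>ibox S N. c l * tL S l x) \<longlonglongrightarrow> f x"
    and D: "\<And>N. (\<Sum>l\<in>ibox S N. (c l)\<^sup>2) \<le> D"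
  shows "VS d f \<le> D"
proof (cases "integrable (unif_cube d) (\<lambda>x. (f x)\<^sup>2)")
  case False
  have "0 \<le> (\<Sum>l\<in>ibox S 0. (c l)\<^sup>2)" by (intro sum_nonneg) auto
  then have "0 \<le> D" using D[of 0] by linarith
  then show ?thesis using False by (simp add: VS_def not_integrable_integral_eq)
next
  case True
  have fS: "finite S" using S finite_subset by blast
  define g where "g N x = (\<Sum>l\<in>ibox S N. c l * tL S l x)" for N x
  have inmi: "l \<in> mi S" if "l \<in> ibox S N" for l N by (rule subsetD[OF box_subset_mi that])
  have gsq: "(g N x)\<^sup>2 = (\<Sum>k\<in>ibox S N. \<Sum>l\<in>ibox S N. c k * c l * (tL S k x * tL S l x))" for N x
    unfolding g_def power2_eq_square sum_product by (intro sum.cong refl) (simp add: mult_ac)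
  have gi: "integrable (unif_cube d) (\<lambda>x. (g N x)\<^sup>2)" for N
    unfolding gsq by (intro Bochner_Integration.integrable_sum integrable_mult_right tL_orthonormal(1)[OF S S] inmi)
  have gI: "(\<integral>x. (g N x)\<^sup>2 \<partial>unif_cube d) \<le> D" for N
  proof -
    have "(\<integral>x. (g N x)\<^sup>2 \<partial>unif_cube d) = (\<Sum>k\<in>ibox S N. \<integral>x. (\<Sum>l\<in>ibox S N. c k * c l * (tL S k x * tL S l x)) \<partial>unif_cube d)"
      unfolding gsq
      by (intro Bochner_Integration.integral_sum Bochner_Integration.integrable_sum integrable_mult_right tL_orthonormal(1)[OF S S] inmi)
    also have "\<dots> = (\<Sum>k\<in>ibox S N. \<Sum>l\<in>ibox S N. \<integral>x. c k * c l * (tL S k x * tL S l x) \<partial>unif_cube d)"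
      by (intro sum.cong refl Bochner_Integration.integral_sum integrable_mult_right tL_orthonormal(1)[OF S S] inmi)
    also have "\<dots> = (\<Sum>k\<in>ibox S N. \<Sum>l\<in>ibox S N. if k = l then c k * c l else 0)"
    proof (intro sum.cong refl)
      fix k l assume "k \<in> ibox S N" "l \<in> ibox S N"
      then show "(\<integral>x. c k * c l * (tL S k x * tL S l x) \<partial>unif_cube d) = (if k = l then c k * c l else 0)"
        using tL_orthonormal(2)[OF S S inmi inmi, of k N l N] by simp
    qed
    also have "\<dots> = (\<Sum>k\<in>ibox S N. (c k)\<^sup>2)" using fS by (simp add: power2_eq_square)
    finally show ?thesis using D by simp
  qed
  have [measurable]: "(\<lambda>x. (g N x)\<^sup>2) \<in> borel_measurable (unif_cube d)" for N
    using gi by (rule borel_measurable_integrable)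
  have "ennreal (VS d f) = (\<integral>\<^sup>+x. ennreal ((f x)\<^sup>2) \<partial>unif_cube d)"
    unfolding VS_def using True by (intro nn_integral_eq_integral[symmetric]) auto
  \<comment> \<open>The partial sums converge pointwise on the cube, and Fatou's lemma gives the
    upper bound.\<close>
  also have "\<dots> = (\<integral>\<^sup>+x. liminf (\<lambda>N. ennreal ((g N x)\<^sup>2)) \<partial>unif_cube d)"
  proof (rule nn_integral_cong_AE, use AE_unif_cube in eventually_elim)
    fix x assume "x \<in> cube d"
    then have "(\<lambda>N. ennreal ((g N x)\<^sup>2)) \<longlonglongrightarrow> ennreal ((f x)\<^sup>2)"
      using lim unfolding g_def by (intro tendsto_intros) auto
    then show "ennreal ((f x)\<^sup>2) = liminf (\<lambda>N. ennreal ((g N x)\<^sup>2))"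
      using lim_imp_Liminf trivial_limit_sequentially by metis
  qed
  also have "\<dots> \<le> liminf (\<lambda>N. \<integral>\<^sup>+x. ennreal ((g N x)\<^sup>2) \<partial>unif_cube d)"
    by (rule nn_integral_liminf) measurable
  also have "\<dots> \<le> liminf (\<lambda>N. ennreal D)"
  proof (rule Liminf_mono, rule always_eventually, rule allI)
    fix N
    have "(\<integral>\<^sup>+x. ennreal ((g N x)\<^sup>2) \<partial>unif_cube d) = ennreal (\<integral>x. (g N x)\<^sup>2 \<partial>unif_cube d)"
      using gi by (intro nn_integral_eq_integral) auto
    then show "(\<integral>\<^sup>+x. ennreal ((g N x)\<^sup>2) \<partial>unif_cube d) \<le> ennreal D" using gI by (simp add: ennreal_leI)
  qed
  also have "\<dots> = ennreal D" by (simp add: Liminf_const)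
  finally have "ennreal (VS d f) \<le> ennreal D" .
  moreover have "0 \<le> D" by (rule order.trans[OF _ gI[of 0]]) simp
  ultimately show ?thesis by simp
qed

text \<open>The limit \<open>D\<close> of the sums of squared coefficients takes the place of
  \<open>VS\<close>: empirical inner products are compared with it, and it dominates
  \<open>VS\<close>. The constant \<open>CU m ^ d\<close> serves all components at once.\<close>

lemma HS_coefficients:
  assumes S: "S \<subseteq> {1..d}" and m: "2 \<le> m" and f: "f \<in> HS m d S"
  shows "\<exists>c D. (\<lambda>N. \<Sum>l\<in>ibox S N. (c l)\<^sup>2) \<longlonglongrightarrow> D \<and> VS d f \<le> D \<and> 0 \<le> D
    \<and> (\<forall>N lam. 0 \<le> lam \<longrightarrow> (\<Sum>l\<in>ibox S N. rw m lam S l * (c l)\<^sup>2) \<le> CU m ^ d * (D + lam * JS m d S f))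
    \<and> (\<forall>x\<in>cube d. (\<lambda>N. \<Sum>l\<in>ibox S N. c l * tL S l x) \<longlonglongrightarrow> f x)"
proof -
  have m1: "1 \<le> m" using m by simp
  have fS: "finite S" using S finite_subset by blast
  have cS: "card S \<le> d" using card_mono[OF _ S] by simp
  have C1: "1 \<le> CU m ^ d" using CU_pos by (rule one_le_power)
  have C0: "0 \<le> CU m ^ d" using C1 by linarith
  obtain b where b: "rep m d S f b" using HS_rep[OF S m1 f] by blast
  let ?B = "infsum (\<lambda>k. (b k)\<^sup>2) (mi S)"
  have B0: "0 \<le> ?B" by (rule infsum_nonneg) simp
  obtain c where c: "\<And>N. (\<Sum>l\<in>ibox S N. tw S l ^ (2 * m) * (c l)\<^sup>2) \<le> CU m ^ card S * ?B"
    and lim: "\<And>x. x \<in> cube d \<Longrightarrow> (\<lambda>N. \<Sum>l\<in>ibox S N. c l * tL S l x) \<longlonglongrightarrow> f x"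
    using rep_Legendre[OF S m b] by blast
  have cd: "(\<Sum>l\<in>ibox S N. tw S l ^ (2 * m) * (c l)\<^sup>2) \<le> CU m ^ d * ?B" for N
    by (rule order.trans[OF c]) (intro mult_right_mono power_increasing cS CU_pos B0)
  define q where "q N = (\<Sum>l\<in>ibox S N. (c l)\<^sup>2)" for N
  have qb: "q N \<le> CU m ^ d * ?B" for N
  proof -
    have "q N \<le> (\<Sum>l\<in>ibox S N. tw S l ^ (2 * m) * (c l)\<^sup>2)"
      unfolding q_def using mult_right_mono[OF one_le_power[OF tw_ge1]] by (intro sum_mono) fastforce
    then show ?thesis using cd[of N] by linarith
  qed
  have "incseq q" unfolding q_def using fS box_mono by (intro incseq_SucI sum_mono2) auto
  then obtain D where D: "q \<longlonglongrightarrow> D" and qD: "\<And>N. q N \<le> D"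
    using incseq_convergent[of q "CU m ^ d * ?B"] qb by blast
  have D0: "0 \<le> D" by (rule order.trans[OF _ qD[of 0]]) (simp add: q_def sum_nonneg)
  have V: "VS d f \<le> D" by (rule VS_le_coefficients[OF S lim]) (use qD in \<open>simp_all add: q_def\<close>)
  have W: "(\<Sum>l\<in>ibox S N. rw m lam S l * (c l)\<^sup>2) \<le> CU m ^ d * (D + lam * JS m d S f)" if "0 \<le> lam" for N lam
  proof (cases "S = {}")
    case True
    have "(\<Sum>l\<in>ibox S N. rw m lam S l * (c l)\<^sup>2) = q N" by (simp add: rw_def q_def True)
    also have "\<dots> \<le> 1 * D" using qD by simp
    also have "\<dots> \<le> CU m ^ d * D" by (intro mult_right_mono C1 D0)
    finally show ?thesis using True by (simp add: JS_def)
  next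
    case False
    have "(\<Sum>l\<in>ibox S N. rw m lam S l * (c l)\<^sup>2) = q N + lam * (\<Sum>l\<in>ibox S N. tw S l ^ (2 * m) * (c l)\<^sup>2)"
      by (simp add: rw_def q_def False algebra_simps sum.distrib sum_distrib_left)
    also have "\<dots> \<le> CU m ^ d * D + lam * (CU m ^ d * ?B)"
    proof (rule add_mono)
      show "q N \<le> CU m ^ d * D" using qD[of N] mult_right_mono[OF C1 D0] by simp
      show "lam * (\<Sum>l\<in>ibox S N. tw S l ^ (2 * m) * (c l)\<^sup>2) \<le> lam * (CU m ^ d * ?B)"
        by (rule mult_left_mono[OF cd that])
    qed
    also have "\<dots> = CU m ^ d * (D + lam * JS m d S f)"
      unfolding JS_rep[OF S False m1 f b] by (simp add: algebra_simps)
    finally show ?thesis .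
  qed
  show ?thesis using D V D0 W lim unfolding q_def by blast
qed

section \<open>Dual norms of the noise and of the Gram matrix error\<close>

lemma sum_CS_weighted:
  fixes a b w :: "'k \<Rightarrow> real"
  assumes "\<And>k. k \<in> A \<Longrightarrow> 0 < w k"
  shows "(\<Sum>k\<in>A. a k * b k)\<^sup>2 \<le> (\<Sum>k\<in>A. w k * (a k)\<^sup>2) * (\<Sum>k\<in>A. (b k)\<^sup>2 / w k)"
proof -
  have "(\<Sum>k\<in>A. a k * b k) = (\<Sum>k\<in>A. (sqrt (w k) * a k) * (b k / sqrt (w k)))"
  proof (intro sum.cong refl)
    fix k assume "k \<in> A"
    then have "sqrt (w k) \<noteq> 0" using assms[of k] by simp
    then show "a k * b k = (sqrt (w k) * a k) * (b k / sqrt (w k))" by simp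
  qed
  then have "(\<Sum>k\<in>A. a k * b k)\<^sup>2 \<le> (\<Sum>k\<in>A. (sqrt (w k) * a k)\<^sup>2) * (\<Sum>k\<in>A. (b k / sqrt (w k))\<^sup>2)"
    using Cauchy_Schwarz_ineq_sum by metis
  also have "(\<Sum>k\<in>A. (sqrt (w k) * a k)\<^sup>2) = (\<Sum>k\<in>A. w k * (a k)\<^sup>2)"
    using assms by (intro sum.cong refl) (simp add: power_mult_distrib less_imp_le)
  also have "(\<Sum>k\<in>A. (b k / sqrt (w k))\<^sup>2) = (\<Sum>k\<in>A. (b k)\<^sup>2 / w k)"
    using assms by (intro sum.cong refl) (simp add: power_divide less_imp_le)
  finally show ?thesis .
qed

text \<open>The squared dual norm of the noise functional with respect to the weights
  \<open>rw\<close>, truncated to a box. Bounds uniform in \<open>N\<close> replace the infinite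
  sum.\<close>

definition noise_stat :: "nat \<Rightarrow> nat set \<Rightarrow> nat \<Rightarrow> (nat \<Rightarrow> nat \<Rightarrow> real) \<Rightarrow> (nat \<Rightarrow> real) \<Rightarrow> real \<Rightarrow> nat \<Rightarrow> real" where
  "noise_stat m S n X eps lam N = (\<Sum>k\<in>ibox S N. ((\<Sum>i<n. eps i * tL S k (X i)) / real n)\<^sup>2 / rw m lam S k)"

definition gram_stat :: "nat \<Rightarrow> nat set \<Rightarrow> nat set \<Rightarrow> nat \<Rightarrow> (nat \<Rightarrow> nat \<Rightarrow> real) \<Rightarrow> real \<Rightarrow> nat \<Rightarrow> real" where
  "gram_stat m S S' n X lam N = (\<Sum>k\<in>ibox S N. \<Sum>l\<in>ibox S' N.
     ((\<Sum>i<n. tL S k (X i) * tL S' l (X i)) / real n - (if S = S' \<and> k = l then 1 else 0))\<^sup>2 / (rw m lam S k * rw m lam S' l))"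

lemma noise_bound:
  assumes lam: "0 \<le> lam" and n: "0 < n" and X: "\<And>i. i < n \<Longrightarrow> X i \<in> cube d"
    and c: "\<And>N. (\<Sum>l\<in>ibox S N. rw m lam S l * (c l)\<^sup>2) \<le> E"
    and lim: "\<And>x. x \<in> cube d \<Longrightarrow> (\<lambda>N. \<Sum>l\<in>ibox S N. c l * tL S l x) \<longlonglongrightarrow> f x"
    and T: "\<And>N. noise_stat m S n X eps lam N \<le> T"
  shows "((\<Sum>i<n. eps i * f (X i)) / real n)\<^sup>2 \<le> E * T"
proof -
  define g where "g N = (\<Sum>k\<in>ibox S N. c k * ((\<Sum>i<n. eps i * tL S k (X i)) / real n))" for N
  have g: "g N = (\<Sum>i<n. eps i * (\<Sum>k\<in>ibox S N. c k * tL S k (X i))) / real n" for N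
  proof -
    have "g N = (\<Sum>k\<in>ibox S N. \<Sum>i<n. eps i * (c k * tL S k (X i))) / real n"
      by (simp add: g_def sum_distrib_left sum_divide_distrib mult.left_commute)
    then show ?thesis by (subst (asm) sum.swap) (simp add: sum_distrib_left)
  qed
  have "(\<lambda>N. g N) \<longlonglongrightarrow> (\<Sum>i<n. eps i * f (X i)) / real n"
    unfolding g by (intro tendsto_intros lim X) (use n in auto)
  then have "(\<lambda>N. (g N)\<^sup>2) \<longlonglongrightarrow> ((\<Sum>i<n. eps i * f (X i)) / real n)\<^sup>2" by (intro tendsto_intros)
  moreover have "(g N)\<^sup>2 \<le> E * T" for N
  proof -
    have "(g N)\<^sup>2 \<le> (\<Sum>l\<in>ibox S N. rw m lam S l * (c l)\<^sup>2) * noise_stat m S n X eps lam N"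
      unfolding g_def noise_stat_def by (rule sum_CS_weighted) (rule rw_pos[OF lam])
    also have "\<dots> \<le> E * T"
    proof (rule mult_mono[OF c T])
      show "0 \<le> E" by (rule order.trans[OF _ c[of 0]]) (rule rw_sum_nonneg[OF lam])
      show "0 \<le> noise_stat m S n X eps lam N"
        unfolding noise_stat_def by (intro sum_nonneg divide_nonneg_pos rw_pos lam; simp)
    qed
    finally show ?thesis .
  qed
  ultimately show ?thesis by (intro LIMSEQ_le_const2) auto
qed

text \<open>Cauchy-Schwarz inequality over pairs of indices, then the limit over boxes. For
  \<open>S = S'\<close> the expected part is a sum of squared coefficients, hence the condition that
  \<open>c'\<close> and \<open>c\<close> agree.\<close>

lemma gram_bound:
  assumes lam: "0 \<le> lam" and n: "0 < n" and X: "\<And>i. i < n \<Longrightarrow> X i \<in> cube d" and fS: "finite S"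
    and c: "\<And>N. (\<Sum>l\<in>ibox S N. rw m lam S l * (c l)\<^sup>2) \<le> E"
    and c': "\<And>N. (\<Sum>l\<in>ibox S' N. rw m lam S' l * (c' l)\<^sup>2) \<le> E'"
    and lim: "\<And>x. x \<in> cube d \<Longrightarrow> (\<lambda>N. \<Sum>l\<in>ibox S N. c l * tL S l x) \<longlonglongrightarrow> f x"
    and lim': "\<And>x. x \<in> cube d \<Longrightarrow> (\<lambda>N. \<Sum>l\<in>ibox S' N. c' l * tL S' l x) \<longlonglongrightarrow> f' x"
    and D: "(\<lambda>N. \<Sum>l\<in>ibox S N. (c l)\<^sup>2) \<longlonglongrightarrow> D" and eq: "S = S' \<Longrightarrow> c' = c"
    and T: "\<And>N. gram_stat m S S' n X lam N \<le> T"
  shows "((\<Sum>i<n. f (X i) * f' (X i)) / real n - (if S = S' then D else 0))\<^sup>2 \<le> E * E' * T"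
proof -
  let ?\<delta> = "\<lambda>k l. if S = S' \<and> k = l then 1 else 0 :: real"
  let ?g = "\<lambda>N x. \<Sum>k\<in>ibox S N. c k * tL S k x" and ?g' = "\<lambda>N x. \<Sum>k\<in>ibox S' N. c' k * tL S' k x"
  let ?P = "\<lambda>k l. (\<Sum>i<n. tL S k (X i) * tL S' l (X i)) / real n"
  define h where "h N = (\<Sum>k\<in>ibox S N. \<Sum>l\<in>ibox S' N. (c k * c' l) * (?P k l - ?\<delta> k l))" for N
  have h: "h N = (\<Sum>i<n. ?g N (X i) * ?g' N (X i)) / real n - (if S = S' then \<Sum>l\<in>ibox S N. (c l)\<^sup>2 else 0)" for N
  proof -
    have "h N = (\<Sum>k\<in>ibox S N. \<Sum>l\<in>ibox S' N. (c k * c' l) * ?P k l) - (\<Sum>k\<in>ibox S N. \<Sum>l\<in>ibox S' N. (c k * c' l) * ?\<delta> k l)"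
      by (simp only: h_def right_diff_distrib sum_subtractf)
    also have "(\<Sum>k\<in>ibox S N. \<Sum>l\<in>ibox S' N. (c k * c' l) * ?\<delta> k l) = (if S = S' then \<Sum>l\<in>ibox S N. (c l)\<^sup>2 else 0)"
    proof (cases "S = S'")
      case True
      have "(\<Sum>k\<in>ibox S N. \<Sum>l\<in>ibox S' N. (c k * c' l) * ?\<delta> k l) = (\<Sum>k\<in>ibox S N. \<Sum>l\<in>ibox S N. if k = l then c k * c l else 0)"
        using True eq by (intro sum.cong) auto
      also have "\<dots> = (\<Sum>k\<in>ibox S N. (c k)\<^sup>2)" using fS by (simp add: power2_eq_square)
      finally show ?thesis using True by simp
    qed simp
    also have "(\<Sum>k\<in>ibox S N. \<Sum>l\<in>ibox S' N. (c k * c' l) * ?P k l) = (\<Sum>i<n. ?g N (X i) * ?g' N (X i)) / real n"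
    proof -
      have "(\<Sum>k\<in>ibox S N. \<Sum>l\<in>ibox S' N. (c k * c' l) * ?P k l)
        = (\<Sum>k\<in>ibox S N. \<Sum>l\<in>ibox S' N. \<Sum>i<n. (c k * tL S k (X i)) * (c' l * tL S' l (X i)) / real n)"
        by (intro sum.cong refl) (simp add: sum_distrib_left sum_divide_distrib mult_ac)
      also have "\<dots> = (\<Sum>k\<in>ibox S N. \<Sum>i<n. \<Sum>l\<in>ibox S' N. (c k * tL S k (X i)) * (c' l * tL S' l (X i)) / real n)"
        by (intro sum.cong refl sum.swap)
      also have "\<dots> = (\<Sum>i<n. \<Sum>k\<in>ibox S N. \<Sum>l\<in>ibox S' N. (c k * tL S k (X i)) * (c' l * tL S' l (X i)) / real n)"
        by (rule sum.swap)
      also have "\<dots> = (\<Sum>i<n. ?g N (X i) * ?g' N (X i)) / real n"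
        unfolding sum_product by (simp only: sum_divide_distrib)
      finally show ?thesis .
    qed
    finally show ?thesis .
  qed
  have "h \<longlonglongrightarrow> (\<Sum>i<n. f (X i) * f' (X i)) / real n - (if S = S' then D else 0)"
    unfolding h
  proof (intro tendsto_intros lim lim' X)
    show "(\<lambda>N. if S = S' then \<Sum>l\<in>ibox S N. (c l)\<^sup>2 else 0) \<longlonglongrightarrow> (if S = S' then D else 0)"
      by (cases "S = S'") (use D in auto)
  qed (use n in auto)
  then have "(\<lambda>N. (h N)\<^sup>2) \<longlonglongrightarrow> ((\<Sum>i<n. f (X i) * f' (X i)) / real n - (if S = S' then D else 0))\<^sup>2" by (intro tendsto_intros)
  moreover have "(h N)\<^sup>2 \<le> E * E' * T" for N
  proof -
    let ?A = "ibox S N \<times> ibox S' N"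
    have "h N = (\<Sum>p\<in>?A. (c (fst p) * c' (snd p)) * (?P (fst p) (snd p) - ?\<delta> (fst p) (snd p)))"
      unfolding h_def sum.cartesian_product case_prod_unfold ..
    then have "(h N)\<^sup>2 \<le> (\<Sum>p\<in>?A. (rw m lam S (fst p) * rw m lam S' (snd p)) * (c (fst p) * c' (snd p))\<^sup>2)
        * (\<Sum>p\<in>?A. (?P (fst p) (snd p) - ?\<delta> (fst p) (snd p))\<^sup>2 / (rw m lam S (fst p) * rw m lam S' (snd p)))"
      using sum_CS_weighted[of ?A "\<lambda>p. rw m lam S (fst p) * rw m lam S' (snd p)" "\<lambda>p. c (fst p) * c' (snd p)"
          "\<lambda>p. ?P (fst p) (snd p) - ?\<delta> (fst p) (snd p)"] rw_pos[OF lam] by simp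
    also have "(\<Sum>p\<in>?A. (rw m lam S (fst p) * rw m lam S' (snd p)) * (c (fst p) * c' (snd p))\<^sup>2)
        = (\<Sum>l\<in>ibox S N. rw m lam S l * (c l)\<^sup>2) * (\<Sum>l\<in>ibox S' N. rw m lam S' l * (c' l)\<^sup>2)"
      unfolding sum_product sum.cartesian_product case_prod_unfold
      by (intro sum.cong refl) (simp add: power_mult_distrib mult_ac)
    also have "(\<Sum>p\<in>?A. (?P (fst p) (snd p) - ?\<delta> (fst p) (snd p))\<^sup>2 / (rw m lam S (fst p) * rw m lam S' (snd p)))
        = gram_stat m S S' n X lam N"
      unfolding gram_stat_def sum.cartesian_product case_prod_unfold ..
    also have "(\<Sum>l\<in>ibox S N. rw m lam S l * (c l)\<^sup>2) * (\<Sum>l\<in>ibox S' N. rw m lam S' l * (c' l)\<^sup>2) * gram_stat m S S' n X lam N \<le> E * E' * T"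
    proof (intro mult_mono c c' T)
      show E: "0 \<le> E" by (rule order.trans[OF _ c[of 0]]) (rule rw_sum_nonneg[OF lam])
      have "0 \<le> E'" by (rule order.trans[OF _ c'[of 0]]) (rule rw_sum_nonneg[OF lam])
      then show "0 \<le> E * E'" using E by simp
      show "0 \<le> (\<Sum>l\<in>ibox S' N. rw m lam S' l * (c' l)\<^sup>2)"
        by (rule rw_sum_nonneg[OF lam])
      show "0 \<le> gram_stat m S S' n X lam N"
        unfolding gram_stat_def by (intro sum_nonneg divide_nonneg_pos mult_pos_pos rw_pos lam; simp)
    qed
    finally show ?thesis .
  qed
  ultimately show ?thesis by (intro LIMSEQ_le_const2) auto
qed

text \<open>The minimality of the estimator in the direction of its own \<open>S\<close>-component of the error gives one
  equation per component; the empirical inner products are then compared with their expectations, for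
  which the components are orthogonal.\<close>

lemma pls_stationary:
  assumes SS: "finite SS" "S \<in> SS" "S \<subseteq> {1..d}" and m: "1 \<le> m" and n: "0 < n"
    and min: "is_pls_min m d SS n X (\<lambda>i. (\<Sum>S\<in>SS. fstar S (X i)) + eps i) lam fam"
    and fstar: "fstar S \<in> HS m d S"
  defines "\<delta> \<equiv> \<lambda>S x. fam S x - fstar S x"
  shows "\<exists>c. c\<^sup>2 \<le> JS m d S (fstar S) * JS m d S (\<delta> S) \<and>
     (\<Sum>i<n. (eps i - (\<Sum>S\<in>SS. \<delta> S (X i))) * \<delta> S (X i)) / real n = lam * (c + JS m d S (\<delta> S))"
proof -
  have fam: "\<forall>S\<in>SS. fam S \<in> HS m d S" using min by (simp add: is_pls_min_def)
  have \<delta>H: "\<delta> S \<in> HS m d S"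
    using HS_lin[OF SS(3) m fam[rule_format, OF SS(2)] fstar, of 1 "-1"] by (simp add: \<delta>_def)
  obtain c where c: "c\<^sup>2 \<le> JS m d S (fstar S) * JS m d S (\<delta> S)"
    and q: "\<And>t. JS m d S (\<lambda>x. fstar S x + t * \<delta> S x) = JS m d S (fstar S) + 2 * t * c + t\<^sup>2 * JS m d S (\<delta> S)"
    using HS_quadratic[OF SS(3) m fstar \<delta>H] by blast
  define r where "r i = eps i - (\<Sum>S\<in>SS. \<delta> S (X i))" for i
  define p where "p = lam * (c + JS m d S (\<delta> S)) - (\<Sum>i<n. r i * \<delta> S (X i)) / real n"
  define a where "a = (\<Sum>i<n. (\<delta> S (X i))\<^sup>2) / (2 * real n) + lam / 2 * JS m d S (\<delta> S)"
  have key: "0 \<le> t * p + t\<^sup>2 * a" for t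
  proof -
    define fam' where "fam' = fam(S := \<lambda>x. fam S x + t * \<delta> S x)"
    have "fam' S' \<in> HS m d S'" if "S' \<in> SS" for S'
      using fam that HS_lin[OF SS(3) m fam[rule_format, OF SS(2)] \<delta>H, of 1 t] by (simp add: fam'_def)
    then have le: "pls_obj m d SS n X (\<lambda>i. (\<Sum>S\<in>SS. fstar S (X i)) + eps i) lam fam
        \<le> pls_obj m d SS n X (\<lambda>i. (\<Sum>S\<in>SS. fstar S (X i)) + eps i) lam fam'"
      using min by (simp add: is_pls_min_def)
    have res: "((\<Sum>S\<in>SS. fstar S (X i)) + eps i) - (\<Sum>S\<in>SS. fam S (X i)) = r i" for i
      by (simp add: r_def \<delta>_def sum_subtractf)
    have sf': "(\<Sum>S\<in>SS. fam' S (X i)) = (\<Sum>S\<in>SS. fam S (X i)) + t * \<delta> S (X i)" for i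
      using SS by (simp add: fam'_def sum.remove[of SS S])
    have res': "((\<Sum>S\<in>SS. fstar S (X i)) + eps i) - (\<Sum>S\<in>SS. fam' S (X i)) = r i - t * \<delta> S (X i)" for i
      using res[of i] unfolding sf' by linarith
    \<comment> \<open>Both penalties are expanded around \<open>fstar S\<close> rather than around
      the estimate, so that \<open>c\<close> pairs \<open>fstar S\<close> with the error.\<close>
    have "(\<lambda>x. fam S x + t * \<delta> S x) = (\<lambda>x. fstar S x + (1 + t) * \<delta> S x)" "fam S = (\<lambda>x. fstar S x + 1 * \<delta> S x)"
      by (auto simp: \<delta>_def algebra_simps)
    then have Jd: "JS m d S (\<lambda>x. fam S x + t * \<delta> S x) = JS m d S (fam S) + 2 * t * c + (2 * t + t\<^sup>2) * JS m d S (\<delta> S)"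
      using q[of "1 + t"] q[of 1] by (simp add: power2_eq_square algebra_simps)
    have J': "(\<Sum>S\<in>SS. JS m d S (fam' S)) = (\<Sum>S\<in>SS. JS m d S (fam S)) + (2 * t * c + (2 * t + t\<^sup>2) * JS m d S (\<delta> S))"
      using SS Jd by (simp add: fam'_def sum.remove[of SS S])
    have sq: "(\<Sum>i<n. (r i - t * \<delta> S (X i))\<^sup>2) = (\<Sum>i<n. (r i)\<^sup>2) - 2 * t * (\<Sum>i<n. r i * \<delta> S (X i)) + t\<^sup>2 * (\<Sum>i<n. (\<delta> S (X i))\<^sup>2)"
      by (simp add: power2_diff power_mult_distrib sum.distrib sum_subtractf sum_distrib_left mult_ac)
    have "0 \<le> (- 2 * t * (\<Sum>i<n. r i * \<delta> S (X i)) + t\<^sup>2 * (\<Sum>i<n. (\<delta> S (X i))\<^sup>2)) / (2 * real n)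
        + lam / 2 * (2 * t * c + (2 * t + t\<^sup>2) * JS m d S (\<delta> S))"
      using le unfolding pls_obj_def res res' sq J' by (simp add: add_divide_distrib diff_divide_distrib algebra_simps)
    also have "\<dots> = t * p + t\<^sup>2 * a"
      using n unfolding p_def a_def by (simp add: field_simps)
    finally show ?thesis .
  qed
  have a0: "0 \<le> a" using key[of 1] key[of "-1"] by simp
  \<comment> \<open>A nonnegative quadratic without constant term has no linear term either.\<close>
  have "(p / 2)\<^sup>2 \<le> 0 * a"
    by (rule quadratic_nonneg_discriminant[OF _ a0]) (use key in simp)
  then have "p = 0" by simp
  then show ?thesis using c unfolding p_def r_def by auto
qed

section \<open>The deterministic error inequality\<close>

lemma pls_core:
  assumes SS: "finite SS" "\<And>S. S \<in> SS \<Longrightarrow> S \<subseteq> {1..d}" and m: "2 \<le> m" and n: "0 < n" and lam: "0 < lam"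
    and X: "\<And>i. i < n \<Longrightarrow> X i \<in> cube d"
    and fstar: "\<And>S. S \<in> SS \<Longrightarrow> fstar S \<in> HS m d S"
    and min: "is_pls_min m d SS n X (\<lambda>i. (\<Sum>S\<in>SS. fstar S (X i)) + eps i) lam fam"
    and T: "\<And>S N. S \<in> SS \<Longrightarrow> noise_stat m S n X eps lam N \<le> (T S)\<^sup>2" "\<And>S. S \<in> SS \<Longrightarrow> 0 \<le> T S"
    and B: "\<And>S S' N. S \<in> SS \<Longrightarrow> S' \<in> SS \<Longrightarrow> gram_stat m S S' n X lam N \<le> B\<^sup>2" "0 \<le> B"
  shows "\<exists>e. \<forall>S\<in>SS. 0 \<le> e S \<and> Snorm m d lam S (\<lambda>x. fam S x - fstar S x) \<le> e S
     \<and> e S \<le> CU m ^ d * T S + sqrt lam * sqrt (JS m d S (fstar S)) + CU m ^ d * B * (\<Sum>S'\<in>SS. e S')"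
proof -
  have m1: "1 \<le> m" using m by simp
  have lam0: "0 \<le> lam" using lam by simp
  let ?K = "CU m ^ d"
  have K1: "1 \<le> ?K" using CU_pos by (rule one_le_power)
  have K0: "0 \<le> ?K" using K1 by linarith
  define \<delta> where "\<delta> S x = fam S x - fstar S x" for S x
  have fam: "fam S \<in> HS m d S" if "S \<in> SS" for S using min that by (simp add: is_pls_min_def)
  have \<delta>H: "\<delta> S \<in> HS m d S" if "S \<in> SS" for S
    using HS_lin[OF SS(2)[OF that] m1 fam[OF that] fstar[OF that], of 1 "-1"] by (simp add: \<delta>_def[abs_def])
  define Pr where "Pr S c D \<longleftrightarrow> (\<lambda>N. \<Sum>l\<in>ibox S N. (c l)\<^sup>2) \<longlonglongrightarrow> D \<and> VS d (\<delta> S) \<le> D \<and> 0 \<le> D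
    \<and> (\<forall>N lam. 0 \<le> lam \<longrightarrow> (\<Sum>l\<in>ibox S N. rw m lam S l * (c l)\<^sup>2) \<le> ?K * (D + lam * JS m d S (\<delta> S)))
    \<and> (\<forall>x\<in>cube d. (\<lambda>N. \<Sum>l\<in>ibox S N. c l * tL S l x) \<longlonglongrightarrow> \<delta> S x)" for S c D
  have "\<forall>S\<in>SS. \<exists>c D. Pr S c D"
    unfolding Pr_def using HS_coefficients[OF SS(2) m \<delta>H] by blast
  then obtain c D where Pr: "\<And>S. S \<in> SS \<Longrightarrow> Pr S (c S) (D S)" by metis
  have cD: "(\<lambda>N. \<Sum>l\<in>ibox S N. (c S l)\<^sup>2) \<longlonglongrightarrow> D S" "VS d (\<delta> S) \<le> D S" "0 \<le> D S"
      "0 \<le> lam \<Longrightarrow> (\<Sum>l\<in>ibox S N. rw m lam S l * (c S l)\<^sup>2) \<le> ?K * (D S + lam * JS m d S (\<delta> S))"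
      "x \<in> cube d \<Longrightarrow> (\<lambda>N. \<Sum>l\<in>ibox S N. c S l * tL S l x) \<longlonglongrightarrow> \<delta> S x" if "S \<in> SS" for S N lam x
    using Pr[OF that] by (auto simp: Pr_def)
  have J0: "0 \<le> JS m d S (\<delta> S)" "0 \<le> JS m d S (fstar S)" if "S \<in> SS" for S
    using JS_nonneg[OF SS(2)[OF that] m1] \<delta>H[OF that] fstar[OF that] by auto
  \<comment> \<open>With \<open>D S\<close> in place of \<open>VS\<close>, because the comparison of
    the Gram matrices produces \<open>D S\<close>; the inequality between the two transfers the
    result to \<open>Snorm\<close>.\<close>
  define e where "e S = sqrt (D S + lam * JS m d S (\<delta> S))" for S
  have e0: "0 \<le> e S" if "S \<in> SS" for S
    unfolding e_def using cD(3) J0 that lam0 by simp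
  have e2: "(e S)\<^sup>2 = D S + lam * JS m d S (\<delta> S)" if "S \<in> SS" for S
    unfolding e_def using cD(3) J0 that lam0 by simp
  have W: "(\<Sum>l\<in>ibox S N. rw m lam S l * (c S l)\<^sup>2) \<le> ?K * (e S)\<^sup>2" if "S \<in> SS" for S N
    using cD(4)[OF that lam0] e2[OF that] by simp
  have main: "e S \<le> ?K * T S + sqrt lam * sqrt (JS m d S (fstar S)) + ?K * B * (\<Sum>S'\<in>SS. e S')" if S: "S \<in> SS" for S
  proof -
    define G where "G S' = (\<Sum>i<n. \<delta> S (X i) * \<delta> S' (X i)) / real n" for S'
    define Nz where "Nz = (\<Sum>i<n. eps i * \<delta> S (X i)) / real n"
    let ?R = "?K * T S + sqrt lam * sqrt (JS m d S (fstar S)) + ?K * B * (\<Sum>S'\<in>SS. e S')"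
    obtain cr where cr: "cr\<^sup>2 \<le> JS m d S (fstar S) * JS m d S (\<delta> S)"
      and st: "(\<Sum>i<n. (eps i - (\<Sum>S\<in>SS. \<delta> S (X i))) * \<delta> S (X i)) / real n = lam * (cr + JS m d S (\<delta> S))"
      using pls_stationary[OF SS(1) S SS(2)[OF S] m1 n min fstar[OF S]] unfolding \<delta>_def by blast
    have "(\<Sum>i<n. (eps i - (\<Sum>S\<in>SS. \<delta> S (X i))) * \<delta> S (X i)) / real n = Nz - (\<Sum>S'\<in>SS. G S')"
    proof -
      have "(\<Sum>S'\<in>SS. G S') = (\<Sum>i<n. \<Sum>S'\<in>SS. \<delta> S (X i) * \<delta> S' (X i)) / real n"
        unfolding G_def sum_divide_distrib[symmetric] by (subst sum.swap) simp
      also have "\<dots> = (\<Sum>i<n. (\<Sum>S\<in>SS. \<delta> S (X i)) * \<delta> S (X i)) / real n"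
        unfolding sum_distrib_left[symmetric]
        by (intro arg_cong2[where f = "(/)"] sum.cong refl mult.commute)
      finally show ?thesis
        by (simp add: Nz_def left_diff_distrib sum_subtractf diff_divide_distrib)
    qed
    then have eq: "Nz - (\<Sum>S'\<in>SS. G S') = lam * (cr + JS m d S (\<delta> S))" using st by simp
    have b1: "\<bar>Nz\<bar> \<le> e S * (?K * T S)"
    proof -
      have "Nz\<^sup>2 \<le> (?K * (e S)\<^sup>2) * (T S)\<^sup>2"
        unfolding Nz_def by (rule noise_bound[OF lam0 n X W[OF S] cD(5)[OF S] T(1)[OF S]])
      \<comment> \<open>As \<open>?K\<close> is at least 1, a second factor \<open>?K\<close> may be
        inserted to obtain a perfect square.\<close>
      also have "\<dots> \<le> (?K * ?K * (e S)\<^sup>2) * (T S)\<^sup>2"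
        using mult_left_mono[OF K1 K0] by (intro mult_right_mono) auto
      also have "\<dots> = (e S * (?K * T S))\<^sup>2" by (simp add: power2_eq_square mult_ac)
      finally have "\<bar>Nz\<bar> \<le> \<bar>e S * (?K * T S)\<bar>" by (simp only: abs_le_square_iff)
      then show ?thesis using e0[OF S] T(2)[OF S] K0 by (simp add: abs_mult)
    qed
    have b2: "\<bar>G S' - (if S = S' then D S else 0)\<bar> \<le> e S * (?K * B * e S')" if S': "S' \<in> SS" for S'
    proof -
      have "(G S' - (if S = S' then D S else 0))\<^sup>2 \<le> (?K * (e S)\<^sup>2) * (?K * (e S')\<^sup>2) * B\<^sup>2"
        unfolding G_def
        by (rule gram_bound[OF lam0 n X finite_subset[OF SS(2)[OF S]] W[OF S] W[OF S'] cD(5)[OF S] cD(5)[OF S'] cD(1)[OF S] _ B(1)[OF S S']]) auto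
      also have "\<dots> = (e S * (?K * B * e S'))\<^sup>2" by (simp add: power2_eq_square mult_ac)
      finally have "\<bar>G S' - (if S = S' then D S else 0)\<bar> \<le> \<bar>e S * (?K * B * e S')\<bar>" by (simp only: abs_le_square_iff)
      then show ?thesis using e0[OF S] e0[OF S'] B(2) K0 by (simp add: abs_mult)
    qed
    have b3: "lam * \<bar>cr\<bar> \<le> e S * (sqrt lam * sqrt (JS m d S (fstar S)))"
    proof -
      have "\<bar>cr\<bar> \<le> sqrt (JS m d S (fstar S)) * sqrt (JS m d S (\<delta> S))"
        using real_sqrt_le_mono[OF cr] by (simp add: real_sqrt_mult)
      then have "lam * \<bar>cr\<bar> \<le> lam * (sqrt (JS m d S (fstar S)) * sqrt (JS m d S (\<delta> S)))"
        by (rule mult_left_mono[OF _ lam0])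
      also have "\<dots> = (sqrt lam * sqrt lam) * (sqrt (JS m d S (fstar S)) * sqrt (JS m d S (\<delta> S)))"
        using lam0 by simp
      also have "\<dots> = sqrt (lam * JS m d S (\<delta> S)) * (sqrt lam * sqrt (JS m d S (fstar S)))"
        by (simp add: real_sqrt_mult mult_ac)
      also have "\<dots> \<le> e S * (sqrt lam * sqrt (JS m d S (fstar S)))"
        unfolding e_def using cD(3)[OF S] J0[OF S] lam0 by (intro mult_right_mono real_sqrt_le_mono) auto
      finally show ?thesis .
    qed
    \<comment> \<open>By orthogonality of the components only the term \<open>S' = S\<close> has an
      expected part, namely \<open>D S\<close>; subtracting it leaves pure deviations.\<close>
    have "D S = (\<Sum>S'\<in>SS. if S = S' then D S else 0)" using SS(1) S by simp
    then have "(e S)\<^sup>2 = Nz - (\<Sum>S'\<in>SS. G S' - (if S = S' then D S else 0)) - lam * cr"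
      using e2[OF S] eq by (simp add: sum_subtractf algebra_simps)
    also have "\<dots> \<le> \<bar>Nz\<bar> + (\<Sum>S'\<in>SS. \<bar>G S' - (if S = S' then D S else 0)\<bar>) + lam * \<bar>cr\<bar>"
    proof -
      have "\<bar>\<Sum>S'\<in>SS. G S' - (if S = S' then D S else 0)\<bar> \<le> (\<Sum>S'\<in>SS. \<bar>G S' - (if S = S' then D S else 0)\<bar>)" by (rule sum_abs)
      moreover have "- (lam * cr) \<le> lam * \<bar>cr\<bar>" using mult_left_mono[of "- cr" "\<bar>cr\<bar>" lam] lam0 by simp
      ultimately show ?thesis by linarith
    qed
    also have "\<dots> \<le> e S * (?K * T S) + (\<Sum>S'\<in>SS. e S * (?K * B * e S')) + e S * (sqrt lam * sqrt (JS m d S (fstar S)))"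
      by (intro add_mono b1 b3 sum_mono b2)
    also have "\<dots> = e S * ?R" unfolding sum_distrib_left[symmetric] by (simp only: distrib_left add_ac)
    finally have le: "e S * e S \<le> e S * ?R" by (simp add: power2_eq_square)
    show ?thesis
    proof (cases "e S = 0")
      case True
      have "0 \<le> ?R" using K0 T(2)[OF S] lam0 J0[OF S] B(2) e0
        by (intro add_nonneg_nonneg mult_nonneg_nonneg sum_nonneg) auto
      then show ?thesis using True by simp
    next
      case False
      then have "0 < e S" using e0[OF S] by simp
      then show ?thesis using le by (simp only: mult_le_cancel_left_pos)
    qed
  qed
  have "Snorm m d lam S (\<lambda>x. fam S x - fstar S x) \<le> e S" if "S \<in> SS" for S
    unfolding Snorm_def e_def using cD(2)[OF that] by (intro real_sqrt_le_mono) (simp add: \<delta>_def[abs_def])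
  then show ?thesis using main e0 by blast
qed

text \<open>Summing over \<open>S\<close> bounds the total by twice the sum of the
  \<open>A S\<close>, because half of the total is absorbed. Reinserting this keeps
  \<open>A S\<close> with factor 1, so that each component retains its own rate.\<close>

lemma absorb_sum:
  fixes e A :: "'s \<Rightarrow> real"
  assumes "finite SS" and e: "\<And>S. S \<in> SS \<Longrightarrow> e S \<le> A S + \<kappa> * (\<Sum>S\<in>SS. e S)"
    and nn: "\<And>S. S \<in> SS \<Longrightarrow> 0 \<le> e S" and \<kappa>: "0 \<le> \<kappa>" "real (card SS) * \<kappa> \<le> 1 / 2" and S: "S \<in> SS"
  shows "e S \<le> A S + 2 * \<kappa> * (\<Sum>S\<in>SS. A S)"
proof -
  let ?E = "\<Sum>S\<in>SS. e S"
  have E0: "0 \<le> ?E" by (intro sum_nonneg nn)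
  have "?E \<le> (\<Sum>S\<in>SS. A S + \<kappa> * ?E)" by (intro sum_mono e)
  also have "\<dots> = (\<Sum>S\<in>SS. A S) + (real (card SS) * \<kappa>) * ?E" by (simp add: sum.distrib)
  also have "\<dots> \<le> (\<Sum>S\<in>SS. A S) + 1 / 2 * ?E" by (intro add_left_mono mult_right_mono \<kappa> E0)
  finally have "?E \<le> 2 * (\<Sum>S\<in>SS. A S)" by simp
  then have "\<kappa> * ?E \<le> \<kappa> * (2 * (\<Sum>S\<in>SS. A S))" by (rule mult_left_mono[OF _ \<kappa>(1)])
  then show ?thesis using e[OF S] by simp
qed

subsection \<open>Effective dimensions\<close>

lemma sum_inverse_le_ln: "1 \<le> K \<Longrightarrow> (\<Sum>k=1..K. 1 / real k) \<le> 1 + ln (real K)"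
proof (induction K rule: dec_induct)
  case (step K)
  have "ln (real K / real (Suc K)) \<le> real K / real (Suc K) - 1"
    using step.hyps by (intro ln_le_minus_one) simp
  also have "\<dots> = - (1 / real (Suc K))" by (simp add: field_simps)
  finally have "1 / real (Suc K) \<le> ln (real (Suc K)) - ln (real K)"
    using step.hyps by (simp add: ln_div)
  then show ?case using step.IH by simp
qed simp

lemma sum_inverse_squares_tail:
  assumes "1 \<le> K" shows "(\<Sum>k=Suc K..N. 1 / (real k)\<^sup>2) \<le> 1 / real K"
proof (cases "K \<le> N")
  case True
  then have "(\<Sum>k=Suc K..N. 1 / (real k)\<^sup>2) \<le> 1 / real K - 1 / real N"
  proof (induction N rule: dec_induct)
    case (step N)
    have N: "0 < real N" using step.hyps assms by simp
    have "1 / (real (Suc N))\<^sup>2 \<le> 1 / (real N * real (Suc N))"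
      unfolding power2_eq_square using N by (intro divide_left_mono mult_right_mono) auto
    also have "\<dots> = 1 / real N - 1 / real (Suc N)" using N by (simp add: field_simps)
    finally show ?case using step.IH step.hyps by simp
  qed simp
  then show ?thesis by (rule order.trans) simp
qed simp

text \<open>Terms up to the cutoff \<open>t\<close> are bounded by \<open>g\<close>, later ones by
  inverse squares. The integer part of \<open>t\<close> is at least \<open>t / 2\<close>, which
  turns the tail into \<open>2 * t\<close>.\<close>

lemma split_sum_at_floor:
  fixes t :: real
  assumes t: "1 \<le> t" and f: "\<And>k. 1 \<le> k \<Longrightarrow> real k \<le> t \<Longrightarrow> f k \<le> g k" "\<And>k. t < real k \<Longrightarrow> f k \<le> (t / real k)\<^sup>2"
    and g: "\<And>k. 0 \<le> g k" and G: "(\<Sum>k=1..nat \<lfloor>t\<rfloor>. g k) \<le> G"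
  shows "(\<Sum>k=1..N. f k) \<le> G + 2 * t"
proof -
  define K where "K = nat \<lfloor>t\<rfloor>"
  have K1: "1 \<le> K" unfolding K_def using t by (simp add: le_nat_iff le_floor_iff)
  have Kt: "real K \<le> t" unfolding K_def using t by (simp add: of_nat_floor)
  have Kt2: "t / 2 \<le> real K"
  proof -
    have "t < real K + 1" unfolding K_def using t by linarith
    then show ?thesis using K1 by (cases "t \<le> 2") auto
  qed
  have "(\<Sum>k=1..N. f k) \<le> (\<Sum>k=1..N. (if k \<le> K then g k else 0) + (if k \<le> K then 0 else (t / real k)\<^sup>2))"
  proof (rule sum_mono)
    fix k assume k: "k \<in> {1..N}"
    show "f k \<le> (if k \<le> K then g k else 0) + (if k \<le> K then 0 else (t / real k)\<^sup>2)"
    proof (cases "k \<le> K")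
      case True
      then have "real k \<le> t" using Kt by (meson of_nat_mono order.trans)
      then show ?thesis using f(1)[of k] True k by simp
    next
      case False
      then have "t < real k" unfolding K_def using t by linarith
      then show ?thesis using f(2)[of k] False by simp
    qed
  qed
  also have "\<dots> = (\<Sum>k=1..N. if k \<le> K then g k else 0) + (\<Sum>k=1..N. if k \<le> K then 0 else (t / real k)\<^sup>2)"
    by (rule sum.distrib)
  also have "(\<Sum>k=1..N. if k \<le> K then g k else 0) \<le> (\<Sum>k=1..K. g k)"
  proof -
    have "(\<Sum>k=1..N. if k \<le> K then g k else 0) = (\<Sum>k\<in>{k\<in>{1..N}. k \<le> K}. g k)"
      by (rule sum.inter_filter[symmetric]) simp
    also have "\<dots> \<le> (\<Sum>k=1..K. g k)" by (rule sum_mono2) (auto simp: g)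
    finally show ?thesis .
  qed
  also have "(\<Sum>k=1..N. if k \<le> K then 0 else (t / real k)\<^sup>2) \<le> 2 * t"
  proof -
    have "(\<Sum>k=1..N. if k \<le> K then 0 else (t / real k)\<^sup>2) = (\<Sum>k=Suc K..N. t\<^sup>2 * (1 / (real k)\<^sup>2))"
      by (rule sum.mono_neutral_cong_right) (auto simp: power_divide)
    also have "\<dots> = t\<^sup>2 * (\<Sum>k=Suc K..N. 1 / (real k)\<^sup>2)" by (rule sum_distrib_left[symmetric])
    also have "\<dots> \<le> t\<^sup>2 * (1 / real K)" by (intro mult_left_mono sum_inverse_squares_tail K1) simp
    also have "\<dots> \<le> t\<^sup>2 * (2 / t)"
      using Kt2 K1 t by (intro mult_left_mono) (auto simp: field_simps)
    also have "\<dots> = 2 * t" using t by (simp add: power2_eq_square)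
    finally show ?thesis .
  qed
  finally show ?thesis using G unfolding K_def by linarith
qed

lemma sum_squares_small:
  fixes t :: real
  assumes f: "\<And>k. 1 \<le> k \<Longrightarrow> f k \<le> (t / real k)\<^sup>2"
  shows "(\<Sum>k=1..N. f k) \<le> 2 * t\<^sup>2"
proof -
  have "(\<Sum>k=1..N. f k) \<le> (\<Sum>k=1..N. t\<^sup>2 * (1 / (real k)\<^sup>2))"
    by (intro sum_mono) (use f in \<open>auto simp: power_divide\<close>)
  also have "\<dots> = t\<^sup>2 * (\<Sum>i<N. 1 / (real (Suc i))\<^sup>2)" by (simp add: sum_distrib_left sum.atLeast1_atMost_eq)
  also have "\<dots> \<le> t\<^sup>2 * 2" by (intro mult_left_mono sum_inverse_squares_le) simp
  finally show ?thesis by simp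
qed

text \<open>The maximum with 1 keeps the value at least 1 for the small arguments
  \<open>t / real i\<close> that arise when a coordinate is split off.\<close>

definition Lp :: "real \<Rightarrow> real" where "Lp t = 1 + ln (max 1 t)"

lemma Lp_ge1: "1 \<le> Lp t"
  by (simp add: Lp_def)

lemma Lp_mono: "s \<le> t \<Longrightarrow> Lp s \<le> Lp t"
  by (simp add: Lp_def)

text \<open>The bound keeps the square for t < 1, because the induction over coordinates evaluates
  it at \<open>t / real i\<close>, where for large \<open>i\<close> only the square is
  summable.\<close>

lemma sum_min_one_square:
  assumes t: "0 < (t::real)" shows "(\<Sum>k=1..N. min 1 ((t / real k)\<^sup>2)) \<le> 3 * min t (t\<^sup>2)"
proof (cases "1 \<le> t")
  case True
  have "(\<Sum>k=1..nat \<lfloor>t\<rfloor>. (1::real)) \<le> t" using True by (simp add: of_nat_floor)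
  then have "(\<Sum>k=1..N. min 1 ((t / real k)\<^sup>2)) \<le> t + 2 * t"
    by (intro split_sum_at_floor[where g = "\<lambda>_. 1"] True) auto
  moreover have "min t (t\<^sup>2) = t" using True by (simp add: power2_eq_square min_def)
  ultimately show ?thesis by simp
next
  case False
  have mt: "min t (t\<^sup>2) = t\<^sup>2" using False t by (simp add: power2_eq_square min_def mult_le_cancel_left1)
  have "(\<Sum>k=1..N. min 1 ((t / real k)\<^sup>2)) \<le> 2 * t\<^sup>2" by (rule sum_squares_small) simp
  also have "2 * t\<^sup>2 \<le> 3 * t\<^sup>2" by simp
  finally show ?thesis unfolding mt by simp
qed

lemma sum_min_id_square:
  assumes t: "0 < (t::real)" shows "(\<Sum>k=1..N. min (t / real k) ((t / real k)\<^sup>2)) \<le> 3 * min t (t\<^sup>2) * Lp t"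
proof (cases "1 \<le> t")
  case True
  have "(\<Sum>k=1..nat \<lfloor>t\<rfloor>. t / real k) \<le> t * (1 + ln t)"
  proof -
    have k: "1 \<le> nat \<lfloor>t\<rfloor>" using True by (simp add: le_nat_iff le_floor_iff)
    have "(\<Sum>k=1..nat \<lfloor>t\<rfloor>. t / real k) = t * (\<Sum>k=1..nat \<lfloor>t\<rfloor>. 1 / real k)" by (simp add: sum_distrib_left)
    also have "\<dots> \<le> t * (1 + ln (real (nat \<lfloor>t\<rfloor>)))"
      using t by (intro mult_left_mono sum_inverse_le_ln k) simp
    also have "\<dots> \<le> t * (1 + ln t)"
      using True k by (intro mult_left_mono add_left_mono ln_mono) (auto simp: of_nat_floor)
    finally show ?thesis .
  qed
  then have "(\<Sum>k=1..N. min (t / real k) ((t / real k)\<^sup>2)) \<le> t * (1 + ln t) + 2 * t"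
    using t by (intro split_sum_at_floor[where g = "\<lambda>k. t / real k"] True) auto
  also have "\<dots> \<le> 3 * t * (1 + ln t)" using True by (simp add: algebra_simps)
  also have "\<dots> = 3 * min t (t\<^sup>2) * Lp t" using True by (simp add: power2_eq_square min_def Lp_def max_def)
  finally show ?thesis .
next
  case False
  have mt: "min t (t\<^sup>2) = t\<^sup>2" using False t by (simp add: power2_eq_square min_def mult_le_cancel_left1)
  have lp: "Lp t = 1" using False by (simp add: Lp_def max_def)
  have "(\<Sum>k=1..N. min (t / real k) ((t / real k)\<^sup>2)) \<le> 2 * t\<^sup>2" by (rule sum_squares_small) simp
  also have "2 * t\<^sup>2 \<le> 3 * t\<^sup>2" by simp
  finally show ?thesis unfolding mt lp by simp
qed

section \<open>Smoothed counts of multi-indices in a hyperbolic cross\<close>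

definition hs :: "nat set \<Rightarrow> nat \<Rightarrow> real \<Rightarrow> real" where
  "hs S N t = (\<Sum>k\<in>ibox S N. min 1 ((t / tw S k)\<^sup>2))"

lemma hs_insert:
  assumes "finite S" "j \<notin> S"
  shows "hs (insert j S) N t = (\<Sum>i=1..N. hs S N (t / real i))"
proof -
  have tw: "tw (insert j S) (k(j := i)) = real (Suc i) * tw S k" for i k
  proof -
    have "(\<Prod>j'\<in>S. real (Suc ((k(j := i)) j'))) = tw S k"
      unfolding tw_def using assms(2) by (intro prod.cong) auto
    then show ?thesis using assms by (simp add: tw_def)
  qed
  have "hs (insert j S) N t = (\<Sum>i<N. hs S N (t / real (Suc i)))"
    unfolding hs_def ibox_def sum_PiE_insert[OF assms(2)] tw by simp
  then show ?thesis by (simp add: sum.atLeast1_atMost_eq)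
qed

text \<open>The first coordinate contributes \<open>t\<close>; every further one sums
  \<open>t / real i\<close> up to the cutoff and costs one logarithm.\<close>

lemma hs_bound:
  assumes "finite S" "S \<noteq> {}" "0 < t"
  shows "hs S N t \<le> 3 ^ card S * min t (t\<^sup>2) * Lp t ^ (card S - 1)"
  using assms
proof (induction S arbitrary: t rule: finite_ne_induct)
  case (singleton j)
  have "hs {j} N t = (\<Sum>i=1..N. min 1 ((t / real i)\<^sup>2))"
    using hs_insert[of "{}" j N t] by (simp add: hs_def[of "{}"] ibox_def tw_def)
  then show ?case using sum_min_one_square[OF singleton] by simp
next
  case (insert j S)
  have c: "card S - 1 = card S - Suc 0" "card S > 0" using insert.hyps by (auto simp: card_gt_0_iff)
  have "hs (insert j S) N t = (\<Sum>i=1..N. hs S N (t / real i))" by (rule hs_insert) fact+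
  also have "\<dots> \<le> (\<Sum>i=1..N. 3 ^ card S * Lp t ^ (card S - 1) * min (t / real i) ((t / real i)\<^sup>2))"
  proof (rule sum_mono)
    fix i assume i: "i \<in> {1..N}"
    then have ti: "0 < t / real i" "t / real i \<le> t" using insert.prems by (auto simp: divide_le_eq)
    have "hs S N (t / real i) \<le> 3 ^ card S * min (t / real i) ((t / real i)\<^sup>2) * Lp (t / real i) ^ (card S - 1)"
      by (rule insert.IH[OF ti(1)])
    also have "\<dots> \<le> 3 ^ card S * min (t / real i) ((t / real i)\<^sup>2) * Lp t ^ (card S - 1)"
      using ti Lp_ge1[of "t / real i"] by (intro mult_left_mono power_mono Lp_mono) auto
    finally show "hs S N (t / real i) \<le> 3 ^ card S * Lp t ^ (card S - 1) * min (t / real i) ((t / real i)\<^sup>2)"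
      by (simp add: mult_ac)
  qed
  also have "\<dots> = 3 ^ card S * Lp t ^ (card S - 1) * (\<Sum>i=1..N. min (t / real i) ((t / real i)\<^sup>2))"
    by (rule sum_distrib_left[symmetric])
  also have "\<dots> \<le> 3 ^ card S * Lp t ^ (card S - 1) * (3 * min t (t\<^sup>2) * Lp t)"
    using Lp_ge1[of t] by (intro mult_left_mono sum_min_id_square insert.prems) auto
  also have "\<dots> = 3 ^ card (insert j S) * min t (t\<^sup>2) * Lp t ^ (card (insert j S) - 1)"
    using insert.hyps c by (cases "card S") (auto simp: mult_ac)
  finally show ?case .
qed

definition effdim :: "nat \<Rightarrow> nat set \<Rightarrow> real \<Rightarrow> real" where
  "effdim m S lam = (if S = {} then 1 else lam powr (-1 / (2 * real m)) * (- ln lam) ^ (card S - 1))"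

text \<open>For nonempty \<open>S\<close> the weight \<open>rw\<close> is 1 + x^(2m) with x = tw /
  t, so both sums reduce to \<open>hs\<close> at \<open>t\<close>; the factor \<open>tw\<close> in
  the second one costs a further \<open>t\<close>.\<close>

lemma rw_sums:
  assumes S: "finite S" "card S \<le> d" and m: "2 \<le> m" and lam: "0 < lam" "1 \<le> - ln lam"
  shows "(\<Sum>k\<in>ibox S N. 1 / rw m lam S k) \<le> 6 ^ d * effdim m S lam"
    and "(\<Sum>k\<in>ibox S N. tw S k / rw m lam S k) \<le> 6 ^ d * ((if S = {} then 1 else lam powr (-1 / (2 * real m))) * effdim m S lam)"
proof -
  \<comment> \<open>The cutoff at which \<open>lam * tw ^ (2 * m)\<close> reaches 1.\<close>
  define t where "t = lam powr (-1 / (2 * real m))"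
  define L where "L = - ln lam"
  have t_eq: "t = exp (L / (2 * real m))" using lam by (simp add: t_def powr_def L_def)
  have "0 \<le> L / (2 * real m)" using lam(2) m by (intro divide_nonneg_pos) (auto simp: L_def)
  then have t1: "1 \<le> t" unfolding t_eq by simp
  have lamt: "lam * t ^ (2 * m) = 1"
  proof -
    have "t ^ (2 * m) = exp (real (2 * m) * (L / (2 * real m)))" unfolding t_eq by (simp only: exp_of_nat_mult)
    also have "real (2 * m) * (L / (2 * real m)) = L" using m by simp
    also have "exp L = 1 / lam" using lam(1) by (simp add: L_def exp_minus field_simps)
    finally show ?thesis using lam(1) by simp
  qed
  have six: "1 \<le> (6::real) ^ d" by (rule one_le_power) simp
  have "(\<Sum>k\<in>ibox S N. 1 / rw m lam S k) \<le> 6 ^ d * effdim m S lam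
    \<and> (\<Sum>k\<in>ibox S N. tw S k / rw m lam S k) \<le> 6 ^ d * ((if S = {} then 1 else t) * effdim m S lam)"
  proof (cases "S = {}")
    case True
    then show ?thesis using six True by (simp add: rw_def effdim_def ibox_def tw_def)
  next
    case False
    have rt: "rw m lam S k = 1 + (tw S k / t) ^ (2 * m)" for k
    proof -
      have "lam = 1 / t ^ (2 * m)" using lamt t1 by (simp add: field_simps)
      then show ?thesis using False by (simp add: rw_def power_divide)
    qed
    have pw: "1 / rw m lam S k \<le> min 1 ((t / tw S k)\<^sup>2)" "tw S k / rw m lam S k \<le> t * min 1 ((t / tw S k)\<^sup>2)" for k
    proof -
      define x where "x = tw S k / t"
      have x0: "0 < x" using tw_ge1[of S k] t1 by (simp add: x_def)
      have inv: "t / tw S k = 1 / x" by (simp add: x_def)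
      have twx: "tw S k = t * x" using t1 by (simp add: x_def)
      have r1: "1 \<le> rw m lam S k" unfolding rt x_def[symmetric] using x0 by simp
      \<comment> \<open>Here 2m \<ge> 3 enters: it leaves x / rw with a decay of order 1 /
        x^2.\<close>
      have r3: "x ^ 3 \<le> rw m lam S k"
      proof (cases "1 \<le> x")
        case True
        then have "x ^ 3 \<le> x ^ (2 * m)" using m by (intro power_increasing) auto
        then show ?thesis unfolding rt x_def[symmetric] by simp
      next
        case F: False
        then have "x ^ 3 \<le> 1" using x0 by (intro power_le_one) auto
        then show ?thesis using r1 by simp
      qed
      have r2: "x\<^sup>2 \<le> rw m lam S k"
      proof (cases "1 \<le> x")
        case True
        then have "x\<^sup>2 \<le> x ^ 3" by (intro power_increasing) auto
        then show ?thesis using r3 by simp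
      next
        case F: False
        then have "x\<^sup>2 \<le> 1" using x0 by (intro power_le_one) auto
        then show ?thesis using r1 by simp
      qed
      have rx: "x \<le> rw m lam S k"
        using r1 r2 x0 by (cases "1 \<le> x") (auto simp: power2_eq_square intro: order.trans[OF _ r2] )
      show "1 / rw m lam S k \<le> min 1 ((t / tw S k)\<^sup>2)"
        unfolding inv using r1 r2 x0 by (auto simp: power_divide divide_le_eq le_divide_eq mult.commute intro!: divide_left_mono)
      have "x / rw m lam S k \<le> 1" using rx r1 by simp
      moreover have "x / rw m lam S k \<le> 1 / x\<^sup>2"
        using r3 r1 x0 by (simp add: field_simps power2_eq_square power3_eq_cube)
      ultimately have "x / rw m lam S k \<le> min 1 ((1 / x)\<^sup>2)" by (simp add: power_divide)
      then have "t * (x / rw m lam S k) \<le> t * min 1 ((1 / x)\<^sup>2)" using t1 by (intro mult_left_mono) auto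
      then show "tw S k / rw m lam S k \<le> t * min 1 ((t / tw S k)\<^sup>2)"
        unfolding inv unfolding twx by simp
    qed
    have h: "hs S N t \<le> 6 ^ d * effdim m S lam"
    proof -
      have "min t (t\<^sup>2) = t" using t1 by (simp add: power2_eq_square min_def)
      then have "hs S N t \<le> 3 ^ card S * (t * Lp t ^ (card S - 1))"
        using hs_bound[OF S(1) False, of t N] t1 by (simp add: mult.assoc)
      also have "\<dots> \<le> 3 ^ card S * (t * (2 * L) ^ (card S - 1))"
      proof (intro mult_left_mono power_mono)
        \<comment> \<open>Since L \<ge> 1 and ln t = L / (2m), both summands of \<open>Lp t\<close>
          are at most L.\<close>
        have "L / (2 * real m) \<le> L / 1" using lam(2) m by (intro divide_left_mono) (auto simp: L_def)
        then show "Lp t \<le> 2 * L"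
          using lam(2) t1 by (simp add: Lp_def max_def t_eq L_def)
      qed (use t1 Lp_ge1[of t] in auto)
      also have "\<dots> = (3 ^ card S * 2 ^ (card S - 1)) * (t * L ^ (card S - 1))" by (simp add: power_mult_distrib)
      also have "\<dots> \<le> 6 ^ d * (t * L ^ (card S - 1))"
      proof (rule mult_right_mono)
        have "(3::real) ^ card S * 2 ^ (card S - 1) \<le> 3 ^ d * 2 ^ d"
          using S(2) by (intro mult_mono power_increasing) auto
        then show "(3::real) ^ card S * 2 ^ (card S - 1) \<le> 6 ^ d" by (simp flip: power_mult_distrib)
        show "0 \<le> t * L ^ (card S - 1)" using t1 lam(2) by (simp add: L_def)
      qed
      finally show ?thesis using False by (simp add: effdim_def t_def L_def)
    qed
    have "(\<Sum>k\<in>ibox S N. 1 / rw m lam S k) \<le> hs S N t" unfolding hs_def by (intro sum_mono pw)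
    moreover have "(\<Sum>k\<in>ibox S N. tw S k / rw m lam S k) \<le> t * hs S N t"
      unfolding hs_def sum_distrib_left by (intro sum_mono pw)
    moreover have "t * hs S N t \<le> t * (6 ^ d * effdim m S lam)" using h t1 by (intro mult_left_mono) auto
    ultimately show ?thesis using h False by (auto simp: mult_ac)
  qed
  then show "(\<Sum>k\<in>ibox S N. 1 / rw m lam S k) \<le> 6 ^ d * effdim m S lam"
    "(\<Sum>k\<in>ibox S N. tw S k / rw m lam S k) \<le> 6 ^ d * ((if S = {} then 1 else lam powr (-1 / (2 * real m))) * effdim m S lam)"
    unfolding t_def by blast+
qed

subsection \<open>Comparison with the rates of the theorem\<close>

text \<open>With a = 4m - 2\<tau> - 2 the exponents of \<lambda> in \<open>beta_n\<close> add up to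
  -3/(4m) - \<gamma>, where \<gamma> = \<tau>/(2ma). For s > 1 the factor \<lambda>^(-\<gamma>)
  outgrows the power (s - 1)/a by which the logarithm in \<open>beta_n\<close> is too small; for s =
  1 both are trivial.\<close>

lemma beta_n_lower:
  fixes lam :: "nat \<Rightarrow> real"
  assumes m: "2 \<le> m" and s: "1 \<le> s" and tau: "s = 1 \<longrightarrow> \<tau> = 0" "1 < s \<longrightarrow> 0 < \<tau> \<and> \<tau> < 2 * real m - 2"
    and lam: "\<And>n. 0 < lam n" and L: "filterlim (\<lambda>n. - ln (lam n)) at_top sequentially"
  shows "\<forall>\<^sub>F n in sequentially. real n powr (-1/2) * lam n powr (-3 / (4 * real m)) * (- ln (lam n)) powr (real s - 1)
     \<le> beta_n m \<tau> s n (lam n)"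
proof -
  define a where "a = 4 * real m - 2 * \<tau> - 2"
  have a2: "2 < a" using m s tau by (cases "s = 1") (auto simp: a_def)
  define \<gamma> where "\<gamma> = (1 / a) * (1 - 1 / (2 * real m)) - 1 / (4 * real m)"
  have \<gamma>: "\<gamma> = \<tau> / (2 * real m * a)"
  proof -
    have "a \<noteq> 0" "real m \<noteq> 0" using a2 m by auto
    then have "\<gamma> = (4 * real m - 2 - a) / (4 * real m * a)" by (simp add: \<gamma>_def field_simps)
    then show ?thesis by (simp add: a_def)
  qed
  define c where "c = 1 / 2 - 1 / (4 * real m)"
  have c: "0 < c" using m by (simp add: c_def field_simps)
  have e1: "\<forall>\<^sub>F x in at_top. x powr ((real s - 1) / a) \<le> exp (\<gamma> * x)"
  proof (cases "s = 1")
    case True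
    then have "\<gamma> = 0" using tau by (simp add: \<gamma>)
    then show ?thesis using True eventually_gt_at_top[of "0::real"] by (auto elim!: eventually_mono)
  next
    case False
    then have "0 < \<gamma>" unfolding \<gamma> using tau s m a2 by simp
    moreover define p where "p = (real s - 1) / a"
    ultimately have "\<forall>\<^sub>F x in at_top. x powr p \<le> exp (\<gamma> * x)" by real_asymp
    then show ?thesis by (simp add: p_def)
  qed
  \<comment> \<open>With x = -ln \<lambda> this expression is the inner logarithm in
    \<open>beta_n\<close>, whose square root is therefore eventually at least 1.\<close>
  have e2: "\<forall>\<^sub>F x in at_top. 1 \<le> c * x - (real s - 1) / 2 * ln x"
    using c by real_asymp
  have e3: "\<forall>\<^sub>F x::real in at_top. 0 < x" by (rule eventually_gt_at_top)
  have e4: "\<forall>\<^sub>F n in sequentially. 1 \<le> ln (real n)" by real_asymp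
  note ev = eventually_conj[OF e1 eventually_conj[OF e2 e3], THEN eventually_compose_filterlim[OF _ L]]
  show ?thesis using ev e4 eventually_gt_at_top[of 0]
  proof eventually_elim
    case (elim n)
    define x where "x = - ln (lam n)"
    have x: "x powr ((real s - 1) / a) \<le> exp (\<gamma> * x)" "1 \<le> c * x - (real s - 1) / 2 * ln x" "0 < x"
      using elim by (auto simp: x_def)
    have lp: "lam n powr y = exp (- y * x)" for y using lam[of n] by (simp add: powr_def x_def)
    have l1: "1 \<le> sqrt (ln (lam n powr (1 / (4 * real m) - 1/2) * x powr ((1 - real s) / 2)))"
    proof -
      have "lam n powr (1 / (4 * real m) - 1/2) * x powr ((1 - real s) / 2) = exp (c * x - (real s - 1) / 2 * ln x)"
      proof -
        have "x powr ((1 - real s) / 2) = exp ((1 - real s) / 2 * ln x)" using x(3) by (simp add: powr_def)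
        then show ?thesis unfolding lp by (simp add: c_def algebra_simps diff_divide_distrib flip: exp_add)
      qed
      then show ?thesis using x(2) by simp
    qed
    have exps: "lam n powr (-1 / (2 * real m)) * lam n powr (-1 / a) * lam n powr (1 / (8 * (real m)^2 - 4 * real m * \<tau> - 4 * real m))
       = lam n powr (-3 / (4 * real m)) * exp (\<gamma> * x)"
    proof -
      \<comment> \<open>The third exponent of \<lambda> in \<open>beta_n\<close> is thus 1 / (2 m
        a).\<close>
      have 8: "8 * (real m)^2 - 4 * real m * \<tau> - 4 * real m = 2 * real m * a" by (simp add: a_def power2_eq_square algebra_simps)
      have "1 / (2 * real m) + 1 / a - 1 / (2 * real m * a) = 3 / (4 * real m) + \<gamma>"
        using a2 m by (simp add: \<gamma>_def field_simps)
      then have "(1 / (2 * real m) + 1 / a - 1 / (2 * real m * a)) * x = (3 / (4 * real m) + \<gamma>) * x" by simp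
      then show ?thesis unfolding 8 lp by (simp add: algebra_simps flip: exp_add)
    qed
    have pos: "0 \<le> real n powr (-1/2) * lam n powr (-3 / (4 * real m))" by simp
    have "x powr (real s - 1) = x powr ((real s - 1) / a) * x powr ((real s - 1) * (1 - 1 / a))"
    proof -
      have "real s - 1 = (real s - 1) / a + (real s - 1) * (1 - 1 / a)" using a2 by (simp add: field_simps)
      then show ?thesis by (metis powr_add)
    qed
    also have "\<dots> \<le> exp (\<gamma> * x) * x powr ((real s - 1) * (1 - 1 / a))"
      by (intro mult_right_mono x) simp
    finally have "real n powr (-1/2) * lam n powr (-3 / (4 * real m)) * x powr (real s - 1)
       \<le> real n powr (-1/2) * lam n powr (-3 / (4 * real m)) * (exp (\<gamma> * x) * x powr ((real s - 1) * (1 - 1 / a)))"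
      by (rule mult_left_mono[OF _ pos])
    also have "\<dots> = real n powr (-1/2) * (lam n powr (-1 / (2 * real m)) * lam n powr (-1 / a) * lam n powr (1 / (8 * (real m)^2 - 4 * real m * \<tau> - 4 * real m)))
        * x powr ((real s - 1) * (1 - 1 / a))"
      unfolding exps by (simp add: mult_ac)
    also have "\<dots> \<le> \<dots> * (sqrt (ln (lam n powr (1 / (4 * real m) - 1/2) * x powr ((1 - real s) / 2))) * sqrt (ln (real n)))"
    proof -
      have "1 * 1 \<le> sqrt (ln (lam n powr (1 / (4 * real m) - 1/2) * x powr ((1 - real s) / 2))) * sqrt (ln (real n))"
        using l1 elim by (intro mult_mono) auto
      moreover have "y \<le> y * z" if "0 \<le> y" "1 * 1 \<le> z" for y z :: real
        using mult_left_mono[OF that(2,1)] by simp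
      ultimately show ?thesis by simp
    qed
    also have "\<dots> = beta_n m \<tau> s n (lam n)"
      by (simp add: beta_n_def a_def x_def mult.assoc)
    finally show ?case by (simp add: x_def)
  qed
qed

subsection \<open>The probabilistic bound and the theorem\<close>

text \<open>\<open>T\<close> and \<open>B\<close> are chosen so that Markov's inequality bounds each
  exceptional event by \<open>1 / M0\<close>. There is one event for each component and one for each
  pair of components, besides a null set.\<close>

lemma pls_tail:
  fixes fh :: "(nat \<Rightarrow> (nat \<Rightarrow> real) \<times> real) \<Rightarrow> nat set \<Rightarrow> (nat \<Rightarrow> real) \<Rightarrow> real"
  assumes SS: "finite SS" "\<And>S. S \<in> SS \<Longrightarrow> S \<subseteq> {1..d}" and m: "2 \<le> m" and n: "0 < n"
    and lam: "0 < lam" "1 \<le> - ln lam"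
    and \<nu>: "prob_space \<nu>" "integrable \<nu> (\<lambda>e. e)" "(\<integral>e. e \<partial>\<nu>) = 0" "integrable \<nu> (\<lambda>e. e\<^sup>2)"
    and fstar: "\<And>S. S \<in> SS \<Longrightarrow> fstar S \<in> HS m d S"
    and min: "\<And>\<omega>. \<omega> \<in> space (sample_space d \<nu> n) \<Longrightarrow> is_pls_min m d SS n (\<lambda>i. fst (\<omega> i))
          (\<lambda>i. (\<Sum>S\<in>SS. fstar S (fst (\<omega> i))) + snd (\<omega> i)) lam (fh \<omega>)"
    and M0: "0 < M0"
    and b2: "0 < b2" "\<And>S S'. S \<in> SS \<Longrightarrow> S' \<in> SS \<Longrightarrow>
        (if S = {} then 1 else lam powr (-1 / (2 * real m))) * effdim m S lam * effdim m S' lam \<le> b2"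
    and T: "\<And>S. T S = sqrt (((\<integral>e. e\<^sup>2 \<partial>\<nu>) + 1) * 6 ^ d * effdim m S lam * M0 / real n)"
    and B: "B = sqrt (108 ^ d * b2 * M0 / real n)"
    and small: "real (card SS) * (CU m ^ d * B) \<le> 1 / 2"
  defines "a \<equiv> \<lambda>S. CU m ^ d * T S + sqrt lam * sqrt (JS m d S (fstar S))"
  shows "\<exists>A\<in>sets (sample_space d \<nu> n). measure (sample_space d \<nu> n) A \<le> (real (card SS) + (real (card SS))\<^sup>2) / M0
    \<and> (\<forall>\<omega>\<in>space (sample_space d \<nu> n) - A. \<forall>S\<in>SS. Snorm m d lam S (\<lambda>x. fh \<omega> S x - fstar S x)
        \<le> a S + 2 * (CU m ^ d * B) * (\<Sum>S\<in>SS. a S))"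
proof -
  let ?P = "sample_space d \<nu> n"
  let ?s = "\<integral>e. e\<^sup>2 \<partial>\<nu>"
  interpret P: prob_space ?P unfolding sample_space_def
    by (intro prob_space_PiM prob_space_pair prob_space_unif_cube \<nu>(1))
  have s0: "0 \<le> ?s" by simp
  have fS: "finite S" "card S \<le> d" if "S \<in> SS" for S
    using finite_subset[OF SS(2)[OF that]] card_mono[OF _ SS(2)[OF that]] by auto
  have "0 < - ln lam" using lam by linarith
  then have eff: "0 < effdim m S lam" for S
    using lam(1) unfolding effdim_def by (auto intro!: mult_pos_pos zero_less_power simp del: ln_less_zero_iff)
  have T2: "(T S)\<^sup>2 = (?s + 1) * 6 ^ d * effdim m S lam * M0 / real n" "0 < (T S)\<^sup>2" "0 \<le> T S" for S
  proof -
    have "0 < (?s + 1) * 6 ^ d * effdim m S lam * M0 / real n"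
      using s0 eff M0 n by (intro divide_pos_pos mult_pos_pos add_nonneg_pos) auto
    then show "(T S)\<^sup>2 = (?s + 1) * 6 ^ d * effdim m S lam * M0 / real n" "0 < (T S)\<^sup>2" "0 \<le> T S"
      unfolding T by simp_all
  qed
  have B2: "B\<^sup>2 = 108 ^ d * b2 * M0 / real n" "0 < B\<^sup>2" "0 \<le> B"
  proof -
    have "0 < 108 ^ d * b2 * M0 / real n" using b2(1) M0 n by simp
    then show "B\<^sup>2 = 108 ^ d * b2 * M0 / real n" "0 < B\<^sup>2" "0 \<le> B" unfolding B by simp_all
  qed
  have rwp: "0 < rw m lam S k" for S k using lam(1) by (intro rw_pos) simp
  have "\<exists>A\<in>sets ?P. measure ?P A \<le> 1 / M0
     \<and> (\<forall>\<omega>\<in>space ?P - A. \<forall>N. noise_stat m S n (\<lambda>i. fst (\<omega> i)) (\<lambda>i. snd (\<omega> i)) lam N \<le> (T S)\<^sup>2)" if S: "S \<in> SS" for S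
  proof -
    \<comment> \<open>The summand 1 in \<open>T\<close> keeps the level positive when the noise has
      variance zero.\<close>
    have "?s * (6 ^ d * effdim m S lam) / (real n * (T S)\<^sup>2) = (?s / (?s + 1)) / M0"
    proof -
      have "real n * (T S)\<^sup>2 = (?s + 1) * (6 ^ d * effdim m S lam) * M0" using n by (simp add: T2(1))
      moreover have "x * v / (y * v * z) = x / y / z" if "0 < v" for x y z v :: real using that by simp
      ultimately show ?thesis using eff[of S] by simp
    qed
    also have "\<dots> \<le> 1 / M0"
    proof (rule divide_right_mono)
      have "x / (x + 1) \<le> 1" if "0 \<le> x" for x :: real using that by simp
      then show "?s / (?s + 1) \<le> 1" using s0 by blast
    qed (use M0 in simp)
    finally have le: "?s * (6 ^ d * effdim m S lam) / (real n * (T S)\<^sup>2) \<le> 1 / M0" .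
    show ?thesis
      using noise_tail[OF \<nu> SS(2)[OF S] rwp rw_sums(1)[OF fS[OF S] m lam] n T2(2)[of S]] le
      unfolding noise_stat_def by (meson order.trans)
  qed
  then obtain AT where AT: "\<And>S. S \<in> SS \<Longrightarrow> AT S \<in> sets ?P" "\<And>S. S \<in> SS \<Longrightarrow> measure ?P (AT S) \<le> 1 / M0"
    "\<And>S \<omega> N. S \<in> SS \<Longrightarrow> \<omega> \<in> space ?P - AT S \<Longrightarrow> noise_stat m S n (\<lambda>i. fst (\<omega> i)) (\<lambda>i. snd (\<omega> i)) lam N \<le> (T S)\<^sup>2"
    by metis
  have "\<exists>A\<in>sets ?P. measure ?P A \<le> 1 / M0
     \<and> (\<forall>\<omega>\<in>space ?P - A. \<forall>N. gram_stat m S S' n (\<lambda>i. fst (\<omega> i)) lam N \<le> B\<^sup>2)" if S: "S \<in> SS" and S': "S' \<in> SS" for S S'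
  proof -
    let ?c = "if S = {} then 1 else lam powr (-1 / (2 * real m))"
    have "3 ^ card S * ((6 ^ d * (?c * effdim m S lam)) * (6 ^ d * effdim m S' lam))
       = (3 ^ card S * (6 ^ d * 6 ^ d)) * (?c * effdim m S lam * effdim m S' lam)" by simp
    also have "\<dots> \<le> (3 ^ d * (6 ^ d * 6 ^ d)) * b2"
      using b2(2)[OF S S'] fS(2)[OF S] lam(1) eff by (intro mult_mono power_increasing mult_nonneg_nonneg) (auto simp: less_imp_le)
    \<comment> \<open>The 3 comes from the pointwise bound on \<open>tL\<close>, the two factors 6
      from \<open>rw_sums\<close>.\<close>
    also have "3 ^ d * (6 ^ d * 6 ^ d) = (108 :: real) ^ d" by (simp flip: power_mult_distrib)
    finally have "3 ^ card S * ((6 ^ d * (?c * effdim m S lam)) * (6 ^ d * effdim m S' lam)) / (real n * B\<^sup>2) \<le> 108 ^ d * b2 / (real n * B\<^sup>2)"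
      using B2(2) n by (intro divide_right_mono) auto
    also have "\<dots> = 1 / M0" using b2(1) M0 n unfolding B2(1) by simp
    finally have le: "3 ^ card S * ((6 ^ d * (?c * effdim m S lam)) * (6 ^ d * effdim m S' lam)) / (real n * B\<^sup>2) \<le> 1 / M0" .
    show ?thesis
      using gram_tail[OF \<nu>(1) SS(2)[OF S] SS(2)[OF S'] rwp rwp rw_sums(2)[OF fS[OF S] m lam] rw_sums(1)[OF fS[OF S'] m lam] n B2(2)] le
      unfolding gram_stat_def by (meson order.trans)
  qed
  then obtain AB where AB: "\<And>S S'. S \<in> SS \<Longrightarrow> S' \<in> SS \<Longrightarrow> AB S S' \<in> sets ?P" "\<And>S S'. S \<in> SS \<Longrightarrow> S' \<in> SS \<Longrightarrow> measure ?P (AB S S') \<le> 1 / M0"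
    "\<And>S S' \<omega> N. S \<in> SS \<Longrightarrow> S' \<in> SS \<Longrightarrow> \<omega> \<in> space ?P - AB S S' \<Longrightarrow> gram_stat m S S' n (\<lambda>i. fst (\<omega> i)) lam N \<le> B\<^sup>2"
    by metis
  \<comment> \<open>Samples with a point outside the cube are removed because the expansions
    represent the functions only on the cube.\<close>
  obtain Z where Z: "{\<omega>\<in>space ?P. \<not> (\<forall>i\<in>{..<n}. fst (\<omega> i) \<in> cube d)} \<subseteq> Z" "emeasure ?P Z = 0" "Z \<in> sets ?P"
    using AE_sample_cube[OF \<nu>(1), where d = d and n = n] by (rule AE_E)
  define UT where "UT = (\<Union>S\<in>SS. AT S)"
  define UB where "UB = (\<Union>p\<in>SS \<times> SS. AB (fst p) (snd p))"
  have sT: "UT \<in> sets ?P" unfolding UT_def by (intro sets.finite_UN SS AT)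
  have sB: "UB \<in> sets ?P" unfolding UB_def by (intro sets.finite_UN finite_cartesian_product SS AB) auto
  have mT: "measure ?P UT \<le> real (card SS) / M0"
  proof -
    have "measure ?P UT \<le> (\<Sum>S\<in>SS. measure ?P (AT S))"
      unfolding UT_def by (rule P.finite_measure_subadditive_finite) (use SS AT in auto)
    also have "\<dots> \<le> (\<Sum>S\<in>SS. 1 / M0)" by (intro sum_mono AT)
    finally show ?thesis by simp
  qed
  have mB: "measure ?P UB \<le> (real (card SS))\<^sup>2 / M0"
  proof -
    have "measure ?P UB \<le> (\<Sum>p\<in>SS \<times> SS. measure ?P (AB (fst p) (snd p)))"
      unfolding UB_def by (rule P.finite_measure_subadditive_finite) (use SS AB in auto)
    also have "\<dots> \<le> (\<Sum>p\<in>SS \<times> SS. 1 / M0)" by (intro sum_mono AB) auto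
    finally show ?thesis by (simp add: card_cartesian_product power2_eq_square)
  qed
  define A where "A = Z \<union> (UT \<union> UB)"
  have sA: "A \<in> sets ?P" unfolding A_def by (intro sets.Un Z(3) sT sB)
  have "measure ?P A \<le> measure ?P Z + (measure ?P UT + measure ?P UB)"
    unfolding A_def
    by (rule order.trans[OF measure_Un_le[OF Z(3) sets.Un[OF sT sB]]])
      (rule add_left_mono[OF measure_Un_le[OF sT sB]])
  moreover have "measure ?P Z = 0" using Z(2) by (simp add: measure_def)
  ultimately have mA: "measure ?P A \<le> (real (card SS) + (real (card SS))\<^sup>2) / M0"
    using mT mB by (simp add: add_divide_distrib)
  have "Snorm m d lam S (\<lambda>x. fh \<omega> S x - fstar S x) \<le> a S + 2 * (CU m ^ d * B) * (\<Sum>S\<in>SS. a S)"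
    if \<omega>: "\<omega> \<in> space ?P - A" and S: "S \<in> SS" for \<omega> S
  proof -
    have \<omega>P: "\<omega> \<in> space ?P" using \<omega> by simp
    have X: "fst (\<omega> i) \<in> cube d" if "i < n" for i using \<omega> Z(1) that by (auto simp: A_def)
    have nt: "\<omega> \<in> space ?P - AT S" if "S \<in> SS" for S using \<omega> that by (auto simp: A_def UT_def)
    have nb: "\<omega> \<in> space ?P - AB S S'" if "S \<in> SS" "S' \<in> SS" for S S' using \<omega> that by (auto simp: A_def UB_def)
    obtain e where e: "\<And>S. S \<in> SS \<Longrightarrow> 0 \<le> e S" "\<And>S. S \<in> SS \<Longrightarrow> Snorm m d lam S (\<lambda>x. fh \<omega> S x - fstar S x) \<le> e S"
      "\<And>S. S \<in> SS \<Longrightarrow> e S \<le> CU m ^ d * T S + sqrt lam * sqrt (JS m d S (fstar S)) + CU m ^ d * B * (\<Sum>S'\<in>SS. e S')"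
      using pls_core[OF SS m n lam(1) X fstar min[OF \<omega>P] AT(3)[OF _ nt] T2(3) AB(3)[OF _ _ nb] B2(3)] by blast
    have K0: "0 \<le> CU m ^ d * B" using CU_pos[of m] B2(3) by simp
    have "e S \<le> a S + 2 * (CU m ^ d * B) * (\<Sum>S\<in>SS. a S)"
      by (rule absorb_sum[OF SS(1) _ e(1) K0 small S]) (use e(3) in \<open>simp_all add: a_def\<close>)
    then show ?thesis using e(2)[OF S] by linarith
  qed
  then show ?thesis using sA mA by blast
qed

section \<open>The rates as square roots of effective dimensions\<close>

lemma powr_square: "((x :: real) powr y)\<^sup>2 = x powr (2 * y)"
  by (simp add: power2_eq_square flip: powr_add)

lemma sqrt_effdim:
  assumes "S \<noteq> {}" "finite S" "0 < lam" "0 < - ln lam" "0 < n"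
  shows "sqrt (effdim m S lam / real n)
    = real n powr (-1/2) * lam powr (-1 / (4 * real m)) * (- ln lam) powr ((real (card S) - 1) / 2)"
proof (rule real_sqrt_unique)
  have c: "(- ln lam) ^ (card S - 1) = (- ln lam) powr (real (card S) - 1)"
    using assms by (cases "card S") (auto simp: powr_realpow)
  have n1: "real n powr (2 * (-1/2)) = 1 / real n" using assms by (simp add: powr_minus_divide)
  have e: "2 * (-1 / (4 * real m)) = -1 / (2 * real m)" "2 * ((real (card S) - 1) / 2) = real (card S) - 1" by simp_all
  show "(real n powr (-1/2) * lam powr (-1 / (4 * real m)) * (- ln lam) powr ((real (card S) - 1) / 2))\<^sup>2 = effdim m S lam / real n"
    unfolding power_mult_distrib powr_square n1 e effdim_def c[symmetric] using assms(1) by simp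
qed simp

text \<open>Under the root stand three factors \<lambda>^(-1/(2m)), two from effective dimensions
  and one from the unbounded basis; together they give the exponent -3/(4m).\<close>

lemma sqrt_gram_rate:
  assumes "1 \<le> s" "0 < lam" "0 < - ln lam" "0 < n"
  shows "sqrt (lam powr (-1 / (2 * real m)) * (lam powr (-1 / (2 * real m)) * (- ln lam) ^ (s - 1))\<^sup>2 / real n)
    = real n powr (-1/2) * lam powr (-3 / (4 * real m)) * (- ln lam) powr (real s - 1)"
proof (rule real_sqrt_unique)
  have c: "(- ln lam) ^ (s - 1) = (- ln lam) powr (real s - 1)"
    using assms by (cases s) (auto simp: powr_realpow)
  have n1: "real n powr (2 * (-1/2)) = 1 / real n" using assms by (simp add: powr_minus_divide)
  have "2 * (-3 / (4 * real m)) = -1 / (2 * real m) + 2 * (-1 / (2 * real m))"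
    by (cases "m = 0") (auto simp: field_simps)
  then have e: "lam powr (2 * (-3 / (4 * real m))) = lam powr (-1 / (2 * real m)) * lam powr (2 * (-1 / (2 * real m)))"
    by (metis powr_add)
  show "(real n powr (-1/2) * lam powr (-3 / (4 * real m)) * (- ln lam) powr (real s - 1))\<^sup>2
    = lam powr (-1 / (2 * real m)) * (lam powr (-1 / (2 * real m)) * (- ln lam) ^ (s - 1))\<^sup>2 / real n"
    unfolding c power_mult_distrib powr_square n1 e by simp
qed simp

theorem theorem2:
  fixes m d :: nat
    and SS :: "nat set set"
    and fstar :: "nat set \<Rightarrow> (nat \<Rightarrow> real) \<Rightarrow> real"
    and CJ :: "nat set \<Rightarrow> real"
    and \<nu> :: "real measure"
    and lam :: "nat \<Rightarrow> real"
    and \<tau> :: real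
    and fhat :: "nat \<Rightarrow> (nat \<Rightarrow> (nat \<Rightarrow> real) \<times> real) \<Rightarrow> nat set \<Rightarrow> (nat \<Rightarrow> real) \<Rightarrow> real"
  assumes d: "d \<ge> 1" and m: "m \<ge> 2"
    and SS_sub: "\<forall>S\<in>SS. S \<subseteq> {1..d}" and SS_empty: "{} \<in> SS"
    and fstar_in: "\<forall>S\<in>SS. fstar S \<in> HS m d S"
    and smooth: "\<forall>S\<in>SS - {{}}. 0 < CJ S \<and> JS m d S (fstar S) \<le> CJ S"
    and nu_prob: "prob_space \<nu>" and nu_sets: "sets \<nu> = sets borel"
    and nu_int: "integrable \<nu> (\<lambda>e. e)" and nu_mean: "(\<integral>e. e \<partial>\<nu>) = 0"
    and nu_4: "integrable \<nu> (\<lambda>e. e ^ 4)"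
    and tau: "(Max (card ` SS) \<le> 1 \<longrightarrow> \<tau> = 0) \<and>
              (Max (card ` SS) > 1 \<longrightarrow> 0 < \<tau> \<and> \<tau> < 2 * real m - 2)"
    and lam_pos: "\<forall>n. lam n > 0"
    and lam1: "(\<lambda>n. sqrt (real n) * lam n) \<longlonglongrightarrow> 0"
    and lam2: "(\<lambda>n. (1 / real n) * lam n powr (-1 / real m)
                  * (- ln (lam n)) powr (2 * real (Max (card ` SS)) - 2)) \<longlonglongrightarrow> 0"
    and lam3: "(\<lambda>n. sqrt (real n) * alpha_n m \<tau> (Max (card ` SS)) n (lam n)
                  (\<Sum>S\<in>SS. JS m d S (fstar S))) \<longlonglongrightarrow> 0"
    and fhat_min: "\<forall>n\<ge>1. \<forall>\<omega>\<in>space (sample_space d \<nu> n).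
        is_pls_min m d SS n (\<lambda>i. fst (\<omega> i))
          (\<lambda>i. (\<Sum>S\<in>SS. fstar S (fst (\<omega> i))) + snd (\<omega> i)) (lam n) (fhat n \<omega>)"
  shows "(\<forall>S\<in>SS - {{}}.
            bigOP (sample_space d \<nu>)
              (\<lambda>n \<omega>. Snorm m d (lam n) S (\<lambda>x. fhat n \<omega> S x - fstar S x))
              (\<lambda>n. real n powr (-1/2) * lam n powr (-1 / (4 * real m))
                     * (- ln (lam n)) powr ((real (card S) - 1) / 2)
                   + sqrt (lam n) * sqrt (JS m d S (fstar S))))
       \<and> bigOP (sample_space d \<nu>)
              (\<lambda>n \<omega>. Snorm m d (lam n) {} (\<lambda>x. fhat n \<omega> {} x - fstar {} x))
              (\<lambda>n. real n powr (-1/2))"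
proof -
  define s where "s = Max (card ` SS)"
  define J where "J = (\<Sum>S\<in>SS. JS m d S (fstar S))"
  define L where "L n = - ln (lam n)" for n
  define t where "t n = lam n powr (-1 / (2 * real m))" for n
  \<comment> \<open>An upper bound for the effective dimensions of all components. For
    \<open>s = 0\<close> only constants are present, which a truncated \<open>s - 1\<close> would
    not reflect.\<close>
  define h where "h n = (if s = 0 then 1 else t n * L n ^ (s - 1))" for n
  define b2 where "b2 n = (if s = 0 then 1 else t n * (h n)\<^sup>2)" for n
  \<comment> \<open>\<open>bn\<close> is the rate of the Gram matrix error \<open>B\<close>, while
    \<open>rn\<close> adds the bias to the noise rate of the largest components.\<close>
  define bn where "bn n = sqrt (b2 n / real n)" for n
  define rn where "rn n = sqrt (h n / real n) + sqrt (lam n) * sqrt J" for n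
  let ?\<sigma> = "\<integral>e. e\<^sup>2 \<partial>\<nu>"
  have m1: "1 \<le> m" using m by simp
  have SSf: "finite SS" using SS_sub by (intro finite_subset[of SS "Pow {1..d}"]) auto
  have SSs: "\<And>S. S \<in> SS \<Longrightarrow> S \<subseteq> {1..d}" using SS_sub by blast
  have fS: "finite S" if "S \<in> SS" for S using finite_subset[OF SSs[OF that]] by simp
  have cs: "card S \<le> s" if "S \<in> SS" for S unfolding s_def using SSf that by (intro Max_ge) auto
  have fstar: "\<And>S. S \<in> SS \<Longrightarrow> fstar S \<in> HS m d S" using fstar_in by blast
  have lp: "\<And>n. 0 < lam n" using lam_pos by blast
  have JS0: "0 \<le> JS m d S (fstar S)" if "S \<in> SS" for S by (rule JS_nonneg[OF SSs[OF that] m1 fstar[OF that]])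
  have JSJ: "JS m d S (fstar S) \<le> J" if "S \<in> SS" for S
    unfolding J_def using SSf JS0 that by (intro member_le_sum) auto
  have nu_2: "integrable \<nu> (\<lambda>e. e\<^sup>2)"
  proof (rule Bochner_Integration.integrable_bound)
    interpret prob_space \<nu> by (rule nu_prob)
    show "integrable \<nu> (\<lambda>e. 1 + e ^ 4)" using nu_4 by simp
    have [measurable]: "(\<lambda>e. e) \<in> borel_measurable \<nu>" by (rule borel_measurable_integrable[OF nu_int])
    show "(\<lambda>e. e\<^sup>2) \<in> borel_measurable \<nu>" by measurable
    have "e\<^sup>2 \<le> 1 + e ^ 4" for e :: real
    proof -
      have "0 \<le> (e\<^sup>2 - 1)\<^sup>2 + e\<^sup>2 * e\<^sup>2 + 1" by (intro add_nonneg_nonneg mult_nonneg_nonneg) auto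
      then show ?thesis by (simp add: power2_eq_square power4_eq_xxxx algebra_simps)
    qed
    then show "AE e in \<nu>. norm (e\<^sup>2) \<le> norm (1 + e ^ 4)" by (intro AE_I2) simp
  qed
  have lam0: "lam \<longlonglongrightarrow> 0"
  proof (rule tendsto_sandwich[OF _ _ tendsto_const lam1])
    show "\<forall>\<^sub>F n in sequentially. 0 \<le> lam n" using lp by (simp add: less_imp_le)
    show "\<forall>\<^sub>F n in sequentially. lam n \<le> sqrt (real n) * lam n"
      using eventually_ge_at_top[of 1]
    proof eventually_elim
      case (elim n)
      then have "1 * lam n \<le> sqrt (real n) * lam n" using lp[of n] by (intro mult_right_mono) auto
      then show ?case by simp
    qed
  qed
  have Ltop: "filterlim (\<lambda>n. - ln (lam n)) at_top sequentially"
  proof -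
    have "filterlim lam (at_right 0) sequentially"
      using lam0 lp by (intro tendsto_imp_filterlim_at_right) auto
    then have "filterlim (\<lambda>n. ln (lam n)) at_bot sequentially" by (rule filterlim_compose[OF ln_at_0])
    then show ?thesis by (simp add: filterlim_uminus_at_top)
  qed
  have evL: "\<forall>\<^sub>F n in sequentially. 1 \<le> L n"
    using Ltop unfolding L_def filterlim_at_top by blast
  have t1: "1 \<le> t n" if "1 \<le> L n" for n
  proof -
    have "0 \<le> L n / (2 * real m)" using that by simp
    moreover have "t n = exp (L n / (2 * real m))" using lp[of n] by (simp add: t_def L_def powr_def)
    ultimately show ?thesis by simp
  qed
  have tp: "0 < t n" for n using lp[of n] by (simp add: t_def)
  have h1: "1 \<le> h n" if "1 \<le> L n" for n
  proof (cases "s = 0")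
    case False
    have "1 * 1 \<le> t n * L n ^ (s - 1)" using t1[OF that] one_le_power[OF that] by (intro mult_mono) auto
    then show ?thesis using False by (simp add: h_def)
  qed (simp add: h_def)
  have Se: "S = {}" if "s = 0" "S \<in> SS" for S using cs[OF that(2)] fS[OF that(2)] that(1) by simp
  have effh: "effdim m S (lam n) \<le> h n" if "S \<in> SS" "1 \<le> L n" for S n
  proof (cases "S = {}")
    case True
    then show ?thesis using h1[OF that(2)] by (simp add: effdim_def)
  next
    case False
    then have "s \<noteq> 0" using Se that by blast
    moreover have "t n * L n ^ (card S - 1) \<le> t n * L n ^ (s - 1)"
      using cs[OF that(1)] that(2) tp[of n] by (intro mult_left_mono power_increasing) auto
    ultimately show ?thesis using False by (simp add: effdim_def h_def t_def L_def)
  qed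
  have eff0: "0 \<le> effdim m S (lam n)" if "1 \<le> L n" for S n
    using that by (simp add: effdim_def L_def)
  have b2b: "(if S = {} then 1 else lam n powr (-1 / (2 * real m))) * effdim m S (lam n) * effdim m S' (lam n) \<le> b2 n"
    if "S \<in> SS" "S' \<in> SS" "1 \<le> L n" for S S' n
  proof (cases "s = 0")
    case True
    then show ?thesis using Se that by (simp add: b2_def effdim_def)
  next
    case False
    have "(if S = {} then 1 else t n) * effdim m S (lam n) * effdim m S' (lam n) \<le> t n * h n * h n"
      using t1[OF that(3)] h1[OF that(3)] effh that eff0 by (intro mult_mono mult_nonneg_nonneg) auto
    moreover have "b2 n = t n * h n * h n" using False by (simp add: b2_def power2_eq_square)
    ultimately show ?thesis unfolding t_def by simp
  qed
  have b2p: "0 < b2 n" if "1 \<le> L n" for n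
    using tp[of n] h1[OF that] by (auto simp: b2_def)
  \<comment> \<open>The first limit permits the absorption; the second makes its remainder, of order
    \<open>bn * rn\<close>, negligible against n^(-1/2).\<close>
  have asym: "bn \<longlonglongrightarrow> 0 \<and> (\<lambda>n. sqrt (real n) * bn n * rn n) \<longlonglongrightarrow> 0"
  proof (cases "s = 0")
    case True
    have "J = 0" unfolding J_def using Se[OF True] by (intro sum.neutral) (auto simp: JS_def)
    then have "bn = (\<lambda>n. sqrt (1 / real n))" "rn = (\<lambda>n. sqrt (1 / real n))"
      using True by (auto simp: bn_def rn_def b2_def h_def)
    moreover have "(\<lambda>n. sqrt (1 / real n)) \<longlonglongrightarrow> 0" "(\<lambda>n. sqrt (real n) * sqrt (1 / real n) * sqrt (1 / real n)) \<longlonglongrightarrow> 0"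
      by real_asymp+
    ultimately show ?thesis by simp
  next
    case False
    then have s1: "1 \<le> s" by simp
    have tau': "s = 1 \<longrightarrow> \<tau> = 0" "1 < s \<longrightarrow> 0 < \<tau> \<and> \<tau> < 2 * real m - 2" using tau by (auto simp: s_def)
    have ev: "\<forall>\<^sub>F n in sequentially. bn n \<le> beta_n m \<tau> s n (lam n) \<and> beta_n m \<tau> s n (lam n) * rn n = alpha_n m \<tau> s n (lam n) J
        \<and> 1 \<le> sqrt (real n) * rn n \<and> 0 \<le> bn n \<and> 0 \<le> rn n"
      using beta_n_lower[OF m s1 tau' lp Ltop] evL eventually_gt_at_top[of 0]
    proof eventually_elim
      case (elim n)
      have L0: "0 < - ln (lam n)" using elim(2) by (simp add: L_def)
      have b: "bn n = real n powr (-1/2) * lam n powr (-3 / (4 * real m)) * (- ln (lam n)) powr (real s - 1)"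
        using sqrt_gram_rate[OF s1 lp L0 elim(3), of m] False by (simp add: bn_def b2_def h_def t_def L_def)
      have hn: "sqrt (h n / real n) = real n powr (-1/2) * lam n powr (-1 / (4 * real m)) * (- ln (lam n)) powr ((real s - 1) / 2)"
      proof -
        \<comment> \<open>\<open>effdim\<close> depends on the set only through its cardinality, so
          \<open>{..<s}\<close> can stand for a component of maximal size.\<close>
        have "h n = effdim m {..<s} (lam n)" using False by (simp add: h_def effdim_def t_def L_def lessThan_empty_iff)
        then show ?thesis using sqrt_effdim[of "{..<s}" "lam n" n m] lp[of n] L0 elim(3) False by (simp add: lessThan_empty_iff)
      qed
      have J0: "0 \<le> J" unfolding J_def by (intro sum_nonneg JS0)
      have "sqrt (real n) * sqrt (h n / real n) = sqrt (h n)"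
        using elim(3) by (simp flip: real_sqrt_mult)
      moreover have "1 \<le> sqrt (h n)" using h1[OF elim(2)] by simp
      moreover have "0 \<le> sqrt (real n) * (sqrt (lam n) * sqrt J)" using J0 lp[of n] by simp
      ultimately have "1 \<le> sqrt (real n) * rn n" unfolding rn_def distrib_left by linarith
      moreover have "0 \<le> rn n" unfolding rn_def using J0 lp[of n] h1[OF elim(2)] by simp
      moreover have "0 \<le> bn n" unfolding bn_def using b2p[OF elim(2)] by simp
      ultimately show ?case using elim(1) by (simp add: b alpha_n_def rn_def hn)
    qed
    define q where "q n = sqrt (real n) * alpha_n m \<tau> s n (lam n) J" for n
    have q0: "q \<longlonglongrightarrow> 0" using lam3 unfolding q_def s_def J_def .
    have "\<forall>\<^sub>F n in sequentially. 0 \<le> bn n \<and> bn n \<le> q n \<and> 0 \<le> sqrt (real n) * bn n * rn n \<and> sqrt (real n) * bn n * rn n \<le> q n"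
      using ev
    proof eventually_elim
      case (elim n)
      let ?\<beta> = "beta_n m \<tau> s n (lam n)"
      have q: "q n = ?\<beta> * (sqrt (real n) * rn n)" unfolding q_def using elim by (metis mult.left_commute)
      have \<beta>0: "0 \<le> ?\<beta>" using elim by linarith
      \<comment> \<open>Because \<open>sqrt (real n) * rn n\<close> is at least 1, the hypothesis on
        \<open>alpha_n\<close> also forces \<open>bn\<close> itself to zero.\<close>
      have "bn n * 1 \<le> ?\<beta> * (sqrt (real n) * rn n)" using elim \<beta>0 by (intro mult_mono) auto
      moreover have "bn n * (sqrt (real n) * rn n) \<le> ?\<beta> * (sqrt (real n) * rn n)" using elim by (intro mult_right_mono) auto
      moreover have "0 \<le> sqrt (real n) * bn n * rn n" using elim by simp
      ultimately show ?case using elim unfolding q by (simp add: mult_ac)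
    qed
    then have evs: "\<forall>\<^sub>F n in sequentially. 0 \<le> bn n" "\<forall>\<^sub>F n in sequentially. bn n \<le> q n"
      "\<forall>\<^sub>F n in sequentially. 0 \<le> sqrt (real n) * bn n * rn n" "\<forall>\<^sub>F n in sequentially. sqrt (real n) * bn n * rn n \<le> q n"
      by (auto elim: eventually_mono)
    show ?thesis
      by (intro conjI tendsto_sandwich[OF evs(1,2) tendsto_const q0] tendsto_sandwich[OF evs(3,4) tendsto_const q0])
  qed
  let ?K = "CU m ^ d"
  let ?c = "real (card SS)"
  have K1: "1 \<le> ?K" using CU_pos by (rule one_le_power)
  have core: "\<exists>M N. \<forall>n\<ge>N. 1 \<le> L n \<and> 1 \<le> n \<and> 0 \<le> M \<and> (\<exists>A\<in>sets (sample_space d \<nu> n). measure (sample_space d \<nu> n) A < \<epsilon>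
     \<and> (\<forall>\<omega>\<in>space (sample_space d \<nu> n) - A. \<forall>S\<in>SS. Snorm m d (lam n) S (\<lambda>x. fhat n \<omega> S x - fstar S x)
         \<le> M * sqrt (effdim m S (lam n) / real n) + sqrt (lam n) * sqrt (JS m d S (fstar S)) + real n powr (-1/2)))"
    if \<epsilon>: "0 < \<epsilon>" for \<epsilon> :: real
  proof -
    \<comment> \<open>The summand 1 makes the total probability of the exceptional events strictly
      smaller than \<epsilon>.\<close>
    define M0 where "M0 = (?c + ?c\<^sup>2 + 1) / \<epsilon>"
    have M0: "0 < M0" unfolding M0_def using \<epsilon> by (intro divide_pos_pos add_nonneg_pos) auto
    have M0e: "(?c + ?c\<^sup>2) / M0 < \<epsilon>"
    proof -
      have "(?c + ?c\<^sup>2) < \<epsilon> * M0" using \<epsilon> by (simp add: M0_def)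
      then show ?thesis using M0 by (simp add: divide_less_eq)
    qed
    define G where "G = sqrt (108 ^ d * M0)"
    define M where "M = ?K * sqrt ((?\<sigma> + 1) * 6 ^ d * M0)"
    define T where "T n S = sqrt ((?\<sigma> + 1) * 6 ^ d * effdim m S (lam n) * M0 / real n)" for n S
    define B where "B n = sqrt (108 ^ d * b2 n * M0 / real n)" for n
    define a where "a n S = ?K * T n S + sqrt (lam n) * sqrt (JS m d S (fstar S))" for n S
    have \<sigma>0: "0 \<le> ?\<sigma>" by simp
    have M_0: "0 \<le> M" unfolding M_def using K1 \<sigma>0 M0 by simp
    have Beq: "B n = G * bn n" for n
      by (simp add: B_def G_def bn_def mult_ac flip: real_sqrt_mult)
    have Teq: "?K * T n S = M * sqrt (effdim m S (lam n) / real n)" for n S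
    proof -
      have "T n S = sqrt ((?\<sigma> + 1) * 6 ^ d * M0) * sqrt (effdim m S (lam n) / real n)"
        unfolding T_def real_sqrt_mult[symmetric] by (simp add: mult_ac)
      then show ?thesis by (simp add: M_def)
    qed
    have "(\<lambda>n. ?c * (?K * (G * bn n))) \<longlonglongrightarrow> ?c * (?K * (G * 0))" using asym by (intro tendsto_intros) auto
    then have ev1: "\<forall>\<^sub>F n in sequentially. ?c * (?K * (G * bn n)) < 1 / 2"
      by (rule order_tendstoD) simp
    have "(\<lambda>n. 2 * ?K * G * (?c * (M + 1)) * (sqrt (real n) * bn n * rn n)) \<longlonglongrightarrow> 2 * ?K * G * (?c * (M + 1)) * 0"
      using asym by (intro tendsto_intros) auto
    then have ev2: "\<forall>\<^sub>F n in sequentially. 2 * ?K * G * (?c * (M + 1)) * (sqrt (real n) * bn n * rn n) < 1"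
      by (rule order_tendstoD) simp
    have "\<forall>\<^sub>F n in sequentially. 1 \<le> L n \<and> 1 \<le> n \<and> 0 \<le> M \<and> (\<exists>A\<in>sets (sample_space d \<nu> n). measure (sample_space d \<nu> n) A < \<epsilon>
     \<and> (\<forall>\<omega>\<in>space (sample_space d \<nu> n) - A. \<forall>S\<in>SS. Snorm m d (lam n) S (\<lambda>x. fhat n \<omega> S x - fstar S x)
         \<le> M * sqrt (effdim m S (lam n) / real n) + sqrt (lam n) * sqrt (JS m d S (fstar S)) + real n powr (-1/2)))"
      using evL eventually_ge_at_top[of 1] ev1 ev2
    proof eventually_elim
      case (elim n)
      have n: "0 < n" using elim(2) by simp
      have mn: "is_pls_min m d SS n (\<lambda>i. fst (\<omega> i)) (\<lambda>i. (\<Sum>S\<in>SS. fstar S (fst (\<omega> i))) + snd (\<omega> i)) (lam n) (fhat n \<omega>)"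
        if "\<omega> \<in> space (sample_space d \<nu> n)" for \<omega> using fhat_min elim(2) that by blast
      have small: "?c * (?K * B n) \<le> 1 / 2" unfolding Beq using elim(3) by simp
      have L1: "1 \<le> - ln (lam n)" using elim(1) by (simp add: L_def)
      obtain A where A: "A \<in> sets (sample_space d \<nu> n)" "measure (sample_space d \<nu> n) A \<le> (?c + ?c\<^sup>2) / M0"
        "\<And>\<omega> S. \<omega> \<in> space (sample_space d \<nu> n) - A \<Longrightarrow> S \<in> SS \<Longrightarrow>
           Snorm m d (lam n) S (\<lambda>x. fhat n \<omega> S x - fstar S x) \<le> a n S + 2 * (?K * B n) * (\<Sum>S\<in>SS. a n S)"
        using pls_tail[OF SSf SSs m n lp L1 nu_prob nu_int nu_mean nu_2 fstar mn M0 b2p[OF elim(1)] b2b[OF _ _ elim(1)] T_def B_def small]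
        unfolding a_def by blast
      have J0: "0 \<le> J" unfolding J_def by (intro sum_nonneg JS0)
      have aS: "a n S \<le> (M + 1) * rn n" if "S \<in> SS" for S
      proof -
        have "M * sqrt (effdim m S (lam n) / real n) \<le> M * sqrt (h n / real n)"
          using effh[OF that elim(1)] n by (intro mult_left_mono real_sqrt_le_mono divide_right_mono M_0) auto
        also have "\<dots> \<le> (M + 1) * sqrt (h n / real n)" using h1[OF elim(1)] by (intro mult_right_mono) auto
        finally have 1: "?K * T n S \<le> (M + 1) * sqrt (h n / real n)" unfolding Teq .
        have "1 * (sqrt (lam n) * sqrt (JS m d S (fstar S))) \<le> (M + 1) * (sqrt (lam n) * sqrt J)"
          using M_0 lp[of n] JSJ[OF that] JS0[OF that] by (intro mult_mono) auto
        then show ?thesis using 1 unfolding a_def rn_def by (simp add: distrib_left)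
      qed
      have G0: "0 \<le> G" unfolding G_def using M0 by simp
      have bn0: "0 \<le> bn n" unfolding bn_def using b2p[OF elim(1)] by simp
      \<comment> \<open>The influence of the other components, which by \<open>ev2\<close> stays
        below n^(-1/2).\<close>
      have "2 * (?K * B n) * (\<Sum>S\<in>SS. a n S) \<le> 2 * (?K * B n) * (\<Sum>S\<in>SS. (M + 1) * rn n)"
        unfolding Beq using K1 G0 bn0 by (intro mult_left_mono sum_mono aS) auto
      also have "\<dots> = 2 * ?K * G * (?c * (M + 1)) * (sqrt (real n) * bn n * rn n) / sqrt (real n)"
        using n by (simp add: Beq mult_ac)
      also have "\<dots> \<le> 1 / sqrt (real n)" using elim(4) n by (intro divide_right_mono) auto
      also have "\<dots> = real n powr (-1/2)" using n by (simp add: powr_minus_divide powr_half_sqrt)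
      finally have tail: "2 * (?K * B n) * (\<Sum>S\<in>SS. a n S) \<le> real n powr (-1/2)" .
      have "Snorm m d (lam n) S (\<lambda>x. fhat n \<omega> S x - fstar S x)
         \<le> M * sqrt (effdim m S (lam n) / real n) + sqrt (lam n) * sqrt (JS m d S (fstar S)) + real n powr (-1/2)"
        if "\<omega> \<in> space (sample_space d \<nu> n) - A" "S \<in> SS" for \<omega> S
        using A(3)[OF that] tail unfolding a_def Teq by linarith
      then show ?case using elim(1,2) M_0 A(1,2) M0e by (meson le_less_trans)
    qed
    then show ?thesis unfolding eventually_sequentially by blast
  qed
  have sn0: "0 \<le> Snorm m d (lam n) S (\<lambda>x. fhat n \<omega> S x - fstar S x)"
    if "S \<in> SS" "1 \<le> n" "\<omega> \<in> space (sample_space d \<nu> n)" for n S \<omega>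
  proof -
    have fh: "fhat n \<omega> S \<in> HS m d S" using fhat_min that by (auto simp: is_pls_min_def)
    have "0 \<le> JS m d S (\<lambda>x. fhat n \<omega> S x - fstar S x)"
      using JS_nonneg[OF SSs[OF that(1)] m1 HS_lin[OF SSs[OF that(1)] m1 fh fstar[OF that(1)], of 1 "-1"]] by simp
    then show ?thesis unfolding Snorm_def VS_def using lp[of n] by simp
  qed
  \<comment> \<open>The possibly nonmeasurable sets in \<open>bigOP\<close> are covered by the event
    \<open>A\<close> of \<open>core\<close>. The constant \<open>M + 2\<close> leaves room for the
    bias and for the remainder n^(-1/2).\<close>
  have tobig: "bigOP (sample_space d \<nu>) (\<lambda>n \<omega>. Snorm m d (lam n) S (\<lambda>x. fhat n \<omega> S x - fstar S x)) r"
    if S: "S \<in> SS" and r: "\<And>M n. 0 \<le> M \<Longrightarrow> 1 \<le> L n \<Longrightarrow> 1 \<le> n \<Longrightarrow>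
        M * sqrt (effdim m S (lam n) / real n) + sqrt (lam n) * sqrt (JS m d S (fstar S)) + real n powr (-1/2) \<le> (M + 2) * r n" for S r
    unfolding bigOP_def
  proof (intro allI impI)
    fix \<epsilon> :: real assume "0 < \<epsilon>"
    then obtain M N where MN: "\<forall>n\<ge>N. 1 \<le> L n \<and> 1 \<le> n \<and> 0 \<le> M \<and> (\<exists>A\<in>sets (sample_space d \<nu> n). measure (sample_space d \<nu> n) A < \<epsilon>
     \<and> (\<forall>\<omega>\<in>space (sample_space d \<nu> n) - A. \<forall>S\<in>SS. Snorm m d (lam n) S (\<lambda>x. fhat n \<omega> S x - fstar S x)
         \<le> M * sqrt (effdim m S (lam n) / real n) + sqrt (lam n) * sqrt (JS m d S (fstar S)) + real n powr (-1/2)))"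
      using core by blast
    have "\<exists>A\<in>sets (sample_space d \<nu> n).
      {\<omega>\<in>space (sample_space d \<nu> n). \<bar>Snorm m d (lam n) S (\<lambda>x. fhat n \<omega> S x - fstar S x)\<bar> > (M + 2) * r n} \<subseteq> A
      \<and> measure (sample_space d \<nu> n) A < \<epsilon>" if nN: "n \<ge> N" for n
    proof -
      note MNn = MN[THEN spec, THEN mp, OF nN]
      have nL: "1 \<le> L n" "1 \<le> n" "0 \<le> M" using MNn by auto
      obtain A where A: "A \<in> sets (sample_space d \<nu> n)" "measure (sample_space d \<nu> n) A < \<epsilon>"
        "\<forall>\<omega>\<in>space (sample_space d \<nu> n) - A. \<forall>S\<in>SS. Snorm m d (lam n) S (\<lambda>x. fhat n \<omega> S x - fstar S x)
         \<le> M * sqrt (effdim m S (lam n) / real n) + sqrt (lam n) * sqrt (JS m d S (fstar S)) + real n powr (-1/2)"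
        using MNn[THEN conjunct2, THEN conjunct2, THEN conjunct2] by (elim bexE conjE) (rule that)
      have "\<omega> \<in> A" if \<omega>: "\<omega> \<in> space (sample_space d \<nu> n)" "\<bar>Snorm m d (lam n) S (\<lambda>x. fhat n \<omega> S x - fstar S x)\<bar> > (M + 2) * r n" for \<omega>
      proof (rule ccontr)
        assume "\<omega> \<notin> A"
        then have "Snorm m d (lam n) S (\<lambda>x. fhat n \<omega> S x - fstar S x)
         \<le> M * sqrt (effdim m S (lam n) / real n) + sqrt (lam n) * sqrt (JS m d S (fstar S)) + real n powr (-1/2)"
          using A(3) \<omega>(1) S by blast
        also have "\<dots> \<le> (M + 2) * r n" by (rule r[OF nL(3) nL(1,2)])
        finally show False using \<omega>(2) sn0[OF S nL(2) \<omega>(1)] by simp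
      qed
      then show ?thesis using A(1,2) by blast
    qed
    then show "\<exists>M N. \<forall>n\<ge>N. \<exists>A\<in>sets (sample_space d \<nu> n).
      {\<omega>\<in>space (sample_space d \<nu> n). \<bar>Snorm m d (lam n) S (\<lambda>x. fhat n \<omega> S x - fstar S x)\<bar> > M * r n} \<subseteq> A
      \<and> measure (sample_space d \<nu> n) A < \<epsilon>" by blast
  qed
  show ?thesis
  proof (intro conjI ballI)
    fix S assume "S \<in> SS - {{}}"
    then have S: "S \<in> SS" "S \<noteq> {}" by auto
    show "bigOP (sample_space d \<nu>) (\<lambda>n \<omega>. Snorm m d (lam n) S (\<lambda>x. fhat n \<omega> S x - fstar S x))
              (\<lambda>n. real n powr (-1/2) * lam n powr (-1 / (4 * real m))
                     * (- ln (lam n)) powr ((real (card S) - 1) / 2)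
                   + sqrt (lam n) * sqrt (JS m d S (fstar S)))"
    proof (rule tobig[OF S(1)])
      fix M :: real and n assume M: "0 \<le> M" and L: "1 \<le> L n" and n: "1 \<le> n"
      let ?e = "sqrt (effdim m S (lam n) / real n)" and ?j = "sqrt (lam n) * sqrt (JS m d S (fstar S))"
      have L0: "0 < - ln (lam n)" and n0: "0 < n" using L n by (auto simp: L_def)
      \<comment> \<open>An effective dimension of at least 1 makes the claimed rate at least
        n^(-1/2), so that it covers the remainder.\<close>
      have "1 * 1 \<le> t n * L n ^ (card S - 1)" using t1[OF L] one_le_power[OF L] by (intro mult_mono) auto
      then have "1 \<le> effdim m S (lam n)" using S(2) by (simp add: effdim_def t_def L_def)
      then have "sqrt (1 / real n) \<le> ?e" by (intro real_sqrt_le_mono divide_right_mono) auto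
      then have e: "real n powr (-1/2) \<le> ?e" using n0 by (simp add: powr_minus_divide powr_half_sqrt real_sqrt_divide)
      have j: "0 \<le> ?j" using lp[of n] JS0[OF S(1)] by simp
      have "0 \<le> ?e" using e by (rule order.trans[rotated]) simp
      then have "M * ?e + ?j + real n powr (-1/2) \<le> (M + 2) * (?e + ?j)"
        unfolding distrib_left distrib_right using e j mult_nonneg_nonneg[OF M j] by linarith
      then show "M * ?e + ?j + real n powr (-1/2) \<le> (M + 2) * (real n powr (-1/2) * lam n powr (-1 / (4 * real m))
                     * (- ln (lam n)) powr ((real (card S) - 1) / 2) + ?j)"
        unfolding sqrt_effdim[OF S(2) fS[OF S(1)] lp L0 n0] .
    qed
  next
    show "bigOP (sample_space d \<nu>) (\<lambda>n \<omega>. Snorm m d (lam n) {} (\<lambda>x. fhat n \<omega> {} x - fstar {} x)) (\<lambda>n. real n powr (-1/2))"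
    proof (rule tobig[OF SS_empty])
      fix M :: real and n :: nat assume M: "0 \<le> M" and n: "1 \<le> n"
      have "sqrt (effdim m {} (lam n) / real n) = real n powr (-1/2)"
        using n by (simp add: effdim_def powr_minus_divide powr_half_sqrt real_sqrt_divide)
      then show "M * sqrt (effdim m {} (lam n) / real n) + sqrt (lam n) * sqrt (JS m d {} (fstar {})) + real n powr (-1/2)
         \<le> (M + 2) * real n powr (-1/2)"
        by (simp add: JS_def algebra_simps)
    qed
  qed
qed

end
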